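(* (i) Let $p>2$ with $p\notin 2\mathbb N$, and let $\ell\in\mathbb N$ with $2\ell<p<2(\ell+1)$. There exists $q(p)<p$ such that for every symmetric open set $U\subset\mathbb T$ with $|U|>0$ and every $q>q(p)$, there exists a positive definite function $f\in L^{2\ell}(\mathbb T)$ whose negative Fourier coefficients are zero, such that $f\notin L^q(\mathbb T)$ while $f\in L^p(\mathbb T\setminus U)$. (ii) Let $0<p<2$. For every symmetric open set $U\subset\mathbb T$ with $|U|>0$ and all $0<s<q<p$, there exists $f$ in the Hardy space $H^s(\mathbb T)$ with nonnegative Fourier coefficients such that $f\notin H^q(\mathbb T)$ while its pointwise boundary value $f^*$ belongs to $L^p(\mathbb T\setminus U)$.
   Context: $\mathbb T=\mathbb R/\mathbb Z$ with Lebesgue measure $|\cdot|$; $U$ symmetric means $U=-U$. A positive definite function is an integrable function on $\mathbb T$ all of whose Fourier coefficients are nonnegative. For $q>0$, $H^q(\mathbb T)$ is the space of periodic distributions $f$ with $\hat f(n)=0$ for $n<0$ such that the functions $f_r(t)=\sum_n \hat f(n)r^{|n|}e^{2\pi i nt}$, $0<r<1$, are uniformly bounded in $L^q(\mathbb T)$, with $\|f\|_{H^q}^q=\sup_{0<r<1}\int_0^1|f_r|^q$. For $f\in H^q(\mathbb T)$, $f_r$ converges a.e. as $r\to1$ to a function $f^*\in L^q(\mathbb T)$, the pointwise boundary value. *)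

theory Defs
  imports "HOL-Analysis.Analysis"
begin

text \<open>The torus T = R/Z is modelled by the real line: functions on T are functions
  on the reals, only their values on the fundamental domain [0,1] matter; subsets of T
  are 1-periodic subsets of the reals.  Lebesgue measure on T is Lebesgue measure on [0,1].\<close>

definition torus_sym_open :: "real set \<Rightarrow> bool" where
  "torus_sym_open U \<longleftrightarrow> open U \<and> (\<forall>x. x \<in> U \<longleftrightarrow> x + 1 \<in> U)
     \<and> (\<forall>x. x \<in> U \<longleftrightarrow> - x \<in> U) \<and> measure lborel (U \<inter> {0..1}) > 0"

definition Lp_on :: "real set \<Rightarrow> real \<Rightarrow> (real \<Rightarrow> complex) \<Rightarrow> bool" where
  "Lp_on S p f \<longleftrightarrow> f \<in> borel_measurable (lebesgue_on S)
     \<and> integrable (lebesgue_on S) (\<lambda>t. norm (f t) powr p)"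

definition fourier_coeff :: "(real \<Rightarrow> complex) \<Rightarrow> int \<Rightarrow> complex" where
  "fourier_coeff f n = integral\<^sup>L (lebesgue_on {0..1})
      (\<lambda>t. f t * exp (- (2 * pi * \<i> * of_int n * of_real t)))"

definition positive_definite :: "(real \<Rightarrow> complex) \<Rightarrow> bool" where
  "positive_definite f \<longleftrightarrow> integrable (lebesgue_on {0..1}) f
     \<and> (\<forall>n. Im (fourier_coeff f n) = 0 \<and> Re (fourier_coeff f n) \<ge> 0)"

text \<open>Periodic distributions with vanishing negative coefficients are represented by
  their Fourier coefficient sequences c (of polynomial growth, c n = 0 for n < 0).
  The Abel means f_r.\<close>
definition abel_mean :: "(int \<Rightarrow> complex) \<Rightarrow> real \<Rightarrow> real \<Rightarrow> complex" where
  "abel_mean c r t = (\<Sum>n::nat. c (int n) * of_real (r ^ n) * exp (2 * pi * \<i> * of_nat n * of_real t))"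

definition in_Hardy :: "real \<Rightarrow> (int \<Rightarrow> complex) \<Rightarrow> bool" where
  "in_Hardy q c \<longleftrightarrow> (\<forall>n<0. c n = 0)
     \<and> (\<exists>C K. \<forall>n. norm (c n) \<le> C * (1 + real_of_int \<bar>n\<bar>) powr K)
     \<and> (\<forall>r\<in>{0<..<1}. Lp_on {0..1} q (abel_mean c r))
     \<and> (\<exists>B. \<forall>r\<in>{0<..<1}. integral\<^sup>L (lebesgue_on {0..1}) (\<lambda>t. norm (abel_mean c r t) powr q) \<le> B)"

definition boundary_value :: "(int \<Rightarrow> complex) \<Rightarrow> (real \<Rightarrow> complex) \<Rightarrow> bool" where
  "boundary_value c g \<longleftrightarrow>
     (AE t in lebesgue_on {0..1}. ((\<lambda>r. abel_mean c r t) \<longlongrightarrow> g t) (at_left 1))"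

end

theory Submission
  imports Defs
begin

text \<open>For polynomials with nonnegative coefficients and an exponent \<open>p\<close> that is not an even integer the
  Hardy--Littlewood majorant property fails: there is a polynomial \<open>P(w, u)\<close> with nonnegative coefficients
  whose \<open>L\<^sup>p\<close> norm in \<open>w\<close> is smaller at \<open>u = 1\<close> than at \<open>u = -1\<close>, even if the norm at \<open>u = -1\<close> is taken with a
  slightly smaller exponent \<open>q\<close> (any \<open>q < p\<close> if \<open>p < 2\<close>). Substituting \<open>w = z^M\<close> with large \<open>M\<close> and a power of \<open>z\<close>
  for \<open>u\<close> gives a function of one variable in which \<open>w\<close> is nearly independent of the position on the circle, and
  auxiliary factors make a symmetric pair of points of \<open>U\<close> win among all points with \<open>u = -1\<close>.
  Multiplying many such factors with rapidly increasing \<open>M\<close> raises the discrepancy to an arbitrarily high power: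
  one gets polynomials with large \<open>L\<^sup>q\<close> norm on \<open>U\<close> and small \<open>L\<^sup>s\<close> norm whose \<open>L\<^sup>p\<close> norm off \<open>U\<close> is small.
  A lacunary sum of such polynomials is the required function.\<close>

text \<open>On the circle a polynomial with nonnegative coefficients has its largest modulus at
  \<open>z = 1\<close> and equal moduli at \<open>t\<close> and \<open>- t\<close>. It cannot simply
  be made to peak in \<open>U\<close>; this explains the symmetry of \<open>U\<close> and the use of
  a mean over a second variable in place of the modulus. Write N1 for the norm of \<open>P\<close>
  at \<open>u = 1\<close> with exponent \<open>p\<close>, and Nm, Nq for the norms at
  \<open>u = -1\<close> with exponents \<open>p\<close>, \<open>q\<close>. The pair of points chosen
  in \<open>U\<close> offers Nq. It has to win against N1 at points with \<open>u = 1\<close> and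
  against Nm at the other points with \<open>u = -1\<close>, although Nm is at least Nq. A damping
  factor with value x at the pair and at most the square of x at these other points decides the
  contest if N1 < x Nq and x Nm < Nq. Such an x exists exactly if N1 Nm < Nq^2, which is the
  hypothesis \<open>gap\<close>. Since \<open>P\<close> is independent of \<open>U\<close>, so is
  the exponent q(p). Above 2 a first-order perturbation gives the gap for \<open>q\<close> close to
  \<open>p\<close>. Below 2 every \<open>q < p\<close> is allowed, so a small discrepancy is not
  enough: a family is needed along which N1 / Nq tends to 0 while Nm / Nq stays bounded.\<close>

subsection \<open>Equidistribution of a fast variable\<close>

definition circ :: "real \<Rightarrow> complex" where
  "circ t = cis (2 * pi * t)"

lemma norm_circ [simp]: "norm (circ t) = 1"
  by (simp add: circ_def)

lemma circ_add_one [simp]: "circ (t + 1) = circ t"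
  by (simp add: circ_def distrib_left flip: cis_mult)

lemma circ_add_of_nat [simp]: "circ (t + real n) = circ t"
proof (induction n)
  case (Suc n)
  have "circ (t + real (Suc n)) = circ ((t + real n) + 1)" by (simp add: algebra_simps)
  then show ?case using Suc by (simp only: circ_add_one)
qed simp

lemma circ_power: "circ t ^ n = circ (real n * t)"
proof -
  have "circ t ^ n = cis (real n * (2 * pi * t))" by (simp only: circ_def Complex.DeMoivre)
  also have "real n * (2 * pi * t) = 2 * pi * (real n * t)" by simp
  finally show ?thesis by (simp only: circ_def)
qed

lemma continuous_on_circ [continuous_intros]:
  "continuous_on S f \<Longrightarrow> continuous_on S (\<lambda>x. circ (f x))"
  unfolding circ_def by (intro continuous_intros)

lemma exp_eq_circ_power: "exp (2 * pi * \<i> * of_nat n * of_real t) = circ t ^ n"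
  by (simp only: circ_power) (simp add: circ_def cis_conv_exp mult_ac)

lemma integral_shift_periodic:
  fixes f :: "real \<Rightarrow> real"
  assumes cont: "continuous_on UNIV f" and per: "\<And>t. f (t + 1) = f t" and a: "0 \<le> a" "a \<le> 1"
  shows "integral {0..1} (\<lambda>t. f (t + a)) = integral {0..1} f"
proof -
  have int: "f integrable_on {c..d}" for c d
    by (rule integrable_continuous_interval) (rule continuous_on_subset[OF cont], simp)
  have shift: "integral {0..d} (\<lambda>t. f (t + c)) = integral {c..d + c} f" for c d
    using integral_shift_Icc_real[of 0 d f c] by (simp add: o_def add.commute)
  have "integral {0..1} (\<lambda>t. f (t + a)) = integral {a..1 + a} f"
    by (rule shift)
  also have "\<dots> = integral {a..1} f + integral {1..1 + a} f"
    using a Henstock_Kurzweil_Integration.integral_combine[where a=a and c=1 and b="1 + a" and f=f] int by auto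
  also have "integral {1..1 + a} f = integral {0..a} (\<lambda>t. f (t + 1))"
    using shift[of a 1] by (simp add: add.commute)
  also have "\<dots> = integral {0..a} f" by (simp add: per)
  also have "integral {a..1} f + integral {0..a} f = integral {0..1} f"
    using a Henstock_Kurzweil_Integration.integral_combine[where a=0 and c=a and b=1 and f=f] int by auto
  finally show ?thesis .
qed

lemma integral_uniform_close:
  fixes f g :: "real \<Rightarrow> real"
  assumes "continuous_on {0..1} f" "continuous_on {0..1} g"
    and "\<And>x. x \<in> {0..1} \<Longrightarrow> \<bar>f x - g x\<bar> \<le> e"
  shows "\<bar>integral {0..1} f - integral {0..1} g\<bar> \<le> e"
proof -
  have "\<bar>integral {0..1} (\<lambda>x. f x - g x)\<bar> \<le> e * (1 - 0)"
    using integral_bound[of 0 1 "\<lambda>x. f x - g x" e] assms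
    by (auto intro!: continuous_intros)
  then show ?thesis
    using assms by (simp add: integral_diff integrable_continuous_interval)
qed

text \<open>Shifting \<open>t\<close> by \<open>x / M\<close> and averaging over \<open>x\<close> decouples the fast variable \<open>M t\<close> from \<open>t\<close>.\<close>

lemma equidistribution_fast_variable:
  fixes \<psi> :: "real \<Rightarrow> real \<Rightarrow> real"
  assumes cont: "continuous_on UNIV (\<lambda>(x, t). \<psi> x t)"
    and per1: "\<And>x t. \<psi> (x + 1) t = \<psi> x t" and per2: "\<And>x t. \<psi> x (t + 1) = \<psi> x t"
  shows "(\<lambda>M. integral {0..1} (\<lambda>t. \<psi> (real M * t) t))
    \<longlonglongrightarrow> integral {0..1} (\<lambda>t. integral {0..1} (\<lambda>x. \<psi> x t))"
proof (rule LIMSEQ_I)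
  fix e :: real assume e: "e > 0"
  have cc: "continuous_on S (\<lambda>y. \<psi> (f y) (g y))"
    if "continuous_on S f" "continuous_on S g" for S and f g :: "'b::topological_space \<Rightarrow> real"
    using continuous_on_compose2[OF cont, of S "\<lambda>y. (f y, g y)"] that
    by (auto intro!: continuous_intros)
  have per1n: "\<psi> (x + real n) t = \<psi> x t" for x t n
  proof (induction n)
    case (Suc n)
    have "\<psi> (x + real (Suc n)) t = \<psi> ((x + real n) + 1) t" by (simp add: algebra_simps)
    then show ?case using Suc by (simp only: per1)
  qed simp
  \<comment> \<open>The second interval reaches to 2 because the shifted argument
    \<open>t + x / real M\<close> may exceed 1.\<close>
  have "uniformly_continuous_on ({0..1} \<times> {0..2}) (\<lambda>(x, t). \<psi> x t)"
    by (intro compact_uniformly_continuous continuous_on_subset[OF cont] compact_Times) auto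
  then obtain d where d: "d > 0" and close: "\<And>x t x' t'. x \<in> {0..1} \<Longrightarrow> t \<in> {0..2} \<Longrightarrow> x' \<in> {0..1} \<Longrightarrow> t' \<in> {0..2}
       \<Longrightarrow> dist (x', t') (x, t) < d \<Longrightarrow> dist (\<psi> x' t') (\<psi> x t) < e / 2"
    unfolding uniformly_continuous_on_def using e by (metis (no_types, lifting) half_gt_zero_iff mem_Sigma_iff old.prod.case)
  have close': "\<bar>\<psi> x t' - \<psi> x t\<bar> \<le> e / 2" if "t \<in> {0..2}" "t' \<in> {0..2}" "\<bar>t' - t\<bar> < d" "x \<ge> 0" for x t t'
  proof -
    have x: "x = frac x + real (nat \<lfloor>x\<rfloor>)" using that(4) by (simp add: frac_def)
    have "\<psi> x t = \<psi> (frac x) t" for t by (subst x) (rule per1n)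
    moreover have "dist (\<psi> (frac x) t') (\<psi> (frac x) t) < e / 2"
      by (rule close) (use that in \<open>auto simp: frac_ge_0 frac_lt_1 less_imp_le dist_Pair_Pair dist_real_def\<close>)
    ultimately show ?thesis by (simp add: dist_real_def)
  qed
  obtain M0 where M0: "real M0 > 1 / d" using reals_Archimedean2 by blast
  show "\<exists>M0. \<forall>M\<ge>M0. norm (integral {0..1} (\<lambda>t. \<psi> (real M * t) t)
      - integral {0..1} (\<lambda>t. integral {0..1} (\<lambda>x. \<psi> x t))) < e"
  proof (intro exI allI impI)
    fix M assume M: "M \<ge> Suc M0"
    then have Mpos: "real M > 0" and Md: "1 / real M < d" "1 / real M \<le> 1"
      using M0 d by (auto simp: field_simps intro: order.strict_trans2)
    have Mx: "x / real M < d" "0 \<le> x / real M" "x / real M \<le> 1" if "x \<in> {0..1}" for x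
    proof -
      have "x / real M \<le> 1 / real M" using that Mpos by (simp add: divide_right_mono)
      then show "x / real M < d" "x / real M \<le> 1" using Md by linarith+
    qed (use that in auto)
    have c0: "continuous_on UNIV (\<lambda>t. \<psi> (real M * t) t)" by (intro cc continuous_intros)
    have p0: "\<psi> (real M * (t + 1)) (t + 1) = \<psi> (real M * t) t" for t
      by (simp add: distrib_left per1n per2)
    define I where "I = integral {0..1} (\<lambda>t. \<psi> (real M * t) t)"
    have Ix: "I = integral {0..1} (\<lambda>t. \<psi> (real M * t + x) (t + x / real M))" if "x \<in> {0..1}" for x
    proof -
      have "I = integral {0..1} (\<lambda>t. \<psi> (real M * (t + x / real M)) (t + x / real M))"
        unfolding I_def
        using integral_shift_periodic[OF c0 p0, of "x / real M"] Mx[OF that] by simp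
      then show ?thesis using Mpos by (simp add: distrib_left)
    qed
    have near: "\<bar>I - integral {0..1} (\<lambda>t. \<psi> (real M * t + x) t)\<bar> \<le> e / 2" if "x \<in> {0..1}" for x
      unfolding Ix[OF that]
    proof (rule integral_uniform_close)
      fix t :: real assume t: "t \<in> {0..1}"
      show "\<bar>\<psi> (real M * t + x) (t + x / real M) - \<psi> (real M * t + x) t\<bar> \<le> e / 2"
        by (rule close') (use t Mx[OF that] that in auto)
    qed (intro cc continuous_intros; use Mpos in simp)+
    \<comment> \<open>After the swap the inner mean runs over a full period of the fast variable, on
      which the offset \<open>real M * t\<close> has no effect.\<close>
    have sw: "integral {0..1} (\<lambda>x. integral {0..1} (\<lambda>t. \<psi> (real M * t + x) t))
        = integral {0..1} (\<lambda>t. integral {0..1} (\<lambda>x. \<psi> (real M * t + x) t))"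
      using integral_swap_continuous[of 0 0 1 1 "\<lambda>x t. \<psi> (real M * t + x) t"]
      by (simp add: case_prod_unfold cc continuous_intros)
    have inner: "integral {0..1} (\<lambda>x. \<psi> (real M * t + x) t) = integral {0..1} (\<lambda>x. \<psi> x t)"
      if t: "t \<in> {0..1}" for t
    proof -
      have Mt: "real M * t = frac (real M * t) + real (nat \<lfloor>real M * t\<rfloor>)" using t by (simp add: frac_def)
      have "\<psi> (real M * t + x) t = \<psi> (x + frac (real M * t)) t" for x
        using per1n[of "x + frac (real M * t)" "nat \<lfloor>real M * t\<rfloor>" t] Mt by (simp add: algebra_simps)
      then have "integral {0..1} (\<lambda>x. \<psi> (real M * t + x) t) = integral {0..1} (\<lambda>x. \<psi> (x + frac (real M * t)) t)"
        by simp
      also have "\<dots> = integral {0..1} (\<lambda>x. \<psi> x t)"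
        by (intro integral_shift_periodic[of "\<lambda>x. \<psi> x t"] cc continuous_intros per1) (auto simp: frac_lt_1 less_imp_le)
      finally show ?thesis .
    qed
    have "\<bar>integral {0..1} (\<lambda>x::real. I) - integral {0..1} (\<lambda>x. integral {0..1} (\<lambda>t. \<psi> (real M * t + x) t))\<bar> \<le> e / 2"
    proof (rule integral_uniform_close)
      show "continuous_on {0..1} (\<lambda>x. integral {0..1} (\<lambda>t. \<psi> (real M * t + x) t))"
        using integral_continuous_on_param[of "{0..1}" 0 1 "\<lambda>x t. \<psi> (real M * t + x) t"]
        by (simp add: case_prod_unfold cc continuous_intros)
    qed (use near in auto)
    moreover have "integral {0..1} (\<lambda>t. integral {0..1} (\<lambda>x. \<psi> (real M * t + x) t)) = integral {0..1} (\<lambda>t. integral {0..1} (\<lambda>x. \<psi> x t))"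
      by (rule integral_cong) (rule inner)
    ultimately show "norm (integral {0..1} (\<lambda>t. \<psi> (real M * t) t)
      - integral {0..1} (\<lambda>t. integral {0..1} (\<lambda>x. \<psi> x t))) < e"
      using sw e by (simp add: I_def)
  qed
qed

subsection \<open>Riesz products\<close>

definition nnpoly :: "(complex \<Rightarrow> complex) \<Rightarrow> bool" where
  "nnpoly F \<longleftrightarrow> (\<exists>p. (\<forall>n. coeff p n \<in> \<real>\<^sub>\<ge>\<^sub>0) \<and> F = poly p)"

text \<open>Generated by the operations and not by a table of coefficients, so that continuity,
  composition and the passage to \<open>w = z ^ M\<close> are rule inductions.\<close>

inductive nnpoly2 :: "(complex \<Rightarrow> complex \<Rightarrow> complex) \<Rightarrow> bool" where
  const: "c \<ge> 0 \<Longrightarrow> nnpoly2 (\<lambda>w z. complex_of_real c)"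
| fst: "nnpoly2 (\<lambda>w z. w)"
| snd: "nnpoly2 (\<lambda>w z. z)"
| add: "nnpoly2 f \<Longrightarrow> nnpoly2 g \<Longrightarrow> nnpoly2 (\<lambda>w z. f w z + g w z)"
| mult: "nnpoly2 f \<Longrightarrow> nnpoly2 g \<Longrightarrow> nnpoly2 (\<lambda>w z. f w z * g w z)"

lemma nnpoly_poly: "(\<And>n. coeff p n \<in> \<real>\<^sub>\<ge>\<^sub>0) \<Longrightarrow> nnpoly (poly p)"
  by (auto simp: nnpoly_def)

lemma nnpoly_const: "c \<ge> 0 \<Longrightarrow> nnpoly (\<lambda>z. complex_of_real c)"
proof -
  assume "c \<ge> 0"
  moreover have "poly [:complex_of_real c:] = (\<lambda>z. complex_of_real c)" by (simp add: fun_eq_iff)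
  ultimately show ?thesis
    using nnpoly_poly[of "[:complex_of_real c:]"] by (simp add: coeff_pCons split: nat.splits)
qed

lemma nnpoly_monom: "nnpoly (\<lambda>z. z ^ M)"
proof -
  have "poly (monom 1 M) = (\<lambda>z::complex. z ^ M)" by (simp add: fun_eq_iff poly_monom)
  then show ?thesis using nnpoly_poly[of "monom 1 M"] by simp
qed

lemma nnpoly_add: "nnpoly f \<Longrightarrow> nnpoly g \<Longrightarrow> nnpoly (\<lambda>z. f z + g z)"
proof -
  assume "nnpoly f" "nnpoly g"
  then obtain p r where p: "\<forall>n. coeff p n \<in> \<real>\<^sub>\<ge>\<^sub>0" "f = poly p" and r: "\<forall>n. coeff r n \<in> \<real>\<^sub>\<ge>\<^sub>0" "g = poly r"
    by (auto simp: nnpoly_def)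
  then show ?thesis using nnpoly_poly[of "p + r"] by (simp add: nonneg_Reals_add_I fun_eq_iff flip: poly_add)
qed

lemma sum_nonneg_Reals: "(\<And>x. x \<in> A \<Longrightarrow> f x \<in> \<real>\<^sub>\<ge>\<^sub>0) \<Longrightarrow> sum f A \<in> (\<real>\<^sub>\<ge>\<^sub>0 :: complex set)"
  by (induction A rule: infinite_finite_induct) (auto intro: nonneg_Reals_add_I)

lemma nnpoly_mult: "nnpoly f \<Longrightarrow> nnpoly g \<Longrightarrow> nnpoly (\<lambda>z. f z * g z)"
proof -
  assume "nnpoly f" "nnpoly g"
  then obtain p r where p: "\<forall>n. coeff p n \<in> \<real>\<^sub>\<ge>\<^sub>0" "f = poly p" and r: "\<forall>n. coeff r n \<in> \<real>\<^sub>\<ge>\<^sub>0" "g = poly r"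
    by (auto simp: nnpoly_def)
  then have "coeff (p * r) n \<in> \<real>\<^sub>\<ge>\<^sub>0" for n
    by (auto simp: coeff_mult intro!: sum_nonneg_Reals nonneg_Reals_mult_I)
  then show ?thesis using nnpoly_poly[of "p * r"] p r by (simp add: fun_eq_iff flip: poly_mult)
qed

lemma nnpoly_diag: "nnpoly2 b \<Longrightarrow> nnpoly (\<lambda>z. b (z ^ M) z)"
proof (induction rule: nnpoly2.induct)
  case snd
  show ?case using nnpoly_monom[of 1] by simp
qed (auto intro: nnpoly_const nnpoly_monom nnpoly_add nnpoly_mult)

lemma continuous_on_nnpoly:
  fixes f :: "'a::topological_space \<Rightarrow> complex"
  assumes "nnpoly F" and "continuous_on S f"
  shows "continuous_on S (\<lambda>x. F (f x))"
  using assms by (auto simp: nnpoly_def intro!: continuous_intros)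

lemma continuous_on_nnpoly2:
  assumes "nnpoly2 b" "continuous_on S f" "continuous_on S g"
  shows "continuous_on S (\<lambda>x. b (f x) (g x))"
  using assms by (induction rule: nnpoly2.induct) (auto intro!: continuous_intros)

lemma nnpoly2_power: "nnpoly2 f \<Longrightarrow> nnpoly2 (\<lambda>w z. f w z ^ n)"
  by (induction n) (auto intro: nnpoly2.mult nnpoly2.const[of 1, simplified])

lemma nnpoly2_compose:
  "nnpoly2 b \<Longrightarrow> nnpoly2 F \<Longrightarrow> nnpoly2 G \<Longrightarrow> nnpoly2 (\<lambda>w z. b (F w z) (G w z))"
  by (induction rule: nnpoly2.induct) (auto intro: nnpoly2.intros)

text \<open>The mean over the fast variable with the slow one frozen at \<open>y\<close>. In the
  limit of large \<open>M\<close> it is the factor by which multiplying \<open>g\<close> by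
  \<open>b (z ^ M) z\<close> changes the local density of the \<open>p\<close>-th power of the
  modulus of \<open>g\<close>.\<close>

definition slice_mean :: "(complex \<Rightarrow> complex \<Rightarrow> complex) \<Rightarrow> real \<Rightarrow> real \<Rightarrow> real" where
  "slice_mean b p y = integral {0..1} (\<lambda>x. norm (b (circ x) (circ y)) powr p)"

lemma continuous_on_norm_powr [continuous_intros]:
  fixes f :: "'a::topological_space \<Rightarrow> complex"
  shows "continuous_on S f \<Longrightarrow> p > 0 \<Longrightarrow> continuous_on S (\<lambda>x. norm (f x) powr p)"
  by (intro continuous_on_powr' continuous_intros) auto

lemma continuous_on_slice_mean:
  assumes "nnpoly2 b" "p > 0"
  shows "continuous_on S (slice_mean b p)"
proof -
  have "continuous_on (S \<times> cbox 0 1) (\<lambda>(y, x). norm (b (circ x) (circ y)) powr p)"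
    unfolding case_prod_unfold
    by (intro continuous_intros continuous_on_nnpoly2[OF assms(1)] assms(2))
  then have "continuous_on S (\<lambda>y. integral (cbox 0 1) (\<lambda>x. norm (b (circ x) (circ y)) powr p))"
    by (rule integral_continuous_on_param)
  then show ?thesis by (simp add: slice_mean_def[abs_def])
qed

lemma slice_mean_add_one: "slice_mean b p (y + 1) = slice_mean b p y"
  by (simp add: slice_mean_def)

text \<open>The weight \<open>u\<close> allows the growth of an integral to be followed on the set
  where \<open>slice_mean\<close> lies on the desired side of 1. It is continuous so that
  equidistribution applies to the weighted integrand.\<close>

lemma riesz_factor_limit:
  fixes u :: "real \<Rightarrow> real"
  assumes b: "nnpoly2 b" and g: "nnpoly g" and p: "p > 0"
    and u: "continuous_on UNIV u" "\<And>t. u (t + 1) = u t"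
  shows "(\<lambda>M. integral {0..1} (\<lambda>t. u t * norm (g (circ t) * b (circ t ^ M) (circ t)) powr p))
    \<longlonglongrightarrow> integral {0..1} (\<lambda>t. u t * norm (g (circ t)) powr p * slice_mean b p t)"
proof -
  define \<psi> where "\<psi> x t = u t * norm (g (circ t)) powr p * norm (b (circ x) (circ t)) powr p" for x t
  have "(\<lambda>M. integral {0..1} (\<lambda>t. \<psi> (real M * t) t))
      \<longlonglongrightarrow> integral {0..1} (\<lambda>t. integral {0..1} (\<lambda>x. \<psi> x t))"
  proof (rule equidistribution_fast_variable)
    show "continuous_on UNIV (\<lambda>(x, t). \<psi> x t)"
      unfolding \<psi>_def case_prod_unfold
      by (intro continuous_intros continuous_on_nnpoly[OF g] continuous_on_nnpoly2[OF b] p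
          continuous_on_compose2[OF u(1)]) auto
  qed (auto simp: \<psi>_def u)
  moreover have "\<psi> (real M * t) t = u t * norm (g (circ t) * b (circ t ^ M) (circ t)) powr p" for M t
    by (simp add: \<psi>_def circ_power norm_mult powr_mult)
  moreover have "integral {0..1} (\<lambda>x. \<psi> x t) = u t * norm (g (circ t)) powr p * slice_mean b p t" for t
    unfolding \<psi>_def slice_mean_def by (rule integral_mult_right)
  ultimately show ?thesis by simp
qed

lemma compact_less_one_bound:
  fixes f :: "real \<Rightarrow> real"
  assumes "compact S" "continuous_on S f" "\<And>x. x \<in> S \<Longrightarrow> f x < 1"
  obtains k where "0 < k" "k < 1" "\<And>x. x \<in> S \<Longrightarrow> f x \<le> k"
proof (cases "S = {}")
  case False
  then obtain x where "x \<in> S" "\<And>y. y \<in> S \<Longrightarrow> f y \<le> f x"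
    using continuous_attains_sup[of S f] assms by blast
  then show ?thesis using assms(3) by (intro that[of "max (1/2) (f x)"]) force+
qed (use that[of "1/2"] in auto)

text \<open>Asymptotically each new factor multiplies the three integrals by at most \<kappa>, at
  most \<kappa> and at least \<mu>, where \<kappa> < 1 < \<mu>. The indicator of the complement of
  \<open>U\<close> is not continuous; the cut-off \<open>w\<close> replaces it and reaches only a
  little further, to where the \<open>p\<close>-mean is still below 1.\<close>

lemma riesz_product_concentration:
  assumes b: "nnpoly2 b" and pos: "0 < s" "0 < q" "0 < p" and U: "open U"
    and As: "\<And>t. t \<in> {0..1} \<Longrightarrow> slice_mean b s t < 1"
    and Ap: "\<And>t. t \<in> {0..1} - U \<Longrightarrow> slice_mean b p t < 1"
    and Aq: "t0 \<in> {0..1}" "slice_mean b q t0 > 1"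
  obtains w where "continuous_on UNIV w" "\<And>t. 0 \<le> w t" "\<And>t. w t \<le> (1::real)"
    "\<And>t. t \<in> {0..1} - U \<Longrightarrow> w t = 1"
    "\<And>\<epsilon> K. \<epsilon> > 0 \<Longrightarrow> \<exists>g. nnpoly g \<and> integral {0..1} (\<lambda>t. norm (g (circ t)) powr s) < \<epsilon>
       \<and> integral {0..1} (\<lambda>t. w t * norm (g (circ t)) powr p) < \<epsilon>
       \<and> integral {0..1} (\<lambda>t. norm (g (circ t)) powr q) > K"
proof -
  note contA = continuous_on_slice_mean[OF b]
  obtain ks where ks: "0 < ks" "ks < 1" "\<And>x. x \<in> {0..1} \<Longrightarrow> slice_mean b s x \<le> ks"
    by (rule compact_less_one_bound[of "{0..1}" "slice_mean b s"]) (use As contA pos in auto)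
  obtain k0 where k0: "0 < k0" "k0 < 1" "\<And>x. x \<in> {0..1} - U \<Longrightarrow> slice_mean b p x \<le> k0"
    by (rule compact_less_one_bound[of "{0..1} - U" "slice_mean b p"])
      (use Ap contA pos U in \<open>auto intro: compact_diff\<close>)
  define k1 where "k1 = (1 + k0) / 2"
  have k1: "k0 < k1" "k1 < 1" using k0 by (auto simp: k1_def)
  define \<kappa> where "\<kappa> = max ks k1"
  have \<kappa>: "0 < \<kappa>" "\<kappa> < 1" using ks k1 by (auto simp: \<kappa>_def)
  define \<mu> where "\<mu> = (1 + slice_mean b q t0) / 2"
  have \<mu>: "1 < \<mu>" "\<mu> < slice_mean b q t0" using Aq by (auto simp: \<mu>_def)
  \<comment> \<open>Equal to 1 where the \<open>p\<close>-mean is at most \<open>k0\<close>, and 0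
    where it is at least \<open>k1\<close>; hence the mean is at most \<kappa> wherever
    \<open>w\<close> is nonzero.\<close>
  define w where "w t = max 0 (min 1 ((k1 - slice_mean b p t) / (k1 - k0)))" for t
  \<comment> \<open>Supported where the \<open>q\<close>-mean exceeds \<mu>. It is positive at
    \<open>t0\<close>, so its integral is positive by continuity.\<close>
  define v where "v t = max 0 (slice_mean b q t - \<mu>)" for t
  have cw: "continuous_on UNIV w" unfolding w_def using contA pos k1
    by (intro continuous_intros) auto
  have cv: "continuous_on UNIV v" unfolding v_def using contA pos
    by (intro continuous_intros) auto
  have wper: "w (t + 1) = w t" and vper: "v (t + 1) = v t" for t
    by (simp_all add: w_def v_def slice_mean_add_one)
  have w01: "0 \<le> w t" "w t \<le> 1" for t by (auto simp: w_def)
  have w1: "w t = 1" if "t \<in> {0..1} - U" for t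
    using k0(3)[OF that] k1 by (simp add: w_def)
  have wA: "w t * slice_mean b p t \<le> w t * \<kappa>" for t
  proof (cases "w t = 0")
    case False
    then have "slice_mean b p t < k1" using k1 by (auto simp: w_def max_def min_def divide_simps split: if_splits)
    then show ?thesis using w01[of t] by (intro mult_left_mono) (auto simp: \<kappa>_def)
  qed simp
  have vA: "v t * \<mu> \<le> v t * slice_mean b q t" for t
    by (cases "v t = 0") (auto simp: v_def max_def intro!: mult_left_mono split: if_splits)
  have v0: "0 \<le> v t" for t by (simp add: v_def)
  define c where "c = integral {0..1} v / 2"
  have "integral {0..1} v \<noteq> 0"
  proof
    assume "integral {0..1} v = 0"
    then have "\<forall>t\<in>{0..1}. v t = 0"
      using integral_eq_0_iff[of 0 1 v] v0 continuous_on_subset[OF cv] by auto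
    then have "v t0 = 0" using Aq by blast
    then show False using \<mu> by (simp add: v_def)
  qed
  moreover have "integral {0..1} v \<ge> 0"
    by (rule integral_nonneg) (use v0 in \<open>auto intro!: integrable_continuous_interval continuous_on_subset[OF cv]\<close>)
  ultimately have c: "c > 0" by (simp add: c_def)
  have iint: "(\<lambda>t. u t * norm (g (circ t)) powr r) integrable_on {0..1}"
       "(\<lambda>t. u t * norm (g (circ t)) powr r * slice_mean b r t) integrable_on {0..1}"
    if "nnpoly g" "r > 0" "continuous_on UNIV u" for u :: "real \<Rightarrow> real" and g r
    by (intro integrable_continuous_interval continuous_intros continuous_on_nnpoly[OF that(1)]
        that(2) contA continuous_on_subset[OF that(3)] subset_UNIV)+
  \<comment> \<open>The constants 2 and \<open>c\<close> make the inequalities strict already at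
    \<open>n = 0\<close>; strictness is what allows a limit in \<open>M\<close> to be replaced by a
    finite \<open>M\<close>.\<close>
  have step: "\<exists>g. nnpoly g \<and> integral {0..1} (\<lambda>t. 1 * norm (g (circ t)) powr s) < 2 * \<kappa> ^ n
       \<and> integral {0..1} (\<lambda>t. w t * norm (g (circ t)) powr p) < 2 * \<kappa> ^ n
       \<and> integral {0..1} (\<lambda>t. v t * norm (g (circ t)) powr q) > c * \<mu> ^ n" for n
  proof (induction n)
    case 0
    have "integral {0..1} w \<le> integral {0..1} (\<lambda>t::real. 1)"
      by (rule integral_le) (use w01 in \<open>auto intro!: integrable_continuous_interval continuous_on_subset[OF cw]\<close>)
    then have w2: "integral {0..1} w < 2" by simp
    show ?case
      by (rule exI[of _ "\<lambda>z. 1"]) (use nnpoly_const[of 1] c w2 in \<open>auto simp: c_def\<close>)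
  next
    case (Suc n)
    then obtain g where g: "nnpoly g" "integral {0..1} (\<lambda>t. 1 * norm (g (circ t)) powr s) < 2 * \<kappa> ^ n"
       "integral {0..1} (\<lambda>t. w t * norm (g (circ t)) powr p) < 2 * \<kappa> ^ n"
       "integral {0..1} (\<lambda>t. v t * norm (g (circ t)) powr q) > c * \<mu> ^ n" by blast
    have c1: "continuous_on UNIV (\<lambda>t::real. 1::real)" by simp
    have "integral {0..1} (\<lambda>t. 1 * norm (g (circ t)) powr s * slice_mean b s t)
        \<le> integral {0..1} (\<lambda>t. \<kappa> * (1 * norm (g (circ t)) powr s))"
    proof (rule integral_le)
      fix t :: real assume "t \<in> {0..1}"
      then have "slice_mean b s t \<le> \<kappa>" using ks(3)[of t] by (simp add: \<kappa>_def)
      then show "1 * norm (g (circ t)) powr s * slice_mean b s t \<le> \<kappa> * (1 * norm (g (circ t)) powr s)"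
        using mult_left_mono[of "slice_mean b s t" \<kappa> "norm (g (circ t)) powr s"] by (simp add: mult_ac)
    qed (use iint[OF g(1) pos(1) c1] in \<open>auto intro: integrable_on_mult_right\<close>)
    also have "\<dots> < 2 * \<kappa> ^ Suc n" using g(2) \<kappa> by simp
    finally have l1: "integral {0..1} (\<lambda>t. 1 * norm (g (circ t)) powr s * slice_mean b s t) < 2 * \<kappa> ^ Suc n" .
    have "integral {0..1} (\<lambda>t. w t * norm (g (circ t)) powr p * slice_mean b p t)
        \<le> integral {0..1} (\<lambda>t. \<kappa> * (w t * norm (g (circ t)) powr p))"
    proof (rule integral_le)
      fix t :: real
      show "w t * norm (g (circ t)) powr p * slice_mean b p t \<le> \<kappa> * (w t * norm (g (circ t)) powr p)"
        using mult_right_mono[OF wA[of t], of "norm (g (circ t)) powr p"] by (simp add: mult_ac)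
    qed (use iint[OF g(1) pos(3) cw] in \<open>auto intro: integrable_on_mult_right\<close>)
    also have "\<dots> < 2 * \<kappa> ^ Suc n" using g(3) \<kappa> by simp
    finally have l2: "integral {0..1} (\<lambda>t. w t * norm (g (circ t)) powr p * slice_mean b p t) < 2 * \<kappa> ^ Suc n" .
    have "c * \<mu> ^ Suc n < integral {0..1} (\<lambda>t. \<mu> * (v t * norm (g (circ t)) powr q))"
      using g(4) \<mu> by (simp add: mult_ac)
    also have "\<dots> \<le> integral {0..1} (\<lambda>t. v t * norm (g (circ t)) powr q * slice_mean b q t)"
    proof (rule integral_le)
      fix t :: real
      show "\<mu> * (v t * norm (g (circ t)) powr q) \<le> v t * norm (g (circ t)) powr q * slice_mean b q t"
        using mult_right_mono[OF vA[of t], of "norm (g (circ t)) powr q"] by (simp add: mult_ac)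
    qed (use iint[OF g(1) pos(2) cv] in \<open>auto intro: integrable_on_mult_right\<close>)
    finally have l3: "c * \<mu> ^ Suc n < integral {0..1} (\<lambda>t. v t * norm (g (circ t)) powr q * slice_mean b q t)" .
    \<comment> \<open>All three strict bounds hold for every large \<open>M\<close>, so one and the
      same factor serves \<open>s\<close>, \<open>p\<close> and \<open>q\<close>.\<close>
    have "\<forall>\<^sub>F M in sequentially.
        integral {0..1} (\<lambda>t. 1 * norm (g (circ t) * b (circ t ^ M) (circ t)) powr s) < 2 * \<kappa> ^ Suc n
      \<and> integral {0..1} (\<lambda>t. w t * norm (g (circ t) * b (circ t ^ M) (circ t)) powr p) < 2 * \<kappa> ^ Suc n
      \<and> integral {0..1} (\<lambda>t. v t * norm (g (circ t) * b (circ t ^ M) (circ t)) powr q) > c * \<mu> ^ Suc n"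
      by (intro eventually_conj
          order_tendstoD(2)[OF riesz_factor_limit[OF b g(1) pos(1), of "\<lambda>_. 1"] l1]
          order_tendstoD(2)[OF riesz_factor_limit[OF b g(1) pos(3) cw wper] l2]
          order_tendstoD(1)[OF riesz_factor_limit[OF b g(1) pos(2) cv vper] l3]) auto
    then obtain M where M: "integral {0..1} (\<lambda>t. 1 * norm (g (circ t) * b (circ t ^ M) (circ t)) powr s) < 2 * \<kappa> ^ Suc n
      \<and> integral {0..1} (\<lambda>t. w t * norm (g (circ t) * b (circ t ^ M) (circ t)) powr p) < 2 * \<kappa> ^ Suc n
      \<and> integral {0..1} (\<lambda>t. v t * norm (g (circ t) * b (circ t ^ M) (circ t)) powr q) > c * \<mu> ^ Suc n"
      using eventually_happens' sequentially_bot by blast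
    show ?case
      by (rule exI[of _ "\<lambda>z. g z * b (z ^ M) z"]) (use M g(1) b in \<open>simp add: nnpoly_mult nnpoly_diag\<close>)
  qed
  have "bounded (v ` {0..1})"
    by (intro compact_imp_bounded compact_continuous_image continuous_on_subset[OF cv]) auto
  then obtain C where C: "C > 0" "\<And>t. t \<in> {0..1} \<Longrightarrow> v t \<le> C"
    unfolding bounded_pos by (force simp: image_iff)
  have fin: "\<exists>g. nnpoly g \<and> integral {0..1} (\<lambda>t. norm (g (circ t)) powr s) < \<epsilon>
       \<and> integral {0..1} (\<lambda>t. w t * norm (g (circ t)) powr p) < \<epsilon>
       \<and> integral {0..1} (\<lambda>t. norm (g (circ t)) powr q) > K" if "\<epsilon> > 0" for \<epsilon> K
  proof -
    have "(\<lambda>n. 2 * \<kappa> ^ n) \<longlonglongrightarrow> 2 * 0"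
      using \<kappa> by (intro tendsto_intros) auto
    then have e1: "\<forall>\<^sub>F n in sequentially. 2 * \<kappa> ^ n < \<epsilon>" using that by (intro order_tendstoD(2)) auto
    have "filterlim (\<lambda>n. \<mu> ^ n) at_top sequentially"
      using \<mu> filterlim_realpow_sequentially_gt1[of \<mu>] filterlim_at_infinity_imp_filterlim_at_top[of "\<lambda>n. \<mu> ^ n"] by auto
    then have e2: "\<forall>\<^sub>F n in sequentially. \<mu> ^ n \<ge> C * K / c" by (simp add: filterlim_at_top)
    obtain n where n: "2 * \<kappa> ^ n < \<epsilon>" "\<mu> ^ n \<ge> C * K / c"
      using eventually_happens'[OF sequentially_bot eventually_conj[OF e1 e2]] by auto
    obtain g where g: "nnpoly g" "integral {0..1} (\<lambda>t. 1 * norm (g (circ t)) powr s) < 2 * \<kappa> ^ n"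
       "integral {0..1} (\<lambda>t. w t * norm (g (circ t)) powr p) < 2 * \<kappa> ^ n"
       "integral {0..1} (\<lambda>t. v t * norm (g (circ t)) powr q) > c * \<mu> ^ n" using step[of n] by blast
    have "C * K \<le> c * \<mu> ^ n" using n(2) c by (simp add: field_simps)
    also note g(4)
    also have "integral {0..1} (\<lambda>t. v t * norm (g (circ t)) powr q) \<le> integral {0..1} (\<lambda>t. C * norm (g (circ t)) powr q)"
      by (rule integral_le) (use iint(1)[OF g(1) pos(2)] cv C(2) in \<open>auto intro: mult_right_mono\<close>)
    finally have "K < integral {0..1} (\<lambda>t. norm (g (circ t)) powr q)" using C(1) by simp
    then show ?thesis using g n(1) by (intro exI[of _ g]) auto
  qed
  show ?thesis by (rule that[OF cw w01 w1 fin])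
qed

subsection \<open>Lacunary sums\<close>

text \<open>Multiplication by a high power of \<open>z\<close> leaves the modulus on the circle unchanged but kills the
  polynomial away from it, so the radial maximal function needs no Hardy space theory.\<close>

lemma monomial_shift_radial_bound:
  assumes g: "nnpoly g" and e: "\<epsilon> > 0"
  obtains M0 where "\<And>M r t. M \<ge> M0 \<Longrightarrow> 0 \<le> r \<Longrightarrow> r \<le> 1 \<Longrightarrow>
     norm ((of_real r * circ t) ^ M * g (of_real r * circ t)) \<le> norm (g (circ t)) + \<epsilon>"
proof -
  have cont: "continuous_on (cball 0 1) g"
    using continuous_on_nnpoly[OF g, of "cball 0 1" "\<lambda>x. x"] by simp
  then have "uniformly_continuous_on (cball 0 1) g"
    by (intro compact_uniformly_continuous) auto
  then obtain d where d: "d > 0" and close: "\<And>x y. x \<in> cball 0 1 \<Longrightarrow> y \<in> cball 0 1 \<Longrightarrow> dist y x < d \<Longrightarrow> dist (g y) (g x) < \<epsilon>"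
    unfolding uniformly_continuous_on_def using e by meson
  have "bounded (g ` cball 0 1)"
    by (intro compact_imp_bounded compact_continuous_image cont) auto
  then obtain B where B: "B > 0" "\<And>x. x \<in> cball 0 1 \<Longrightarrow> norm (g x) \<le> B"
    unfolding bounded_pos by auto
  \<comment> \<open>Radii up to \<rho> are killed by \<open>r ^ M\<close>; for radii beyond \<rho>
    the point is within \<open>d\<close> of the circle and uniform continuity applies.\<close>
  define \<rho> where "\<rho> = max 0 (1 - d / 2)"
  have \<rho>: "0 \<le> \<rho>" "\<rho> < 1" using d by (auto simp: \<rho>_def)
  have "(\<lambda>M. \<rho> ^ M * B) \<longlonglongrightarrow> 0 * B" using \<rho> by (intro tendsto_intros) auto
  then have "\<forall>\<^sub>F M in sequentially. \<rho> ^ M * B < \<epsilon>" using e by (intro order_tendstoD(2)) auto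
  then obtain M0 where M0: "\<And>M. M \<ge> M0 \<Longrightarrow> \<rho> ^ M * B < \<epsilon>" by (auto simp: eventually_sequentially)
  show ?thesis
  proof (rule that)
    fix M r t assume M: "M \<ge> M0" and r: "0 \<le> r" "r \<le> (1::real)"
    have in1: "of_real r * circ t \<in> cball 0 1" using r by (simp add: norm_mult)
    have eq: "norm ((of_real r * circ t) ^ M * g (of_real r * circ t)) = r ^ M * norm (g (of_real r * circ t))"
      using r by (simp add: norm_mult norm_power)
    show "norm ((of_real r * circ t) ^ M * g (of_real r * circ t)) \<le> norm (g (circ t)) + \<epsilon>"
    proof (cases "r \<le> \<rho>")
      case True
      have "r ^ M * norm (g (of_real r * circ t)) \<le> \<rho> ^ M * B"
        using True r B(2)[OF in1] by (intro mult_mono power_mono) auto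
      then show ?thesis unfolding eq using M0[OF M] by (smt (verit) norm_ge_zero)
    next
      case False
      have "of_real r * circ t - circ t = of_real (r - 1) * circ t" by (simp add: algebra_simps)
      then have "dist (of_real r * circ t) (circ t) = \<bar>r - 1\<bar>"
        by (simp only: dist_norm norm_mult norm_circ norm_of_real mult_1_right)
      then have "dist (of_real r * circ t) (circ t) < d" using False d r by (auto simp: \<rho>_def)
      then have "dist (g (of_real r * circ t)) (g (circ t)) < \<epsilon>" using in1 by (intro close) auto
      then have "norm (g (of_real r * circ t)) \<le> norm (g (circ t)) + \<epsilon>"
        unfolding dist_norm by norm
      moreover have "r ^ M * norm (g (of_real r * circ t)) \<le> 1 * norm (g (of_real r * circ t))"
        using r by (intro mult_right_mono power_le_one) auto
      ultimately show ?thesis unfolding eq by linarith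
    qed
  qed
qed

text \<open>The shift serves three ends: a spectrum beyond \<open>N0\<close>, the radial bound, and
  \<open>c n \<le> real n\<close>. By the last one the sup norm of a block is controlled by the
  place where it ends, whatever its coefficients, so the thresholds for later blocks can be fixed in
  advance.\<close>

lemma nnpoly_shifted_block:
  assumes g: "nnpoly g" and e: "\<epsilon> > 0"
  obtains c N1 where "N0 < N1" "\<And>n. 0 \<le> c n" "\<And>n. c n \<le> real n"
    "\<And>n. c n \<noteq> 0 \<Longrightarrow> N0 \<le> n \<and> n < N1"
    "\<And>t. norm (\<Sum>n<N1. of_real (c n) * circ t ^ n) = norm (g (circ t))"
    "\<And>r t. 0 \<le> r \<Longrightarrow> r \<le> 1 \<Longrightarrow>
       norm (\<Sum>n<N1. of_real (c n) * (of_real r * circ t) ^ n) \<le> norm (g (circ t)) + \<epsilon>"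
proof -
  obtain p where p: "\<And>n. coeff p n \<in> \<real>\<^sub>\<ge>\<^sub>0" "g = poly p" using g by (auto simp: nnpoly_def)
  define a where "a n = Re (coeff p n)" for n
  have a: "0 \<le> a n" "coeff p n = of_real (a n)" for n
    using p(1)[of n] by (auto simp: a_def nonneg_Reals_def)
  obtain M0 where M0: "\<And>M r t. M \<ge> M0 \<Longrightarrow> 0 \<le> r \<Longrightarrow> r \<le> 1 \<Longrightarrow>
     norm ((of_real r * circ t) ^ M * g (of_real r * circ t)) \<le> norm (g (circ t)) + \<epsilon>"
    using monomial_shift_radial_bound[OF g e] by blast
  define d where "d = degree p"
  obtain M1 :: nat where M1: "(\<Sum>i\<le>d. a i) \<le> real M1" using real_arch_simple by blast
  define M where "M = M0 + M1 + N0"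
  define c where "c n = (if M \<le> n then a (n - M) else 0)" for n
  have ale: "a i \<le> real M" for i
  proof (cases "i \<le> d")
    case True
    then have "a i \<le> (\<Sum>i\<le>d. a i)" using a by (intro member_le_sum) auto
    then show ?thesis using M1 by (simp add: M_def)
  next
    case False
    then show ?thesis by (simp add: a_def coeff_eq_0 d_def)
  qed
  have eval: "(\<Sum>n<M + Suc d. of_real (c n) * z ^ n) = z ^ M * g z" for z
  proof -
    have "(\<Sum>n<M + Suc d. of_real (c n) * z ^ n) = (\<Sum>n=M..<M + Suc d. of_real (c n) * z ^ n)"
      by (rule sum.mono_neutral_right) (auto simp: c_def)
    also have "\<dots> = (\<Sum>i<Suc d. of_real (c (i + M)) * z ^ (i + M))"
      using sum.shift_bounds_nat_ivl[of "\<lambda>n. of_real (c n) * z ^ n" 0 M "Suc d"]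
      by (simp add: add.commute atLeast0LessThan)
    also have "\<dots> = z ^ M * (\<Sum>i\<le>d. coeff p i * z ^ i)"
      unfolding lessThan_Suc_atMost sum_distrib_left
      by (intro sum.cong) (auto simp: c_def a power_add mult_ac)
    finally show ?thesis by (simp add: p(2) poly_altdef d_def)
  qed
  show ?thesis
  proof (rule that[of "M + Suc d" c])
    show "N0 < M + Suc d" by (simp add: M_def)
    show "0 \<le> c n" for n using a by (simp add: c_def)
    show "c n \<le> real n" for n
    proof (cases "M \<le> n")
      case True
      then have "c n = a (n - M)" "real M \<le> real n" by (auto simp: c_def)
      then show ?thesis using ale[of "n - M"] by linarith
    qed (simp add: c_def)
    show "N0 \<le> n \<and> n < M + Suc d" if "c n \<noteq> 0" for n
      using that by (auto simp: c_def M_def a_def d_def split: if_splits dest: le_degree) (metis add.commute coeff_eq_0 complex_Re_numeral le_diff_conv le_imp_less_Suc linorder_not_less zero_complex.sel(1))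
    show "norm (\<Sum>n<M + Suc d. of_real (c n) * circ t ^ n) = norm (g (circ t))" for t
      unfolding eval by (simp add: norm_mult norm_power)
    show "norm (\<Sum>n<M + Suc d. of_real (c n) * (of_real r * circ t) ^ n) \<le> norm (g (circ t)) + \<epsilon>"
      if "0 \<le> r" "r \<le> 1" for r t
      unfolding eval by (rule M0) (use that in \<open>auto simp: M_def\<close>)
  qed
qed

text \<open>One argument for all \<theta> > 0, with no distinction between subadditivity below 1 and
  Minkowski above 1: each weighted term is at most the whole sum, so \<open>x j\<close> is at most
  its \<open>1 / \<theta>\<close>-th power times \<open>(1 / 2) ^ Suc j\<close>, and these geometric
  factors add up to 1.\<close>

lemma weighted_powr_suminf:
  fixes x :: "nat \<Rightarrow> real"
  assumes x: "\<And>j. 0 \<le> x j" and th: "\<theta> > 0"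
    and sm: "summable (\<lambda>j. (2 powr \<theta>) ^ Suc j * x j powr \<theta>)"
  shows "summable x" "suminf x powr \<theta> \<le> (\<Sum>j. (2 powr \<theta>) ^ Suc j * x j powr \<theta>)"
proof -
  define S where "S = (\<Sum>j. (2 powr \<theta>) ^ Suc j * x j powr \<theta>)"
  have eq: "(2 powr \<theta>) ^ Suc j * x j powr \<theta> = (2 ^ Suc j * x j) powr \<theta>" for j
    using x by (simp add: powr_mult powr_realpow[symmetric] powr_powr mult_ac powr_add del: power_Suc)
  have le: "(2 ^ Suc j * x j) powr \<theta> \<le> S" for j
    unfolding eq[symmetric] S_def
    using sum_le_suminf[OF sm, of "{j}"] by simp
  have S0: "0 \<le> S" by (rule order_trans[OF _ le[of 0]]) simp
  have xj: "x j \<le> S powr (1 / \<theta>) * (1 / 2) ^ Suc j" for j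
  proof -
    have "2 ^ Suc j * x j = ((2 ^ Suc j * x j) powr \<theta>) powr (1 / \<theta>)"
      using th x[of j] by (simp add: powr_powr)
    also have "\<dots> \<le> S powr (1 / \<theta>)" using le th by (intro powr_mono2) auto
    finally show ?thesis by (simp add: field_simps power_one_over)
  qed
  have geo: "(\<lambda>j. S powr (1 / \<theta>) * (1 / 2) ^ Suc j) sums (S powr (1 / \<theta>) * 1)"
    by (intro sums_mult power_half_series)
  show smx: "summable x"
    by (rule summable_comparison_test'[OF sums_summable[OF geo], of 0]) (use x xj in auto)
  have "suminf x \<le> S powr (1 / \<theta>)"
    using suminf_le[OF xj smx sums_summable[OF geo]] sums_unique[OF geo] by simp
  then have "suminf x powr \<theta> \<le> (S powr (1 / \<theta>)) powr \<theta>"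
    using th suminf_nonneg[OF smx] x by (intro powr_mono2) auto
  also have "\<dots> = S" using th S0 by (simp add: powr_powr)
  finally show "suminf x powr \<theta> \<le> S" .
qed

lemma integrable_suminf_nonneg:
  fixes f :: "nat \<Rightarrow> 'a \<Rightarrow> real"
  assumes int: "\<And>j. integrable M (f j)" and pos: "\<And>j x. 0 \<le> f j x"
    and sm: "summable (\<lambda>j. integral\<^sup>L M (f j))"
  shows "AE x in M. summable (\<lambda>j. f j x)"
    "integrable M (\<lambda>x. \<Sum>j. f j x)" "integral\<^sup>L M (\<lambda>x. \<Sum>j. f j x) = (\<Sum>j. integral\<^sup>L M (f j))"
proof -
  have [measurable]: "f j \<in> borel_measurable M" for j using int by auto
  have "(\<integral>\<^sup>+x. (\<Sum>j. ennreal (f j x)) \<partial>M) = (\<Sum>j. \<integral>\<^sup>+x. ennreal (f j x) \<partial>M)"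
    by (rule nn_integral_suminf) auto
  also have "\<dots> = (\<Sum>j. ennreal (integral\<^sup>L M (f j)))"
    using int pos by (simp add: nn_integral_eq_integral)
  also have "\<dots> = ennreal (\<Sum>j. integral\<^sup>L M (f j))"
    using sm pos by (intro suminf_ennreal2) auto
  finally have "(\<integral>\<^sup>+x. (\<Sum>j. ennreal (f j x)) \<partial>M) \<noteq> \<infinity>" by simp
  then have "AE x in M. (\<Sum>j. ennreal (f j x)) \<noteq> \<infinity>"
    by (intro nn_integral_PInf_AE) auto
  then show ae: "AE x in M. summable (\<lambda>j. f j x)"
    by eventually_elim (use pos in \<open>auto intro: summable_suminf_not_top\<close>)
  have ae': "AE x in M. summable (\<lambda>j. norm (f j x))" using ae pos by simp
  have sm': "summable (\<lambda>j. LINT x|M. norm (f j x))" using sm pos by simp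
  show "integrable M (\<lambda>x. \<Sum>j. f j x)" by (rule integrable_suminf[OF int ae' sm'])
  show "integral\<^sup>L M (\<lambda>x. \<Sum>j. f j x) = (\<Sum>j. integral\<^sup>L M (f j))" by (rule integral_suminf[OF int ae' sm'])
qed

lemma integral_lebesgue_on_continuous:
  fixes F :: "real \<Rightarrow> real"
  assumes "continuous_on {0..1} F"
  shows "integrable (lebesgue_on {0..1}) F" "integral\<^sup>L (lebesgue_on {0..1}) F = integral {0..1} F"
  using continuous_imp_integrable_real[OF assms] lebesgue_integral_eq_integral[of "{0..1}" F] by auto

text \<open>Differentiating the geometric series twice gives the coefficients
  \<open>(n + 1) * (n + 2)\<close>, which dominate.\<close>

lemma summable_quadratic_powser:
  assumes "\<bar>r\<bar> < 1"
  shows "summable (\<lambda>n. (1 + real n) ^ 2 * r ^ n)"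
proof -
  have s1: "summable (\<lambda>n. diffs (\<lambda>_. 1) n * x ^ n)" if "norm x < 1" for x :: real
    using that by (intro termdiff_converges[of x 1]) auto
  have "summable (\<lambda>n. diffs (diffs (\<lambda>_. 1)) n * \<bar>r\<bar> ^ n)"
    using assms s1 by (intro termdiff_converges[of _ 1]) auto
  then show ?thesis
    by (rule summable_comparison_test'[of _ 0])
      (auto simp: diffs_def power2_eq_square abs_mult power_abs intro!: mult_right_mono mult_mono)
qed

lemma powr_sum3_le:
  fixes a b c q :: real
  assumes "0 \<le> a" "0 \<le> b" "0 \<le> c" "q > 0"
  shows "(a + b + c) powr q \<le> 3 powr q * (a powr q + b powr q + c powr q)"
proof -
  define m where "m = max a (max b c)"
  have m: "0 \<le> m" "a + b + c \<le> 3 * m" using assms by (auto simp: m_def)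
  have "(a + b + c) powr q \<le> (3 * m) powr q" using assms m by (intro powr_mono2) auto
  also have "\<dots> = 3 powr q * m powr q" using m by (simp add: powr_mult)
  also have "m powr q \<le> a powr q + b powr q + c powr q"
    by (auto simp: m_def max_def)
  finally show ?thesis by simp
qed

text \<open>The two summands belong to two cases. A tail of size at most 1 leaves \<open>g\<close>
  within a bounded distance of \<open>f\<close>. Where the tail is larger, the crude bound
  \<open>G powr q\<close> may be multiplied by \<open>Y powr s \<ge> 1\<close>; this is Chebyshev's
  inequality in pointwise form, and it lets smallness in the exponent \<open>s\<close> act on an
  estimate in the exponent \<open>q\<close>.\<close>

lemma tail_perturbation_bound:
  fixes f S g T :: complex
  assumes f: "f = S + g + T" and S: "norm S \<le> B" and g: "norm g \<le> G" and T: "norm T \<le> Y"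
    and pos: "q > 0" "s > 0"
  shows "norm g powr q \<le> 3 powr q * (norm f powr q + B powr q + 1) + G powr q * Y powr s"
proof (cases "Y \<le> 1")
  case True
  have B: "0 \<le> B" using S norm_ge_zero order_trans by blast
  have "g = f - S - T" using f by simp
  then have "norm g \<le> norm f + norm S + norm T"
    by (metis norm_triangle_ineq4 add_right_mono order_trans)
  then have "norm g \<le> norm f + B + 1" using S T True by linarith
  then have "norm g powr q \<le> (norm f + B + 1) powr q" using pos by (intro powr_mono2) auto
  also have "\<dots> \<le> 3 powr q * (norm f powr q + B powr q + 1 powr q)"
    using B pos by (intro powr_sum3_le) auto
  finally show ?thesis by (simp add: add_increasing2)
next
  case False
  have "norm g powr q \<le> G powr q * 1" using g pos by (simp add: powr_mono2)
  also have "\<dots> \<le> G powr q * Y powr s" using False pos by (intro mult_left_mono ge_one_powr_ge_zero) auto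
  finally show ?thesis by (simp add: add_increasing)
qed

lemma integrable_lebesgue_on_subset:
  fixes f :: "real \<Rightarrow> real"
  assumes "integrable (lebesgue_on S) f" "T \<subseteq> S" "S \<in> sets lebesgue" "T \<in> sets lebesgue"
  shows "integrable (lebesgue_on T) f"
  using assms set_integrable_subset[of lebesgue S f T]
  by (simp add: set_integrable_def integrable_restrict_space)

lemma borel_measurable_lebesgue_on_of_borel:
  "f \<in> borel_measurable borel \<Longrightarrow> f \<in> borel_measurable (lebesgue_on S)"
  by (rule measurable_restrict_space1) (simp add: measurable_completion)

lemma integrable_const_lebesgue_on_unit:
  "integrable (lebesgue_on {0..1}) (\<lambda>t::real. a::real)"
  "integral\<^sup>L (lebesgue_on {0..1}) (\<lambda>t::real. a::real) = a"
  using integral_lebesgue_on_continuous[of "\<lambda>_. a"] by auto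

text \<open>The blocks have disjoint spectra and thresholds depending only on where the previous block ends.
  The sum escapes \<open>L\<^sup>q\<close> because each tail is small in \<open>L\<^sup>s\<close> compared with the sup norm of the block before it.\<close>

lemma glue_blocks:
  fixes s q p :: real and w :: "real \<Rightarrow> real"
  assumes pos: "0 < s" "0 < q" "0 < p" and U: "open U"
    and w: "continuous_on UNIV w" "\<And>t. 0 \<le> w t" "\<And>t. t \<in> {0..1} - U \<Longrightarrow> w t = 1"
    and conc: "\<And>\<epsilon> K. \<epsilon> > 0 \<Longrightarrow> \<exists>g. nnpoly g \<and> integral {0..1} (\<lambda>t. norm (g (circ t)) powr s) < \<epsilon>
       \<and> integral {0..1} (\<lambda>t. w t * norm (g (circ t)) powr p) < \<epsilon>
       \<and> integral {0..1} (\<lambda>t. norm (g (circ t)) powr q) > K"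
  obtains c :: "nat \<Rightarrow> real" and f :: "real \<Rightarrow> complex" and H :: "real \<Rightarrow> real"
  where "\<And>n. 0 \<le> c n" "\<And>n. c n \<le> (1 + real n) ^ 2"
    "f \<in> borel_measurable borel"
    "AE t in lebesgue_on {0..1}. ((\<lambda>r. \<Sum>n. of_real (c n) * (of_real r * circ t) ^ n) \<longlongrightarrow> f t) (at_left 1)"
    "integrable (lebesgue_on {0..1}) H"
    "AE t in lebesgue_on {0..1}. \<forall>r\<in>{0<..<1}. norm (\<Sum>n. of_real (c n) * (of_real r * circ t) ^ n) powr s \<le> H t"
    "AE t in lebesgue_on {0..1}. norm (f t) powr s \<le> H t"
    "integrable (lebesgue_on ({0..1} - U)) (\<lambda>t. norm (f t) powr p)"
    "\<not> integrable (lebesgue_on {0..1}) (\<lambda>t. norm (f t) powr q)"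
proof -
  \<comment> \<open>The power with exponent \<open>N\<close> absorbs the weights
    \<open>(2 powr s) ^ Suc j\<close> and \<open>(2 powr p) ^ Suc j\<close> of
    \<open>weighted_powr_suminf\<close> and leaves \<open>(1 / 2) ^ Suc j\<close>, as
    \<open>Suc j \<le> N j\<close>. The other factor absorbs the sup norm, at most the square of
    \<open>N\<close>, of the block that ends at \<open>N\<close>.\<close>
  define \<epsilon> where "\<epsilon> N = 1 / ((2 powr s * 2 powr p * 2) ^ N * ((1 + real N ^ 2) powr q))" for N :: nat
  \<comment> \<open>Everything that \<open>tail_perturbation_bound\<close> may lose, plus
    \<open>N\<close>: the cube of \<open>N\<close> bounds the sum of the earlier blocks, and the
    final 1 pays for the tail.\<close>
  define K where "K N = 3 powr q * (real N + (real N ^ 3) powr q + 1) + 1" for N :: nat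
  have N2pos: "1 + real N ^ 2 > 0" for N by (simp add: add_pos_nonneg)
  then have N2ne: "1 + real N ^ 2 \<noteq> 0" for N by (metis less_irrefl)
  have \<epsilon>pos: "\<epsilon> N > 0" for N using N2ne by (simp add: \<epsilon>_def)
  have ge1: "2 powr s \<ge> 1" "2 powr p \<ge> 1" using pos by (auto simp: ge_one_powr_ge_zero)
  have Nq: "(1 + real N ^ 2) powr q \<ge> 1" for N using pos by (auto intro!: ge_one_powr_ge_zero)
  have \<epsilon>gen: "x ^ Suc j * \<epsilon> N \<le> (1 / 2) ^ Suc j / (1 + real N ^ 2) powr q"
    if "1 \<le> x" "x * 2 \<le> 2 powr s * 2 powr p * 2" "Suc j \<le> N" for x :: real and j N
  proof -
    have "(x * 2) ^ Suc j \<le> (x * 2) ^ N" using that by (intro power_increasing) auto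
    also have "\<dots> \<le> (2 powr s * 2 powr p * 2) ^ N" using that by (intro power_mono) auto
    finally have "x ^ Suc j * 2 ^ Suc j \<le> (2 powr s * 2 powr p * 2) ^ N" by (simp add: power_mult_distrib mult_ac)
    then have "x ^ Suc j / (2 powr s * 2 powr p * 2) ^ N \<le> (1 / 2) ^ Suc j"
      by (simp add: field_simps power_one_over)
    then have "(x ^ Suc j / (2 powr s * 2 powr p * 2) ^ N) / (1 + real N ^ 2) powr q \<le> (1 / 2) ^ Suc j / (1 + real N ^ 2) powr q"
      by (rule divide_right_mono) simp
    then show ?thesis by (simp add: \<epsilon>_def)
  qed
  have gens: "2 powr s * 2 \<le> 2 powr s * 2 powr p * 2" "2 powr p * 2 \<le> 2 powr s * 2 powr p * 2"
      "1 * 2 \<le> 2 powr s * 2 powr p * 2"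
    using ge1 mult_mono[OF ge1(1) ge1(2)] by auto
  have drop: "(1 / 2) ^ Suc j / (1 + real N ^ 2) powr q \<le> (1 / 2) ^ Suc j" for j N
    using divide_left_mono[OF Nq[of N], of "(1 / 2) ^ Suc j"] N2ne[of N] by simp

  \<comment> \<open>All demands depend on the start \<open>N\<close> alone. Therefore one choice of
    a block for each \<open>N\<close>, followed by iteration of \<open>nxt\<close>, does the work of
    a recursive construction.\<close>
  define Q where "Q N c N1 \<longleftrightarrow> N < N1 \<and> (\<forall>n. 0 \<le> c n) \<and> (\<forall>n. c n \<le> real n) \<and> (\<forall>n. c n \<noteq> 0 \<longrightarrow> N \<le> n \<and> n < N1)
      \<and> (\<forall>r t. 0 \<le> r \<longrightarrow> r \<le> 1 \<longrightarrow> norm (\<Sum>n<N1. of_real (c n) * (of_real r * circ t) ^ n)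
            \<le> norm (\<Sum>n<N1. of_real (c n) * circ t ^ n) + \<epsilon> N)
      \<and> integral {0..1} (\<lambda>t. norm (\<Sum>n<N1. of_real (c n) * circ t ^ n) powr s) < \<epsilon> N
      \<and> integral {0..1} (\<lambda>t. w t * norm (\<Sum>n<N1. of_real (c n) * circ t ^ n) powr p) < \<epsilon> N
      \<and> integral {0..1} (\<lambda>t. norm (\<Sum>n<N1. of_real (c n) * circ t ^ n) powr q) > K N" for N N1 :: nat and c :: "nat \<Rightarrow> real"
  have "\<exists>c N1. Q N c N1" for N
  proof -
    obtain g where g: "nnpoly g" "integral {0..1} (\<lambda>t. norm (g (circ t)) powr s) < \<epsilon> N"
       "integral {0..1} (\<lambda>t. w t * norm (g (circ t)) powr p) < \<epsilon> N"
       "integral {0..1} (\<lambda>t. norm (g (circ t)) powr q) > K N" using conc[OF \<epsilon>pos] by blast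
    obtain c N1 where
      cc: "N < N1" "\<And>n. 0 \<le> c n" "\<And>n. c n \<le> real n"
        "\<And>n. c n \<noteq> 0 \<Longrightarrow> N \<le> n \<and> n < N1"
        "\<And>t. norm (\<Sum>n<N1. of_real (c n) * circ t ^ n) = norm (g (circ t))"
        "\<And>r t. 0 \<le> r \<Longrightarrow> r \<le> 1 \<Longrightarrow>
           norm (\<Sum>n<N1. of_real (c n) * (of_real r * circ t) ^ n) \<le> norm (g (circ t)) + \<epsilon> N"
      by (rule nnpoly_shifted_block[OF g(1) \<epsilon>pos[of N], of N]) (rule that, assumption+)
    have "Q N c N1" unfolding Q_def using cc g by (intro conjI allI impI) auto
    then show ?thesis by blast
  qed
  then obtain blk nxt where "\<And>N. Q N (blk N) (nxt N)" by metis
  then have bn: "\<And>N::nat. N < nxt N" "\<And>N n. 0 \<le> blk N n" "\<And>N n. blk N n \<le> real n"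
      "\<And>N n. blk N n \<noteq> 0 \<Longrightarrow> N \<le> n \<and> n < nxt N"
      "\<And>N r t. 0 \<le> r \<Longrightarrow> r \<le> 1 \<Longrightarrow> norm (\<Sum>n<nxt N. of_real (blk N n) * (of_real r * circ t) ^ n)
            \<le> norm (\<Sum>n<nxt N. of_real (blk N n) * circ t ^ n) + \<epsilon> N"
      "\<And>N. integral {0..1} (\<lambda>t. norm (\<Sum>n<nxt N. of_real (blk N n) * circ t ^ n) powr s) < \<epsilon> N"
      "\<And>N. integral {0..1} (\<lambda>t. w t * norm (\<Sum>n<nxt N. of_real (blk N n) * circ t ^ n) powr p) < \<epsilon> N"
      "\<And>N. integral {0..1} (\<lambda>t. norm (\<Sum>n<nxt N. of_real (blk N n) * circ t ^ n) powr q) > K N"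
    unfolding Q_def by blast+
  \<comment> \<open>Starting at 1 rather than 0 yields \<open>Suc j \<le> N j\<close>, the form in
    which the exponents in \<epsilon> are compared with the weights.\<close>
  define N where "N j = (nxt ^^ j) 1" for j
  have N_Suc: "N (Suc j) = nxt (N j)" for j by (simp add: N_def)
  have N_strict: "strict_mono N" by (rule strict_mono_Suc_iff[THEN iffD2]) (simp add: N_Suc bn)
  have N_ge: "Suc j \<le> N j" for j
  proof (induction j)
    case (Suc j)
    then show ?case using bn(1)[of "N j"] by (simp add: N_Suc)
  qed (simp add: N_def)
  have N_le: "N i \<le> N j" if "i \<le> j" for i j using strict_mono_less_eq[OF N_strict] that by simp
  define g where "g j z = (\<Sum>n<N (Suc j). of_real (blk (N j) n) * z ^ n)" for j and z :: complex
  \<comment> \<open>A block with \<open>j > n\<close> starts beyond \<open>n\<close>, so the range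
    catches every contribution. It also shows that \<open>c n\<close> has \<open>n + 1\<close> terms
    of size at most \<open>n\<close>, whence the quadratic growth.\<close>
  define c where "c n = (\<Sum>j\<le>n. blk (N j) n)" for n
  have c0: "0 \<le> c n" for n unfolding c_def by (intro sum_nonneg bn)
  have c2: "c n \<le> (1 + real n) ^ 2" for n
  proof -
    have "c n \<le> (\<Sum>j\<le>n. real n)" unfolding c_def by (intro sum_mono bn)
    also have "\<dots> \<le> (1 + real n) ^ 2" by (simp add: power2_eq_square algebra_simps)
    finally show ?thesis .
  qed
  have blk0: "blk (N j) n = 0" if "n < N j \<or> N (Suc j) \<le> n" for j n
    using bn(4)[of "N j" n] that by (force simp: N_Suc)
  have partial: "(\<Sum>n<N J. of_real (c n) * z ^ n) = (\<Sum>j<J. g j z)" for J z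
  proof -
    have "complex_of_real (c n) = (\<Sum>j<J. of_real (blk (N j) n))" if n: "n < N J" for n
    proof -
      have z1: "blk (N i) n = 0" if "n < i" for i using N_ge[of i] that by (intro blk0) linarith
      have z2: "blk (N i) n = 0" if "J \<le> i" for i using N_le[of J i] that n by (intro blk0) linarith
      have "(\<Sum>j\<le>n. blk (N j) n) = (\<Sum>j<max J (Suc n). blk (N j) n)"
        by (intro sum.mono_neutral_left) (auto simp: z1)
      also have "\<dots> = (\<Sum>j<J. blk (N j) n)"
        by (intro sum.mono_neutral_right) (auto simp: z2)
      finally show ?thesis by (simp add: c_def)
    qed
    then have "(\<Sum>n<N J. of_real (c n) * z ^ n) = (\<Sum>n<N J. \<Sum>j<J. of_real (blk (N j) n) * z ^ n)"
      by (intro sum.cong) (auto simp: sum_distrib_right)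
    also have "\<dots> = (\<Sum>j<J. \<Sum>n<N J. of_real (blk (N j) n) * z ^ n)" by (rule sum.swap)
    also have "\<dots> = (\<Sum>j<J. g j z)"
    proof (rule sum.cong[OF refl])
      fix j assume "j \<in> {..<J}"
      then have "N (Suc j) \<le> N J" by (intro N_le) auto
      then show "(\<Sum>n<N J. of_real (blk (N j) n) * z ^ n) = g j z"
        unfolding g_def by (intro sum.mono_neutral_right) (auto simp: blk0)
    qed
    finally show ?thesis .
  qed
  have gsums: "(\<lambda>j. g j (of_real r * circ t)) sums (\<Sum>n. of_real (c n) * (of_real r * circ t) ^ n)"
    if r: "0 < r" "r < 1" for r t
  proof -
    have "summable (\<lambda>n. of_real (c n) * (of_real r * circ t) ^ n)"
    proof (rule summable_comparison_test'[OF summable_quadratic_powser[of r], of 0])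
      show "norm (of_real (c n) * (of_real r * circ t) ^ n) \<le> (1 + real n)\<^sup>2 * r ^ n" for n
        using r c0[of n] c2[of n] by (auto simp: norm_mult norm_power intro!: mult_right_mono)
    qed (use r in auto)
    then have "(\<lambda>M. \<Sum>n<M. of_real (c n) * (of_real r * circ t) ^ n) \<longlonglongrightarrow> (\<Sum>n. of_real (c n) * (of_real r * circ t) ^ n)"
      by (rule summable_LIMSEQ)
    from LIMSEQ_subseq_LIMSEQ[OF this N_strict] show ?thesis
      by (simp add: sums_def o_def partial)
  qed
  have gcont: "continuous_on S (\<lambda>x. g j (h x))" if "continuous_on S h" for S j and h :: "real \<Rightarrow> complex"
    unfolding g_def using that by (intro continuous_intros)
  have grad: "norm (g j (of_real r * circ t)) \<le> norm (g j (circ t)) + \<epsilon> (N j)" if "0 \<le> r" "r \<le> 1" for j r t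
    using bn(5)[OF that, of "N j" t] by (simp add: g_def N_Suc)
  have \<epsilon>half: "\<epsilon> (N j) \<le> (1/2) ^ Suc j" for j
    using \<epsilon>gen[of 1 j "N j", OF _ gens(3) N_ge] drop[of j "N j"] by simp
  have half_sum: "summable (\<lambda>j. (1/2::real) ^ Suc j)" "(\<Sum>j. (1/2::real) ^ Suc j) = 1"
    using power_half_series by (auto simp: sums_iff)
  have \<epsilon>sum: "summable (\<lambda>j. \<epsilon> (N j))" "(\<Sum>j. \<epsilon> (N j)) \<le> 1"
  proof -
    show sm: "summable (\<lambda>j. \<epsilon> (N j))"
      by (rule summable_comparison_test'[OF half_sum(1), of 0]) (use \<epsilon>half \<epsilon>pos in \<open>auto simp: less_imp_le\<close>)
    show "(\<Sum>j. \<epsilon> (N j)) \<le> 1" using suminf_le[OF \<epsilon>half sm half_sum(1)] half_sum(2) by simp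
  qed
  let ?M = "lebesgue_on {0..1::real}"
  have gpow: "continuous_on S (\<lambda>t. norm (g j (circ t)) powr a)" if "a > 0" for S j a
    using that by (intro continuous_on_norm_powr gcont continuous_intros)
  have gint: "integrable ?M (\<lambda>t. norm (g j (circ t)) powr a)"
    "integral\<^sup>L ?M (\<lambda>t. norm (g j (circ t)) powr a) = integral {0..1} (\<lambda>t. norm (g j (circ t)) powr a)" if "a > 0" for j a
    using integral_lebesgue_on_continuous[OF gpow[OF that]] by auto
  define X where "X j t = (2 powr s) ^ Suc j * norm (g j (circ t)) powr s" for j t
  have gs: "integral {0..1} (\<lambda>t. norm (g j (circ t)) powr s) \<le> \<epsilon> (N j)" for j
    using bn(6)[of "N j"] by (simp add: g_def N_Suc)
  have Xint: "integrable ?M (X j)" "integral\<^sup>L ?M (X j) \<le> (2 powr s) ^ Suc j * \<epsilon> (N j)" for j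
    using gint[OF pos(1), of j] gs[of j] by (auto simp: X_def[abs_def] simp del: power_Suc intro!: mult_left_mono)
  have X0: "0 \<le> X j t" for j t by (simp add: X_def)
  have Xhalf: "(2 powr s) ^ Suc j * \<epsilon> (N j) \<le> (1/2) ^ Suc j" for j
    using \<epsilon>gen[of "2 powr s" j "N j", OF ge1(1) gens(1) N_ge] drop[of j "N j"] by linarith
  have Xsum: "summable (\<lambda>j. integral\<^sup>L ?M (X j))"
  proof (rule summable_comparison_test'[OF half_sum(1), of 0])
    show "norm (integral\<^sup>L ?M (X j)) \<le> (1/2) ^ Suc j" for j
      using Xint(2)[of j] Xhalf[of j] Bochner_Integration.integral_nonneg[OF X0[of j], of ?M] by (simp del: power_Suc)
  qed
  note X = integrable_suminf_nonneg[OF Xint(1) X0 Xsum]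
  define f where "f t = (\<Sum>j. g j (circ t))" for t
  have fmeas: "f \<in> borel_measurable borel"
    unfolding f_def by (intro borel_measurable_suminf borel_measurable_continuous_onI gcont continuous_intros)
  have sumnorm: "AE t in ?M. summable (\<lambda>j. norm (g j (circ t))) \<and> (\<Sum>j. norm (g j (circ t))) powr s \<le> (\<Sum>j. X j t)"
    using X(1)
  proof eventually_elim
    case (elim t)
    then show ?case
      using weighted_powr_suminf[of "\<lambda>j. norm (g j (circ t))" s] pos(1) by (simp add: X_def del: power_Suc)
  qed
  \<comment> \<open>The 1 pays for the total of the radial errors \<open>\<epsilon> (N j)\<close>,
    and the constant 3 comes from \<open>powr_sum3_le\<close>. One function then dominates all radii
    and the boundary value.\<close>
  define H where "H t = 3 powr s * ((\<Sum>j. X j t) + 1)" for t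
  have Hint: "integrable ?M H"
    unfolding H_def using X(2)
    by (intro integrable_mult_right Bochner_Integration.integrable_add integrable_const_lebesgue_on_unit)
  have Hbd: "x powr s \<le> H t" if "0 \<le> x" "x \<le> (\<Sum>j. norm (g j (circ t))) + 1"
      "(\<Sum>j. norm (g j (circ t))) powr s \<le> (\<Sum>j. X j t)" "summable (\<lambda>j. norm (g j (circ t)))" for x t
  proof -
    have nn: "0 \<le> (\<Sum>j. norm (g j (circ t)))" using that by (intro suminf_nonneg) auto
    have "x powr s \<le> ((\<Sum>j. norm (g j (circ t))) + 1 + 0) powr s" using that pos by (intro powr_mono2) auto
    also have "\<dots> \<le> 3 powr s * ((\<Sum>j. norm (g j (circ t))) powr s + 1 powr s + 0 powr s)"
      using nn pos by (intro powr_sum3_le) auto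
    also have "\<dots> \<le> H t" unfolding H_def using that(3) by (intro mult_left_mono) auto
    finally show ?thesis .
  qed
  have radial: "AE t in ?M. ((\<lambda>r. \<Sum>n. of_real (c n) * (of_real r * circ t) ^ n) \<longlongrightarrow> f t) (at_left 1)"
    using sumnorm
  proof eventually_elim
    case (elim t)
    then have sm: "summable (\<lambda>j. norm (g j (circ t)) + \<epsilon> (N j))" using \<epsilon>sum(1) by (intro summable_add) auto
    have ev: "\<forall>\<^sub>F r::real in at_left 1. 0 < r \<and> r < 1"
      using eventually_at_left_real[of 0 1] by (simp add: eventually_mono)
    have "((\<lambda>r. \<Sum>j. g j (of_real r * circ t)) \<longlongrightarrow> f t) (at_left 1)"
      unfolding f_def
    proof (rule tannerys_theorem[where M = "\<lambda>j. norm (g j (circ t)) + \<epsilon> (N j)", THEN conjunct2, THEN conjunct2])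
      fix j
      have "((\<lambda>r. g j (of_real r * circ t)) \<longlongrightarrow> g j (of_real 1 * circ t)) (at_left 1)"
        unfolding g_def by (intro tendsto_intros)
      then show "((\<lambda>r. g j (of_real r * circ t)) \<longlongrightarrow> g j (circ t)) (at_left 1)" by simp
    next
      show "\<forall>\<^sub>F (k, r) in at_top \<times>\<^sub>F at_left 1. norm (g k (of_real r * circ t)) \<le> norm (g k (circ t)) + \<epsilon> (N k)"
        unfolding eventually_prod_filter
        by (rule exI[of _ "\<lambda>_. True"], rule exI[of _ "\<lambda>r. 0 < r \<and> r < 1"]) (use ev grad in auto)
    qed (use sm in auto)
    moreover have "\<forall>\<^sub>F r in at_left 1. (\<Sum>j. g j (of_real r * circ t)) = (\<Sum>n. of_real (c n) * (of_real r * circ t) ^ n)"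
      using ev by eventually_elim (use gsums in \<open>auto intro!: sums_unique[symmetric]\<close>)
    ultimately show ?case by (rule Lim_transform_eventually)
  qed
  have domr: "AE t in ?M. \<forall>r\<in>{0<..<1}. norm (\<Sum>n. of_real (c n) * (of_real r * circ t) ^ n) powr s \<le> H t"
    using sumnorm
  proof eventually_elim
    case (elim t)
    show ?case
    proof
      fix r :: real assume r: "r \<in> {0<..<1}"
      have sm: "summable (\<lambda>j. norm (g j (circ t)) + \<epsilon> (N j))" using elim \<epsilon>sum(1) by (intro summable_add) auto
      have "norm (\<Sum>j. g j (of_real r * circ t)) \<le> (\<Sum>j. norm (g j (circ t)) + \<epsilon> (N j))"
        by (rule norm_suminf_le) (use grad r sm in auto)
      also have "\<dots> = (\<Sum>j. norm (g j (circ t))) + (\<Sum>j. \<epsilon> (N j))"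
        using elim \<epsilon>sum(1) by (intro suminf_add[symmetric]) auto
      also have "\<dots> \<le> (\<Sum>j. norm (g j (circ t))) + 1" using \<epsilon>sum(2) by simp
      finally show "norm (\<Sum>n. of_real (c n) * (of_real r * circ t) ^ n) powr s \<le> H t"
        using sums_unique[OF gsums[of r t]] r elim by (intro Hbd) auto
    qed
  qed
  have domf: "AE t in ?M. norm (f t) powr s \<le> H t"
    using sumnorm
  proof eventually_elim
    case (elim t)
    have "norm (f t) \<le> (\<Sum>j. norm (g j (circ t)))" unfolding f_def using elim by (intro summable_norm) auto
    then show ?case using elim by (intro Hbd) auto
  qed

  have Vset: "{0..1} - U \<in> sets lebesgue" using U by auto
  let ?V = "lebesgue_on ({0..1} - U)"
  define Z where "Z j t = (2 powr p) ^ Suc j * norm (g j (circ t)) powr p" for j t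
  have Zcont: "continuous_on S (Z j)" for S j unfolding Z_def by (intro continuous_on_mult continuous_on_const gpow pos)
  have wZcont: "continuous_on {0..1} (\<lambda>t. w t * Z j t)" for j
    by (intro continuous_on_mult Zcont continuous_on_subset[OF w(1)]) auto
  have wgp: "integral {0..1} (\<lambda>t. w t * norm (g j (circ t)) powr p) \<le> \<epsilon> (N j)" for j
    using bn(7)[of "N j"] by (simp add: g_def N_Suc)
  have Z0: "0 \<le> Z j t" for j t by (simp add: Z_def)
  have Zint: "integrable ?V (Z j)" for j
    by (rule integrable_lebesgue_on_subset[OF integral_lebesgue_on_continuous(1)[OF Zcont] _ _ Vset]) auto
  have wZint: "integrable ?V (\<lambda>t. w t * Z j t)" for j
    by (rule integrable_lebesgue_on_subset[OF integral_lebesgue_on_continuous(1)[OF wZcont] _ _ Vset]) auto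
  have Zle: "integral\<^sup>L ?V (Z j) \<le> (1/2) ^ Suc j" for j
  proof -
    \<comment> \<open>Off \<open>U\<close> the weight is 1, so it can be inserted for free;
      enlarging the domain to the whole interval then gives the integral for which the block was
      made.\<close>
    have "integral\<^sup>L ?V (Z j) = integral\<^sup>L ?V (\<lambda>t. w t * Z j t)"
      by (intro Bochner_Integration.integral_cong) (auto simp: w)
    also have "\<dots> = integral ({0..1} - U) (\<lambda>t. w t * Z j t)"
      by (rule lebesgue_integral_eq_integral[OF wZint Vset])
    also have "\<dots> \<le> integral {0..1} (\<lambda>t. w t * Z j t)"
      by (intro integral_subset_le integrable_on_lebesgue_on[OF wZint Vset] integrable_continuous_interval wZcont)
        (auto simp: w Z0)
    also have "\<dots> = integral {0..1} (\<lambda>t. (2 powr p) ^ Suc j * (w t * norm (g j (circ t)) powr p))"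
      by (simp add: Z_def mult_ac)
    also have "\<dots> \<le> (2 powr p) ^ Suc j * \<epsilon> (N j)"
      using wgp[of j] by (simp del: power_Suc)
    also have "\<dots> \<le> (1/2) ^ Suc j"
      using \<epsilon>gen[of "2 powr p" j "N j", OF ge1(2) gens(2) N_ge] drop[of j "N j"] by linarith
    finally show ?thesis .
  qed
  have Zsum: "summable (\<lambda>j. integral\<^sup>L ?V (Z j))"
    by (rule summable_comparison_test'[OF half_sum(1), of 0])
      (use Zle Z0 in \<open>auto simp del: power_Suc simp: abs_of_nonneg Bochner_Integration.integral_nonneg\<close>)
  note Z = integrable_suminf_nonneg[OF Zint Z0 Zsum]
  have fp: "integrable ?V (\<lambda>t. norm (f t) powr p)"
  proof (rule Bochner_Integration.integrable_bound[OF Z(2)])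
    show "(\<lambda>t. norm (f t) powr p) \<in> borel_measurable ?V"
      using fmeas by (intro borel_measurable_lebesgue_on_of_borel) measurable
    show "AE t in ?V. norm (norm (f t) powr p) \<le> norm (\<Sum>j. Z j t)"
      using Z(1)
    proof eventually_elim
      case (elim t)
      have ws: "summable (\<lambda>j. norm (g j (circ t)))" "(\<Sum>j. norm (g j (circ t))) powr p \<le> (\<Sum>j. Z j t)"
        using weighted_powr_suminf[of "\<lambda>j. norm (g j (circ t))" p] pos(3) elim by (simp_all add: Z_def del: power_Suc)
      have "norm (f t) powr p \<le> (\<Sum>j. norm (g j (circ t))) powr p"
        unfolding f_def using ws(1) pos by (intro powr_mono2 summable_norm) auto
      then show ?case using ws(2) by simp
    qed
  qed

  have nfq: "\<not> integrable ?M (\<lambda>t. norm (f t) powr q)"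
  proof
    assume fq: "integrable ?M (\<lambda>t. norm (f t) powr q)"
    define I where "I = integral\<^sup>L ?M (\<lambda>t. norm (f t) powr q)"
    \<comment> \<open>The \<open>q\<close>-integral of block \<open>i\<close> exceeds
      \<open>K (N i)\<close>, while \<open>tail_perturbation_bound\<close> estimates it by
      \<open>I\<close>, the earlier blocks and a tail term of at most 1. The choice of
      \<open>K\<close> leaves exactly \<open>N i\<close> against \<open>I\<close>.\<close>
    have "real (N i) \<le> I" for i
    proof -
      define Y where "Y t = (\<Sum>k. norm (g (k + Suc i) (circ t)))" for t
      define W where "W k t = (2 powr s) ^ Suc k * norm (g (k + Suc i) (circ t)) powr s" for k t
      have Wint: "integrable ?M (W k)" "integral\<^sup>L ?M (W k) \<le> (2 powr s) ^ Suc k * \<epsilon> (N (k + Suc i))" for k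
        using gint[OF pos(1), of "k + Suc i"] gs[of "k + Suc i"] by (auto simp: W_def[abs_def] simp del: power_Suc intro!: mult_left_mono)
      have W0: "0 \<le> W k t" for k t by (simp add: W_def)
      \<comment> \<open>Bounds the integral of the weighted tail behind block \<open>i\<close>. The
        later thresholds \<epsilon> contain at least this divisor, so that
        \<open>G powr q * D \<le> 1\<close>.\<close>
      define D where "D = 1 / (1 + real (N (Suc i)) ^ 2) powr q"
      have D0: "D \<ge> 0" by (simp add: D_def)
      have Wle: "integral\<^sup>L ?M (W k) \<le> (1/2) ^ Suc k * D" for k
      proof -
        have "Suc k \<le> N (k + Suc i)" using N_ge[of "k + Suc i"] by simp
        then have "(2 powr s) ^ Suc k * \<epsilon> (N (k + Suc i)) \<le> (1/2) ^ Suc k / (1 + real (N (k + Suc i)) ^ 2) powr q"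
          using \<epsilon>gen[of "2 powr s" k "N (k + Suc i)", OF ge1(1) gens(1)] by simp
        also have "\<dots> \<le> (1/2) ^ Suc k / (1 + real (N (Suc i)) ^ 2) powr q"
          using N_le[of "Suc i" "k + Suc i"] pos
          by (intro divide_left_mono powr_mono2 add_left_mono power_mono mult_pos_pos) (auto simp: N2ne)
        finally show ?thesis using Wint(2)[of k] by (simp add: D_def)
      qed
      have hD: "(\<lambda>k. (1/2::real) ^ Suc k * D) sums (1 * D)" by (intro sums_mult2 power_half_series)
      have Wsum: "summable (\<lambda>k. integral\<^sup>L ?M (W k))"
        by (rule summable_comparison_test'[OF sums_summable[OF hD], of 0])
          (use Wle W0 in \<open>auto simp del: power_Suc simp: abs_of_nonneg Bochner_Integration.integral_nonneg\<close>)
      note W = integrable_suminf_nonneg[OF Wint(1) W0 Wsum]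
      have WD: "integral\<^sup>L ?M (\<lambda>t. \<Sum>k. W k t) \<le> D"
        using suminf_le[OF Wle Wsum sums_summable[OF hD]] sums_unique[OF hD] W(3) by simp
      define G where "G = real (N (Suc i)) ^ 2"
      define B where "B = real (N i) ^ 3"
      have gG: "norm (g i (circ t)) \<le> G" for t
      proof -
        have "norm (g i (circ t)) \<le> (\<Sum>n<N (Suc i). real (N (Suc i)))"
          unfolding g_def
        proof (rule sum_norm_le)
          fix n assume "n \<in> {..<N (Suc i)}"
          then show "norm (of_real (blk (N i) n) * circ t ^ n) \<le> real (N (Suc i))"
            using bn(2,3)[of "N i" n] by (auto simp: norm_mult norm_power intro: order_trans)
        qed
        then show ?thesis by (simp add: G_def power2_eq_square)
      qed
      have SB: "norm (\<Sum>j<i. g j (circ t)) \<le> B" for t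
      proof -
        have "norm (\<Sum>n<N i. of_real (c n) * circ t ^ n) \<le> (\<Sum>n<N i. real (N i) ^ 2)"
        proof (rule sum_norm_le)
          fix n assume "n \<in> {..<N i}"
          then have "(1 + real n) ^ 2 \<le> real (N i) ^ 2" by (intro power_mono) auto
          then have "c n \<le> real (N i) ^ 2" using c2[of n] by linarith
          then show "norm (of_real (c n) * circ t ^ n) \<le> real (N i) ^ 2"
            using c0[of n] by (simp add: norm_mult norm_power)
        qed
        then show ?thesis unfolding partial by (simp add: B_def power2_eq_square power3_eq_cube)
      qed
      have ae: "AE t in ?M. norm (g i (circ t)) powr q \<le> 3 powr q * (norm (f t) powr q + B powr q + 1) + G powr q * (\<Sum>k. W k t)"
        using W(1) sumnorm
      proof eventually_elim
        case (elim t)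
        have ws: "summable (\<lambda>k. norm (g (k + Suc i) (circ t)))" "Y t powr s \<le> (\<Sum>k. W k t)"
          using weighted_powr_suminf[of "\<lambda>k. norm (g (k + Suc i) (circ t))" s] pos(1) elim(1)
          by (simp_all add: W_def Y_def del: power_Suc)
        have "summable (\<lambda>j. g j (circ t))" by (rule summable_norm_cancel[OF conjunct1[OF elim(2)]])
        then have "f t = (\<Sum>k. g (k + Suc i) (circ t)) + (\<Sum>j<Suc i. g j (circ t))"
          unfolding f_def by (rule suminf_split_initial_segment)
        then have "f t = (\<Sum>j<i. g j (circ t)) + g i (circ t) + (\<Sum>k. g (k + Suc i) (circ t))" by simp
        from tail_perturbation_bound[OF this SB gG _ pos(2,1), of "Y t"]
        have "norm (g i (circ t)) powr q \<le> 3 powr q * (norm (f t) powr q + B powr q + 1) + G powr q * Y t powr s"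
          using summable_norm[OF ws(1)] by (simp add: Y_def)
        also have "\<dots> \<le> 3 powr q * (norm (f t) powr q + B powr q + 1) + G powr q * (\<Sum>k. W k t)"
          using ws(2) by (intro add_left_mono mult_left_mono) auto
        finally show ?case .
      qed
      note ic = integrable_const_lebesgue_on_unit
      have rint: "integrable ?M (\<lambda>t. 3 powr q * (norm (f t) powr q + B powr q + 1) + G powr q * (\<Sum>k. W k t))"
        using fq W(2) ic(1) by (intro Bochner_Integration.integrable_add integrable_mult_right) auto
      have "K (N i) < integral\<^sup>L ?M (\<lambda>t. norm (g i (circ t)) powr q)"
        using bn(8)[of "N i"] gint(2)[OF pos(2), of i] by (simp add: g_def N_Suc)
      also have "\<dots> \<le> integral\<^sup>L ?M (\<lambda>t. 3 powr q * (norm (f t) powr q + B powr q + 1) + G powr q * (\<Sum>k. W k t))"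
        by (rule integral_mono_AE[OF gint(1)[OF pos(2)] rint ae])
      also have "\<dots> = 3 powr q * (I + B powr q + 1) + G powr q * integral\<^sup>L ?M (\<lambda>t. \<Sum>k. W k t)"
        using fq W(2) ic(1) ic(2)[of 1] by (simp add: I_def)
      also have "\<dots> \<le> 3 powr q * (I + B powr q + 1) + G powr q * D"
        using WD by (intro add_left_mono mult_left_mono) auto
      also have "G powr q * D \<le> 1"
      proof -
        have "G powr q \<le> (1 + real (N (Suc i)) ^ 2) powr q" using pos by (intro powr_mono2) (auto simp: G_def)
        then show ?thesis using Nq[of "N (Suc i)"] by (simp add: D_def divide_simps)
      qed
      finally have "3 powr q * (real (N i) + B powr q + 1) < 3 powr q * (I + B powr q + 1)"
        by (simp add: K_def B_def)
      then show ?thesis by simp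
    qed
    then have "real (Suc i) \<le> I" for i using N_ge[of i] by (metis of_nat_le_iff order_trans)
    then show False using reals_Archimedean2[of I] by (metis Suc_n_not_le_n less_le_not_le of_nat_le_iff order_less_imp_le order_trans)
  qed
  show ?thesis by (rule that[OF c0 c2 fmeas radial Hint domr domf fp nfq])
qed

subsection \<open>Concentration near a symmetric pair of points\<close>

definition lpn :: "real \<Rightarrow> (real \<Rightarrow> complex) \<Rightarrow> real" where
  "lpn a F = integral {0..1} (\<lambda>x. norm (F x) powr a) powr (1 / a)"

text \<open>As a function of \<open>x powr q\<close> the left side is a power with exponent
  \<open>s / q < 1\<close>, hence strictly concave, and the right side is its tangent at 1. The
  proof takes \<open>1 + u < exp u\<close> at \<open>(q - s) * l\<close> and at
  \<open>- s * l\<close>, with weights \<open>k\<close> and \<open>1 - k\<close> for which the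
  linear terms cancel.\<close>

lemma powr_tangent_strict:
  fixes x :: real
  assumes "0 \<le> x" "x \<noteq> 1" "0 < s" "s < q"
  shows "x powr s < 1 + s / q * (x powr q - 1)"
proof (cases "x = 0")
  case True
  then show ?thesis using assms by (simp add: field_simps)
next
  case False
  define l where "l = ln x"
  define k where "k = s / q"
  have l: "l \<noteq> 0" "0 < k" "k < 1" using False assms by (auto simp: l_def k_def)
  have e1: "1 + u < exp u" if "u \<noteq> 0" for u :: real using exp_ge_add_one_self[of u] exp_less_cancel_iff
    by (metis add.commute exp_eq_one_iff less_eq_real_def ln_exp ln_eq_minus_one that add_diff_cancel exp_gt_zero)
  have xs: "x powr s = exp (s * l)" and xq: "x powr q = exp (q * l)"
    using False assms by (auto simp: powr_def l_def)
  have "1 + (q - s) * l < exp ((q - s) * l)" "1 + (- s * l) < exp (- s * l)" using l assms e1[of "(q - s) * l"] e1[of "- s * l"] by auto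
  then have "k * (1 + (q - s) * l) + (1 - k) * (1 + (- s * l)) < k * exp ((q - s) * l) + (1 - k) * exp (- s * l)"
    using l by (intro add_strict_mono mult_strict_left_mono) auto
  moreover have "k * (1 + (q - s) * l) + (1 - k) * (1 + (- s * l)) = 1 + (k * q - s) * l"
    by (simp add: algebra_simps)
  moreover have "k * q = s" using assms by (simp add: k_def)
  ultimately have "1 < k * exp ((q - s) * l) + (1 - k) * exp (- s * l)" by simp
  then have "exp (s * l) * 1 < exp (s * l) * (k * exp ((q - s) * l) + (1 - k) * exp (- s * l))"
    by (intro mult_strict_left_mono) auto
  also have "\<dots> = k * (exp (s * l) * exp ((q - s) * l)) + (1 - k) * (exp (s * l) * exp (- s * l))"
    by (simp add: algebra_simps)
  also have "\<dots> = k * exp (q * l) + (1 - k)" by (simp flip: exp_add add: algebra_simps)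
  finally show ?thesis unfolding xs xq k_def[symmetric] by (simp add: algebra_simps)
qed

lemma powr_tangent:
  fixes x :: real
  assumes "0 \<le> x" "0 < s" "s \<le> q"
  shows "x powr s \<le> 1 + s / q * (x powr q - 1)"
proof (cases "x = 1 \<or> s = q")
  case False
  then show ?thesis using powr_tangent_strict[of x s q] assms by simp
qed (use assms in auto)

lemma lpn_nonneg: "0 \<le> lpn a F" by (simp add: lpn_def)

lemma lpn_powr:
  assumes "a > 0" "continuous_on {0..1} F"
  shows "lpn a F powr a = integral {0..1} (\<lambda>x. norm (F x) powr a)"
proof -
  have "0 \<le> integral {0..1} (\<lambda>x. norm (F x) powr a)"
    by (intro integral_nonneg integrable_continuous_interval continuous_on_norm_powr assms) auto
  then show ?thesis using assms(1) by (simp add: lpn_def powr_powr)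
qed

lemma lpn_eq_0_imp:
  assumes "a > 0" "continuous_on {0..1} F" "lpn a F = 0" "x \<in> {0..1}"
  shows "F x = 0"
proof -
  have "integral {0..1} (\<lambda>x. norm (F x) powr a) = 0"
    using lpn_powr[OF assms(1,2)] assms(3) by simp
  then have "\<forall>x\<in>{0..1}. norm (F x) powr a = 0"
    using integral_eq_0_iff[of 0 1 "\<lambda>x. norm (F x) powr a"] continuous_on_norm_powr[OF assms(2,1)] by auto
  then show ?thesis using assms(4) by auto
qed

lemma lpn_mono_aux:
  assumes sq: "0 < s" "s \<le> q" and F: "continuous_on {0..1} F" and pos: "0 < lpn q F"
  shows "integral {0..1} (\<lambda>x. norm (F x / of_real (lpn q F)) powr q) = 1"
    and "lpn s F = lpn q F * lpn s (\<lambda>x. F x / of_real (lpn q F))"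
    and "continuous_on {0..1} (\<lambda>x. F x / of_real (lpn q F))"
proof -
  define \<nu> where "\<nu> = lpn q F"
  have eq: "norm (F x / of_real \<nu>) powr a = (1 / \<nu> powr a) * norm (F x) powr a" for x a
    using pos by (simp add: \<nu>_def norm_divide powr_divide)
  have q: "0 < q" using sq by simp
  have pw: "\<nu> powr a > 0" for a using pos by (simp add: \<nu>_def)
  have "integral {0..1} (\<lambda>x. norm (F x / of_real \<nu>) powr q) = (1 / \<nu> powr q) * integral {0..1} (\<lambda>x. norm (F x) powr q)"
    unfolding eq by (rule integral_mult_right)
  also have "\<dots> = 1" unfolding lpn_powr[OF q F, symmetric] using pw[of q] by (simp add: \<nu>_def)
  finally show "integral {0..1} (\<lambda>x. norm (F x / of_real (lpn q F)) powr q) = 1" by (simp add: \<nu>_def)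
  have I0: "0 \<le> integral {0..1} (\<lambda>x. norm (F x) powr s)"
    by (intro integral_nonneg integrable_continuous_interval continuous_on_norm_powr F sq) auto
  have "integral {0..1} (\<lambda>x. norm (F x / of_real \<nu>) powr s) = (1 / \<nu> powr s) * integral {0..1} (\<lambda>x. norm (F x) powr s)"
    unfolding eq by (rule integral_mult_right)
  then have "lpn s (\<lambda>x. F x / of_real \<nu>) = (1 / \<nu>) * lpn s F"
    using I0 sq pos by (simp add: lpn_def powr_divide powr_powr \<nu>_def)
  then show "lpn s F = lpn q F * lpn s (\<lambda>x. F x / of_real (lpn q F))" using pos by (simp add: \<nu>_def)
  show "continuous_on {0..1} (\<lambda>x. F x / of_real (lpn q F))" using pos F by (intro continuous_intros) auto
qed

text \<open>After scaling to \<open>q\<close>-norm 1 the tangent inequality integrates to a bound by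
  1, since the linear term has integral 0.\<close>

lemma lpn_mono:
  assumes sq: "0 < s" "s \<le> q" and F: "continuous_on {0..1} F"
  shows "lpn s F \<le> lpn q F"
proof (cases "lpn q F = 0")
  case True
  then have "F x = 0" if "x \<in> {0..1}" for x using lpn_eq_0_imp[of q F x] that F sq by auto
  then have "integral {0..1} (\<lambda>x. norm (F x) powr s) = integral {0..1} (\<lambda>x::real. 0::real)"
    by (intro integral_cong) auto
  then show ?thesis by (simp add: lpn_def)
next
  case False
  then have pos: "0 < lpn q F" using lpn_nonneg[of q F] by linarith
  define G where "G = (\<lambda>x. F x / of_real (lpn q F))"
  note aux = lpn_mono_aux[OF sq F pos, folded G_def]
  have G1: "integral {0..1} (\<lambda>x. norm (G x) powr q) = 1" using aux(1) by (simp add: G_def)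
  have int: "(\<lambda>x. norm (G x) powr a) integrable_on {0..1}" if "a > 0" for a
    by (intro integrable_continuous_interval continuous_on_norm_powr aux(3) that)
  have tang: "((\<lambda>x. 1 + s / q * (norm (G x) powr q - 1)) has_integral (1 + s / q * (1 - 1))) {0..1}"
    using has_integral_const_real[of "1::real" 0 1] integrable_integral[OF int[of q]] G1 sq
    by (intro has_integral_add has_integral_mult_right has_integral_diff) auto
  have "integral {0..1} (\<lambda>x. norm (G x) powr s) \<le> 1 + s / q * (1 - 1)"
    by (rule has_integral_le[OF integrable_integral[OF int] tang]) (use sq powr_tangent in auto)
  then have "lpn s G \<le> 1 powr (1 / s)"
    unfolding lpn_def using sq by (intro powr_mono2 integral_nonneg int) auto
  then show ?thesis unfolding aux(2) using pos by (simp add: mult_le_cancel_left1)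
qed

text \<open>Two different values of the modulus cannot both be 1 after scaling. At a point where it
  is not 1 the tangent inequality is strict, and by continuity so is its integral.\<close>

lemma lpn_strict_mono:
  assumes sq: "0 < s" "s < q" and F: "continuous_on {0..1} F"
    and nc: "x0 \<in> {0..1}" "x1 \<in> {0..1}" "norm (F x0) \<noteq> norm (F x1)"
  shows "lpn s F < lpn q F"
proof -
  have "lpn q F \<noteq> 0" using lpn_eq_0_imp[of q F] nc F sq by (metis less_trans)
  then have pos: "0 < lpn q F" using lpn_nonneg[of q F] by linarith
  define G where "G = (\<lambda>x. F x / of_real (lpn q F))"
  note aux = lpn_mono_aux[OF sq(1) less_imp_le[OF sq(2)] F pos, folded G_def]
  have G1: "integral {0..1} (\<lambda>x. norm (G x) powr q) = 1" using aux(1) by (simp add: G_def)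
  have contG: "continuous_on {0..1} (\<lambda>x. norm (G x) powr a)" if "a > 0" for a
    by (intro continuous_on_norm_powr aux(3) that)
  have int: "(\<lambda>x. norm (G x) powr a) integrable_on {0..1}" if "a > 0" for a
    by (intro integrable_continuous_interval contG that)
  have "norm (G x0) \<noteq> norm (G x1)" using nc pos by (simp add: G_def norm_divide)
  then obtain x2 where x2: "x2 \<in> {0..1}" "norm (G x2) \<noteq> 1" using nc by metis
  define D where "D x = 1 + s / q * (norm (G x) powr q - 1) - norm (G x) powr s" for x
  have D0: "0 \<le> D x" for x using powr_tangent[of "norm (G x)" s q] sq by (simp add: D_def)
  have Dc: "continuous_on {0..1} D" unfolding D_def
    by (intro continuous_on_diff continuous_on_add continuous_on_mult continuous_on_const contG) (use sq in auto)
  have "integral {0..1} D \<noteq> 0"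
  proof
    assume "integral {0..1} D = 0"
    then have "\<forall>x\<in>{0..1}. D x = 0" using integral_eq_0_iff[of 0 1 D] Dc D0 by auto
    then show False using x2 powr_tangent_strict[of "norm (G x2)" s q] sq by (force simp: D_def)
  qed
  moreover have "integral {0..1} D \<ge> 0" using D0 by (intro integral_nonneg integrable_continuous_interval Dc)
  moreover have "integral {0..1} D = 1 + s / q * (1 - 1) - integral {0..1} (\<lambda>x. norm (G x) powr s)"
    unfolding D_def
    using has_integral_const_real[of "1::real" 0 1] integrable_integral[OF int[of q]] integrable_integral[OF int[of s]] G1 sq
    by (intro integral_unique has_integral_diff has_integral_add has_integral_mult_right) auto
  ultimately have "integral {0..1} (\<lambda>x. norm (G x) powr s) < 1" by simp
  then have "lpn s G < 1 powr (1 / s)"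
    unfolding lpn_def using sq by (intro powr_less_mono2 integral_nonneg int) auto
  then show ?thesis unfolding aux(2) using pos by simp
qed

section \<open>Cosine estimates, dyadic points and damping\<close>

lemma norm_half_one_plus_circ: "norm ((1 + circ t) / 2) = \<bar>cos (pi * t)\<bar>"
proof -
  have "norm (1 + circ t) ^ 2 = (1 + cos (2 * (pi * t))) ^ 2 + (sin (2 * (pi * t))) ^ 2"
    by (simp add: cmod_power2 circ_def mult_ac)
  also have "\<dots> = 1 + 2 * cos (2 * (pi * t)) + ((cos (2 * (pi * t))) ^ 2 + (sin (2 * (pi * t))) ^ 2)"
    by (simp only: power2_sum)  (simp add: algebra_simps)
  also have "\<dots> = 2 + 2 * cos (2 * (pi * t))" by simp
  also have "\<dots> = (2 * \<bar>cos (pi * t)\<bar>) ^ 2" by (simp only: cos_double_cos) (simp add: power_mult_distrib)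
  finally have "norm (1 + circ t) = 2 * \<bar>cos (pi * t)\<bar>"
    by (rule power2_eq_imp_eq) auto
  then show ?thesis by (simp add: norm_divide)
qed

lemma abs_cos_add_int_pi: "\<bar>cos (pi * of_int m + x)\<bar> = \<bar>cos x\<bar>"
proof -
  have "sin (of_int m * pi) = 0" by (simp add: sin_times_pi_eq_0)
  then have s: "sin (pi * of_int m) = 0" by (simp add: mult.commute)
  then have "(cos (pi * of_int m)) ^ 2 = 1" using sin_cos_squared_add[of "pi * of_int m"] by simp
  then have "\<bar>cos (pi * of_int m)\<bar> = 1" by (simp add: abs_square_eq_1)
  then show ?thesis using s by (simp add: cos_add abs_mult)
qed

lemma abs_cos_le_of_residue:
  fixes i h m :: nat
  assumes "m \<le> i" "i + m \<le> h" "0 < h"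
  shows "\<bar>cos (pi * real i / real h)\<bar> \<le> cos (pi * real m / real h)"
proof -
  have a: "pi * real m / real h \<le> pi * real i / real h" using assms by (simp add: divide_right_mono)
  have "real i + real m \<le> real h" using assms by linarith
  then have "pi * (real i + real m) \<le> pi * real h" by (intro mult_left_mono) auto
  then have "pi * (real i + real m) / real h \<le> pi * 1" using assms by (simp add: divide_le_eq)
  then have b: "pi * real i / real h \<le> pi - pi * real m / real h" by (simp add: algebra_simps add_divide_distrib)
  have c: "0 \<le> pi * real m / real h" by simp
  have "cos (pi * real i / real h) \<le> cos (pi * real m / real h)" using a b c by (intro cos_monotone_0_pi_le) linarith+
  moreover have "cos (pi - pi * real m / real h) \<le> cos (pi * real i / real h)" using a b c by (intro cos_monotone_0_pi_le) linarith+
  ultimately show ?thesis by simp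
qed

text \<open>With \<open>c = cos x\<close> the difference is
  \<open>c * (4 * c + 3) * (c - 1)\<close>. It says that the odd residue 3 is damped at least twice
  as strongly as the residue 1, which is the origin of the square in the majorant gap.\<close>

lemma cos_triple_le_cos_squared:
  fixes x :: real
  assumes "0 \<le> cos x" shows "cos (3 * x) \<le> cos x ^ 2"
proof -
  define c where "c = cos x"
  have "c \<le> 1" by (simp add: c_def)
  then have "c * ((4 * c + 3) * (c - 1)) \<le> 0" using assms by (intro mult_nonneg_nonpos mult_nonneg_nonpos) (auto simp: c_def)
  then have "4 * c ^ 3 - 3 * c \<le> c ^ 2" by (simp add: algebra_simps power2_eq_square power3_eq_cube)
  then show ?thesis by (simp add: cos_treble_cos c_def)
qed

text \<open>Consecutive powers of \<tau> have ratio \<tau> > \<alpha> / \<beta>, so they cannot jump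
  over the interval from \<alpha> to \<beta>; the first power below \<beta> is the one.\<close>

lemma power_between:
  fixes \<alpha> \<beta> \<tau> :: real
  assumes "0 < \<beta>" "\<beta> \<le> 1" "\<alpha> / \<beta> < \<tau>" "0 < \<tau>" "\<tau> < 1"
  obtains L where "\<alpha> < \<tau> ^ L" "\<tau> ^ L < \<beta>"
proof -
  have ex: "\<exists>n. \<tau> ^ n < \<beta>" using real_arch_pow_inv[of \<beta> \<tau>] assms by auto
  define L where "L = (LEAST n. \<tau> ^ n < \<beta>)"
  have L: "\<tau> ^ L < \<beta>" unfolding L_def by (rule LeastI_ex[OF ex])
  then have "L \<noteq> 0" using assms by (cases L) auto
  then obtain L' where L': "L = Suc L'" by (cases L) auto
  have "\<not> \<tau> ^ L' < \<beta>" using not_less_Least[of L' "\<lambda>n. \<tau> ^ n < \<beta>"] L' by (simp add: L_def)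
  then have "\<beta> * \<tau> \<le> \<tau> ^ L" using assms by (simp add: L' mult.commute)
  moreover have "\<alpha> < \<beta> * \<tau>" using assms by (simp add: field_simps)
  ultimately show ?thesis using L by (intro that[of L]) auto
qed

text \<open>Every point is within \<open>1 / 2 ^ n\<close> of an odd multiple of
  \<open>1 / 2 ^ n\<close>. Oddness makes \<open>k\<close> invertible modulo \<open>2 ^ n\<close>
  and puts the point on the side \<open>u = -1\<close>.\<close>

lemma dyadic_odd_in_open:
  assumes U: "open U" "x \<in> U" "0 < x" "x < (1::real)"
  obtains n0 where "\<And>n. n \<ge> n0 \<Longrightarrow> \<exists>k. odd k \<and> k < 2 ^ n \<and> real k / 2 ^ n \<in> U"
proof -
  have "open (U \<inter> {0<..<1})" using U by auto
  then obtain d where d: "d > 0" "ball x d \<subseteq> U \<inter> {0<..<1}" using U by (elim openE[of _ x]) auto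
  obtain n0 where n0: "(1/2::real) ^ n0 < d" using real_arch_pow_inv[of d "1/2"] d by auto
  show ?thesis
  proof (rule that[of "Suc n0"])
    fix n assume n: "Suc n0 \<le> n"
    define j where "j = nat \<lfloor>x * 2 ^ (n - 1)\<rfloor>"
    define k where "k = 2 * j + 1"
    have n1: "(2::real) ^ n = 2 * 2 ^ (n - 1)" using n by (cases n) auto
    have j: "real j \<le> x * 2 ^ (n - 1)" "x * 2 ^ (n - 1) < real j + 1" using U by (auto simp: j_def)
    have "\<bar>real k - x * 2 ^ n\<bar> \<le> 1" unfolding n1 k_def using j by (auto simp: abs_le_iff algebra_simps)
    then have "\<bar>real k - x * 2 ^ n\<bar> / 2 ^ n \<le> 1 / 2 ^ n" by (intro divide_right_mono) auto
    moreover have "\<bar>real k - x * 2 ^ n\<bar> / 2 ^ n = \<bar>real k / 2 ^ n - x\<bar>"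
    proof -
      have "real k / 2 ^ n - x = (real k - x * 2 ^ n) / 2 ^ n" by (simp add: field_simps)
      then show ?thesis by (simp add: abs_divide)
    qed
    moreover have "(1/2::real) ^ n \<le> (1/2) ^ n0" using n by (intro power_decreasing) auto
    ultimately have "\<bar>real k / 2 ^ n - x\<bar> < d" using n0 by (simp add: power_one_over)
    then have "real k / 2 ^ n \<in> ball x d" by (simp add: dist_real_def abs_minus_commute)
    then have "real k / 2 ^ n \<in> U" "real k / 2 ^ n < 1" using d(2) by auto
    then have "real k < real (2 ^ n)" by simp
    then have "k < 2 ^ n" by (simp only: of_nat_less_iff)
    then show "\<exists>k. odd k \<and> k < 2 ^ n \<and> real k / 2 ^ n \<in> U" using \<open>real k / 2 ^ n \<in> U\<close>
      by (intro exI[of _ k]) (auto simp: k_def)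
  qed
qed

text \<open>Where \<open>f \<ge> 1\<close>, a compact set, \<open>g\<close> is bounded away from 1
  and a high power beats the maximum of \<open>f\<close>; elsewhere \<open>f < 1\<close> already
  suffices. With \<open>g = 1\<close> on a finite grid only, this reduces an estimate on the circle
  to finitely many points.\<close>

lemma compact_damping:
  fixes f g :: "real \<Rightarrow> real"
  assumes S: "compact S" and f: "continuous_on S f" and g: "continuous_on S g"
    and g01: "\<And>y. 0 \<le> g y" "\<And>y. g y \<le> 1" and f0: "\<And>y. 0 \<le> f y" and alt: "\<And>y. y \<in> S \<Longrightarrow> f y < 1 \<or> g y < 1"
  obtains M0 where "\<And>M y. M \<ge> M0 \<Longrightarrow> y \<in> S \<Longrightarrow> f y * g y ^ M < 1"
proof -
  define T where "T = {y \<in> S. 1 \<le> f y}"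
  have "closed (S \<inter> f -` {1..})" 
    by (rule continuous_closed_preimage[OF f compact_imp_closed[OF S]]) simp
  from compact_Int_closed[OF S this] have T: "compact T" unfolding T_def
    by (rule back_subst[of compact]) auto
  obtain k where k: "0 < k" "k < 1" "\<And>y. y \<in> T \<Longrightarrow> g y \<le> k"
    by (rule compact_less_one_bound[OF T continuous_on_subset[OF g]]) (use alt in \<open>force simp: T_def\<close>)+
  have "bounded (f ` S)" using S f by (intro compact_imp_bounded compact_continuous_image)
  then obtain B where B: "B > 0" "\<And>y. y \<in> S \<Longrightarrow> \<bar>f y\<bar> \<le> B" unfolding bounded_pos by auto
  obtain M0 where M0: "k ^ M0 < 1 / B" using real_arch_pow_inv[of "1 / B" k] k B by auto
  show ?thesis
  proof (rule that)
    fix M y assume M: "M \<ge> M0" and y: "y \<in> S"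
    show "f y * g y ^ M < 1"
    proof (cases "y \<in> T")
      case True
      have "g y ^ M \<le> k ^ M" using k True g01 by (intro power_mono) auto
      also have "\<dots> \<le> k ^ M0" using k M by (intro power_decreasing) auto
      finally have "f y * g y ^ M \<le> B * k ^ M0" using B(2)[OF y] f0[of y] g01 by (intro mult_mono) auto
      also have "\<dots> < 1" using M0 B by (simp add: field_simps)
      finally show ?thesis .
    next
      case False
      then have "f y < 1" using y by (auto simp: T_def)
      moreover have "f y * g y ^ M \<le> f y * 1" using f0 g01 by (intro mult_left_mono power_le_one) auto
      ultimately show ?thesis by linarith
    qed
  qed
qed


lemma torus_sym_open_add_int:
  assumes "torus_sym_open U"
  shows "x + of_int z \<in> U \<longleftrightarrow> x \<in> U"
proof -
  have per: "x \<in> U \<longleftrightarrow> x + 1 \<in> U" for x using assms by (simp add: torus_sym_open_def)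
  have nat: "x + real n \<in> U \<longleftrightarrow> x \<in> U" for x n
  proof (induction n)
    case (Suc n)
    have "x + real (Suc n) = (x + real n) + 1" by simp
    then show ?case using per[of "x + real n"] Suc by metis
  qed simp
  show ?thesis
  proof (cases "z \<ge> 0")
    case True
    then show ?thesis using nat[of x "nat z"] by simp
  next
    case False
    then show ?thesis using nat[of "x + of_int z" "nat (- z)"] by simp
  qed
qed

lemma torus_sym_open_inner_point:
  assumes "torus_sym_open U"
  obtains x where "x \<in> U" "0 < x" "x < (1::real)"
proof -
  have "U \<inter> {0<..<1} \<noteq> {}"
  proof
    assume e: "U \<inter> {0<..<1} = {}"
    have "U \<inter> {0..1} \<subseteq> {0, 1}"
    proof
      fix x assume "x \<in> U \<inter> {0..1}"
      moreover then have "x \<notin> {0<..<1}" using e by auto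
      ultimately show "x \<in> {0, 1}" by auto
    qed
    then have "finite (U \<inter> {0..1})" using finite_subset by blast
    then have "measure lborel (U \<inter> {0..1}) = 0" by (simp add: measure_def emeasure_lborel_countable countable_finite)
    then show False using assms by (simp add: torus_sym_open_def)
  qed
  then show ?thesis using that by auto
qed

text \<open>The block is \<open>R\<inverse> ((1 + z^k') / 2)^L ((1 + z^h) / 2)^M P(w, z^(h/2))\<close> with \<open>h = 2^n\<close> and \<open>k k' = 1\<close> modulo \<open>h\<close>,
  where \<open>k / h \<in> U\<close>: the factor with \<open>M\<close> localises at the points \<open>j / h\<close>, where \<open>P\<close> is evaluated at
  \<open>u = (-1)^j\<close>, and the factor with \<open>L\<close> singles out \<open>j = \<plusminus>k\<close> among the odd \<open>j\<close>.\<close>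

lemma concentration_block:
  assumes P: "nnpoly2 P" and ord: "0 < s" "s < q" "q < p" and U: "torus_sym_open U"
    and gap: "lpn p (\<lambda>x. P (circ x) 1) * lpn p (\<lambda>x. P (circ x) (-1)) < lpn q (\<lambda>x. P (circ x) (-1)) ^ 2"
    and nc: "lpn s (\<lambda>x. P (circ x) (-1)) < lpn q (\<lambda>x. P (circ x) (-1))"
  obtains b t0 where "nnpoly2 b" "\<And>t. t \<in> {0..1} \<Longrightarrow> slice_mean b s t < 1"
    "\<And>t. t \<in> {0..1} - U \<Longrightarrow> slice_mean b p t < 1" "t0 \<in> {0..1}" "slice_mean b q t0 > 1"
proof -
  define F where "F e = (\<lambda>x. P (circ x) e)" for e
  have Fc: "continuous_on {0..1} (F e)" for e
    unfolding F_def by (intro continuous_on_nnpoly2[OF P] continuous_intros)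
  have q0: "0 < q" "0 < p" using ord by auto
  define Np where "Np = lpn p (F 1)"
  define Nm where "Nm = lpn p (F (-1))"
  define Nq where "Nq = lpn q (F (-1))"
  define Ns where "Ns = lpn s (F (-1))"
  have gap': "Np * Nm < Nq ^ 2" "Ns < Nq" using gap nc by (auto simp: Np_def Nm_def Nq_def Ns_def F_def)
  have pos: "0 \<le> Np" "0 \<le> Ns" by (auto simp: Np_def Ns_def lpn_nonneg)
  then have Nq: "0 < Nq" using gap' by linarith
  have NqNm: "Nq \<le> Nm" unfolding Nq_def Nm_def by (rule lpn_mono[OF _ _ Fc]) (use ord in auto)
  have NsNp: "lpn s (F 1) \<le> Np" unfolding Np_def by (rule lpn_mono[OF _ _ Fc]) (use ord in auto)
  \<comment> \<open>The window for \<open>\<tau> ^ L\<close>: above \<alpha> the chosen pair beats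
    the even points, below \<beta> it beats the other odd points. The gap hypothesis says that the
    window is not empty.\<close>
  define \<alpha> where "\<alpha> = Np / Nq"
  define \<beta> where "\<beta> = Nq / Nm"
  have \<beta>: "0 < \<beta>" "\<beta> \<le> 1" using Nq NqNm by (auto simp: \<beta>_def)
  have ab: "\<alpha> / \<beta> < 1" using gap' Nq NqNm by (simp add: \<alpha>_def \<beta>_def power2_eq_square field_simps)
  obtain x where x: "x \<in> U" "0 < x" "x < 1" using torus_sym_open_inner_point[OF U] .
  have "open U" using U by (simp add: torus_sym_open_def)
  from dyadic_odd_in_open[OF this x] obtain n0 where
    n0: "\<And>n. n \<ge> n0 \<Longrightarrow> \<exists>k. odd k \<and> k < 2 ^ n \<and> real k / 2 ^ n \<in> U" by blast
  \<comment> \<open>The damping \<tau> at the pair tends to 1 on finer grids, so that its powers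
    eventually step finely enough to meet the window.\<close>
  have "(\<lambda>n. cos (pi * (1/2) ^ n)) \<longlonglongrightarrow> cos (pi * 0)" by (intro tendsto_intros) auto
  then have "\<forall>\<^sub>F n in sequentially. \<alpha> / \<beta> < cos (pi * (1/2) ^ n)" using ab by (intro order_tendstoD(1)) auto
  then obtain n1 where n1: "\<And>n. n \<ge> n1 \<Longrightarrow> \<alpha> / \<beta> < cos (pi * (1/2) ^ n)" by (auto simp: eventually_sequentially)
  define n where "n = n0 + n1 + 3"
  define h where "h = (2::nat) ^ n"
  define h2 where "h2 = (2::nat) ^ (n - 1)"
  have n3: "n = Suc (n - 1)" "3 \<le> n" by (simp_all add: n_def)
  have h: "h = 2 * h2" unfolding h_def h2_def by (subst n3(1)) (simp only: power_Suc)
  then have heven: "even h" by simp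
  have "(2::nat) ^ 3 \<le> h" unfolding h_def using n3(2) by (rule power_increasing) simp
  then have h8: "8 \<le> h" by simp
  obtain k where k: "odd k" "k < h" "real k / real h \<in> U" using n0[of n] by (auto simp: n_def h_def)
  have "coprime k h" using k(1) by (simp add: h_def)
  moreover have "k \<noteq> 0" using k(1) by (cases k) auto
  \<comment> \<open>Multiplication by \<open>k'\<close> permutes the odd residues and sends
    \<open>k\<close> to 1. So the factor with exponent \<open>k'\<close>, which decreases with the
    distance of the residue from 0 modulo \<open>h\<close>, is largest among odd points at those
    congruent to \<open>k\<close> or \<open>- k\<close>.\<close>
  ultimately obtain k' y' where kk: "k * k' = h * y' + 1" using bezout_nat[of k h] by auto
  have k'odd: "odd k'" using kk heven by (metis even_add even_mult_iff odd_one)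
  define \<tau> where "\<tau> = cos (pi * 1 / real h)"
  have \<tau>n: "\<tau> = cos (pi * (1/2) ^ n)" by (simp add: \<tau>_def h_def power_one_over)
  have pih: "0 < pi / real h" using h8 by simp
  have pih2: "pi / real h < pi / 2" by (rule divide_strict_left_mono) (use h8 in auto)
  have \<tau>0: "0 < \<tau>" unfolding \<tau>_def using pih pih2 by (intro cos_gt_zero) auto
  have \<tau>1: "\<tau> < 1" unfolding \<tau>_def using cos_monotone_0_pi[of 0 "pi / real h"] pih pih2 by auto
  have \<tau>ab: "\<alpha> / \<beta> < \<tau>" unfolding \<tau>n by (rule n1) (simp add: n_def)
  obtain L where L: "\<alpha> < \<tau> ^ L" "\<tau> ^ L < \<beta>" using power_between[OF \<beta> \<tau>ab \<tau>0 \<tau>1] .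
  have L1: "Np < \<tau> ^ L * Nq" using L(1) Nq by (simp add: \<alpha>_def field_simps)
  have "\<tau> ^ L * Nm < Nq" using L(2) Nq NqNm by (simp add: \<beta>_def field_simps)
  then have L2: "(\<tau> ^ 2) ^ L * Nm < \<tau> ^ L * Nq" using \<tau>0 by (simp add: power2_eq_square power_mult_distrib mult.assoc)
  have L3: "\<tau> ^ L * Ns < \<tau> ^ L * Nq" using gap'(2) \<tau>0 by simp
  \<comment> \<open>Dividing by \<open>R\<close> moves the threshold to 1: all competing values lie
    below \<open>R\<close>, and the value of the \<open>q\<close>-norm at the pair lies
    above.\<close>
  obtain R where R: "max Np (max ((\<tau> ^ 2) ^ L * Nm) (\<tau> ^ L * Ns)) < R" "R < \<tau> ^ L * Nq"
    using dense[of "max Np (max ((\<tau> ^ 2) ^ L * Nm) (\<tau> ^ L * Ns))" "\<tau> ^ L * Nq"] L1 L2 L3 by auto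
  have R0: "0 < R" using R(1) pos by linarith
  define B where "B w z = complex_of_real (1 / R) * ((1 + z ^ k') * complex_of_real (1/2)) ^ L * P w (z ^ h2)" for w z
  define b where "b M w z = B w z * ((1 + z ^ h) * complex_of_real (1/2)) ^ M" for M w z
  have one: "nnpoly2 (\<lambda>w z. 1)" using nnpoly2.const[of 1] by simp
  have zpow: "nnpoly2 (\<lambda>w z. z ^ j)" for j by (rule nnpoly2_power[OF nnpoly2.snd])
  have Bnn: "nnpoly2 B" unfolding B_def
    by (intro nnpoly2.mult nnpoly2_power nnpoly2.add one zpow nnpoly2.const nnpoly2_compose[OF P nnpoly2.fst zpow]) (use R0 in auto)
  have bnn: "nnpoly2 (b M)" for M unfolding b_def
    by (intro nnpoly2.mult nnpoly2_power nnpoly2.add one zpow nnpoly2.const Bnn) auto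
  define c1 where "c1 y = \<bar>cos (pi * (real k' * y))\<bar>" for y
  define c2 where "c2 y = \<bar>cos (pi * (real h * y))\<bar>" for y
  have c01: "0 \<le> c1 y" "c1 y \<le> 1" "0 \<le> c2 y" "c2 y \<le> 1" for y by (auto simp: c1_def c2_def)
  have half: "norm ((1 + circ y ^ j) * complex_of_real (1/2)) = \<bar>cos (pi * (real j * y))\<bar>" for j y
    using norm_half_one_plus_circ[of "real j * y"] by (simp add: circ_power)
  have nB: "norm (B (circ x) (circ y)) = (1 / R * c1 y ^ L) * norm (P (circ x) (circ (real h2 * y)))" for x y
    unfolding B_def norm_mult norm_power half[unfolded norm_mult] c1_def circ_power[of y h2]
    using R0 by (simp add: norm_divide)
  have nb: "norm (b M (circ x) (circ y)) = norm (B (circ x) (circ y)) * c2 y ^ M" for M x y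
    unfolding b_def norm_mult norm_power half[unfolded norm_mult] c2_def ..
  have sb: "slice_mean (b M) a y = slice_mean B a y * (c2 y powr a) ^ M" if "a > 0" for M a y
  proof -
    have pw: "(c2 y ^ M) powr a = (c2 y powr a) ^ M" using c01(3)[of y] that
      by (induction M) (auto simp: powr_mult)
    show ?thesis unfolding slice_mean_def nb using c01(3)[of y]
      by (simp add: powr_mult pw)
  qed
  have sB: "slice_mean B a y = (c1 y ^ L * lpn a (F e) / R) powr a" if "circ (real h2 * y) = e" "a > 0" for a y e
  proof -
    have "slice_mean B a y = (1 / R * c1 y ^ L) powr a * integral {0..1} (\<lambda>x. norm (F e x) powr a)"
      unfolding slice_mean_def nB that(1) F_def
      by (simp only: powr_mult integral_mult_right)
    also have "integral {0..1} (\<lambda>x. norm (F e x) powr a) = lpn a (F e) powr a"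
      by (rule lpn_powr[OF that(2) Fc, symmetric])
    also have "(1 / R * c1 y ^ L) powr a * lpn a (F e) powr a = (1 / R * c1 y ^ L * lpn a (F e)) powr a"
      by (rule powr_mult[symmetric])
    finally show ?thesis by (simp add: mult_ac)
  qed
  have sB1: "slice_mean B a y < 1" if "circ (real h2 * y) = e" "a > 0" "c1 y ^ L * lpn a (F e) < R" for a y e
  proof -
    have "c1 y ^ L * lpn a (F e) / R < 1" using that(3) R0 by simp
    moreover have "0 \<le> c1 y ^ L * lpn a (F e) / R" using R0 c01(1)[of y] lpn_nonneg[of a "F e"] by simp
    ultimately have "(c1 y ^ L * lpn a (F e) / R) powr a < 1 powr a" using that(2) by (intro powr_less_mono2) auto
    then show ?thesis unfolding sB[OF that(1,2)] by simp
  qed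
  have circ_half: "circ (real h2 * (real j / real h)) = (if even j then 1 else -1)" for j
  proof -
    have e: "real h2 * (real j / real h) = real j / 2" using h8 unfolding h by (simp add: field_simps)
    show ?thesis
    proof (cases "even j")
      case True
      then obtain i where "j = 2 * i" by (elim evenE)
      then show ?thesis unfolding e using circ_add_of_nat[of 0 i] by (simp add: circ_def)
    next
      case False
      then obtain i where "j = 2 * i + 1" by (elim oddE)
      then have j2: "real j / 2 = 1/2 + real i" by simp
      have "circ (1/2) = -1" by (simp add: circ_def)
      then show ?thesis unfolding e j2 circ_add_of_nat using False by simp
    qed
  qed
  have grid: "\<exists>j::nat. y = real j / real h" if "c2 y = 1" "y \<in> {0..1}" for y
  proof -
    have "(cos (pi * (real h * y))) ^ 2 = 1" using that(1) by (simp add: c2_def power2_eq_1_iff abs_if split: if_splits)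
    then have "sin ((real h * y) * pi) = 0" using sin_cos_squared_add[of "pi * (real h * y)"] by (simp add: mult.commute)
    then have "real h * y \<in> \<int>" by (simp only: sin_times_pi_eq_0)
    then obtain z where z: "real h * y = of_int z" by (auto elim: Ints_cases)
    have "0 \<le> real h * y" using that by simp
    then have "real h * y = real (nat z)" using z by simp
    then show ?thesis using h8 by (intro exI[of _ "nat z"]) (simp add: field_simps)
  qed
  have res: "c1 (real j / real h) = \<bar>cos (pi * real ((k' * j) mod h) / real h)\<bar>" for j
  proof -
    have "real (k' * j) = real (h * ((k' * j) div h) + (k' * j) mod h)" by simp
    then have kj: "real k' * real j = real h * real ((k' * j) div h) + real ((k' * j) mod h)"
      by (simp only: of_nat_mult of_nat_add)
    have "pi * (real k' * (real j / real h)) = pi * (real k' * real j) / real h" by simp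
    also have "\<dots> = pi * of_int (int ((k' * j) div h)) + pi * real ((k' * j) mod h) / real h"
      unfolding kj using h8 by (simp add: field_simps)
    finally show ?thesis unfolding c1_def by (simp only: abs_cos_add_int_pi)
  qed
  have resodd: "odd ((k' * j) mod h)" if "odd j" for j
    using that k'odd heven by (simp add: dvd_mod_iff)
  have odd1: "c1 (real j / real h) \<le> \<tau>" if "odd j" for j
  proof -
    have "1 \<le> (k' * j) mod h" using resodd[OF that] by (cases "(k' * j) mod h") auto
    moreover have "(k' * j) mod h + 1 \<le> h" using h8 by (simp add: Suc_le_eq)
    ultimately have "\<bar>cos (pi * real ((k' * j) mod h) / real h)\<bar> \<le> cos (pi * real 1 / real h)"
      using h8 by (intro abs_cos_le_of_residue) auto
    then show ?thesis unfolding res \<tau>_def by simp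
  qed
  have odd2: "c1 (real j / real h) \<le> \<tau> ^ 2" if "odd j" "real j / real h \<notin> U" for j
  proof -
    define i where "i = (k' * j) mod h"
    define m where "m = (k' * j) div h"
    have kj: "k' * j = h * m + i" by (simp add: i_def m_def)
    have i: "i < h" "odd i" using h8 resodd[OF that(1)] by (auto simp: i_def)
    have ikk: "int k * int k' = int h * int y' + 1" using kk by (metis of_nat_1 of_nat_add of_nat_mult)
    have ikj: "int k' * int j = int h * int m + int i" using kj by (metis of_nat_add of_nat_mult)
    \<comment> \<open>Multiplying the residue by \<open>k\<close> recovers \<open>j\<close> modulo
      \<open>h\<close>. Residue 1 or \<open>h - 1\<close> would thus make \<open>j\<close> congruent
      to \<open>k\<close> or \<open>- k\<close> and put \<open>j / h\<close> in \<open>U\<close> by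
      symmetry and periodicity; any other odd residue is at least 3 away from both 0 and
      \<open>h\<close>.\<close>
    have key: "int j = int k * int i + int h * (int k * int m - int y' * int j)"
    proof -
      have "int k * (int k' * int j) = int k * (int h * int m + int i)" unfolding ikj ..
      moreover have "int k * (int k' * int j) = (int h * int y' + 1) * int j" unfolding ikk[symmetric] by simp
      ultimately show ?thesis by (simp add: algebra_simps)
    qed
    have notU: "\<not> int j = e * int k + int h * z" if e: "e = 1 \<or> e = -1" for e z
    proof
      assume "int j = e * int k + int h * z"
      then have "real j = of_int e * real k + real h * of_int z" by (metis of_int_add of_int_mult of_int_of_nat_eq)
      then have "real j / real h = of_int e * (real k / real h) + of_int z" using h8 by (simp add: field_simps)
      moreover have "- (real k / real h) \<in> U" using U k(3) unfolding torus_sym_open_def by blast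
      then have "of_int e * (real k / real h) \<in> U" using k(3) e by (elim disjE) simp_all
      ultimately have "real j / real h \<in> U" by (simp only: torus_sym_open_add_int[OF U])
      then show False using \<open>real j / real h \<notin> U\<close> by simp
    qed
    have "i \<noteq> 1" using key notU[of 1] by auto
    moreover have "i \<noteq> h - 1"
    proof
      assume "i = h - 1"
      then have ih: "int i = int h - 1" using h8 by simp
      have "int j = -1 * int k + int h * (int k + int k * int m - int y' * int j)"
        using key[unfolded ih] by (simp add: algebra_simps)
      then show False using notU[of "-1"] by blast
    qed
    ultimately have "3 \<le> i \<and> i + 3 \<le> h" using i heven by presburger
    then have "\<bar>cos (pi * real i / real h)\<bar> \<le> cos (pi * real 3 / real h)"
      using h8 by (intro abs_cos_le_of_residue) auto
    also have "\<dots> = cos (3 * (pi * 1 / real h))" by (simp add: mult.commute)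
    also have "\<dots> \<le> \<tau> ^ 2" unfolding \<tau>_def using \<tau>0 by (intro cos_triple_le_cos_squared) (simp add: \<tau>_def)
    finally show ?thesis unfolding res i_def .
  qed
  have evenB: "c1 y ^ L * lpn a (F 1) < R" if "a = s \<or> a = p" for a y
  proof -
    have "lpn a (F 1) \<le> Np" using that NsNp by (auto simp: Np_def)
    moreover have "c1 y ^ L * lpn a (F 1) \<le> 1 * lpn a (F 1)"
      using c01[of y] lpn_nonneg by (intro mult_right_mono power_le_one) auto
    ultimately show ?thesis using R(1) by simp
  qed
  \<comment> \<open>For \<open>s\<close> the pair in \<open>U\<close> gets no exemption. There the
    weaker damping \<open>\<tau> ^ L\<close> suffices because \<open>Ns < Nq\<close>.\<close>
  have alts: "slice_mean B s y < 1 \<or> c2 y powr s < 1" if yin: "y \<in> {0..1}" for y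
  proof (cases "c2 y = 1")
    case True
    then obtain j where j: "y = real j / real h" using grid[of y] yin by blast
    show ?thesis
    proof (cases "even j")
      case True
      then show ?thesis using sB1[of y 1 s] circ_half[of j] evenB[of s y] ord j by auto
    next
      case False
      have "c1 y ^ L * Ns \<le> \<tau> ^ L * Ns" using odd1[OF False] c01(1)[of y] pos unfolding j by (intro mult_right_mono power_mono) auto
      also have "\<dots> < R" using R(1) by simp
      finally show ?thesis using sB1[of y "-1" s] circ_half[of j] False ord j by (auto simp: Ns_def)
    qed
  next
    case False
    then have "c2 y powr s < 1 powr s" using c01[of y] ord by (intro powr_less_mono2) auto
    then show ?thesis by simp
  qed
  have altp: "slice_mean B p y < 1 \<or> c2 y powr p < 1" if yin: "y \<in> {0..1} - U" for y
  proof (cases "c2 y = 1")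
    case True
    then obtain j where j: "y = real j / real h" using grid[of y] yin by blast
    show ?thesis
    proof (cases "even j")
      case True
      then show ?thesis using sB1[of y 1 p] circ_half[of j] evenB[of p y] q0 j by auto
    next
      case False
      have "c1 y ^ L * Nm \<le> (\<tau> ^ 2) ^ L * Nm" using odd2[OF False] yin c01(1)[of y] NqNm Nq unfolding j by (intro mult_right_mono power_mono) auto
      also have "\<dots> < R" using R(1) by simp
      finally show ?thesis using sB1[of y "-1" p] circ_half[of j] False q0 j by (auto simp: Nm_def)
    qed
  next
    case False
    then have "c2 y powr p < 1 powr p" using c01[of y] q0 by (intro powr_less_mono2) auto
    then show ?thesis by simp
  qed
  have c2c: "continuous_on S (\<lambda>y. c2 y powr a)" if "a > 0" for S a
    unfolding c2_def using that by (intro continuous_on_powr' continuous_intros) auto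
  have sm0: "0 \<le> slice_mean B a y" if "a > 0" for a y unfolding slice_mean_def
    by (intro integral_nonneg integrable_continuous_interval continuous_on_norm_powr continuous_on_nnpoly2[OF Bnn] continuous_intros that) auto
  have c2p: "0 \<le> c2 y powr a" "c2 y powr a \<le> 1" if "a > 0" for y a using c01[of y] that by (auto intro: powr_le1)
  obtain Ms where Ms: "\<And>M y. M \<ge> Ms \<Longrightarrow> y \<in> {0..1} \<Longrightarrow> slice_mean B s y * (c2 y powr s) ^ M < 1"
    by (rule compact_damping[of "{0..1}" "slice_mean B s" "\<lambda>y. c2 y powr s"])
      (use alts c2c c2p sm0 ord continuous_on_slice_mean[OF Bnn] in auto)
  obtain Mp where Mp: "\<And>M y. M \<ge> Mp \<Longrightarrow> y \<in> {0..1} - U \<Longrightarrow> slice_mean B p y * (c2 y powr p) ^ M < 1"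
    by (rule compact_damping[of "{0..1} - U" "slice_mean B p" "\<lambda>y. c2 y powr p"])
      (use altp c2c c2p sm0 q0 continuous_on_slice_mean[OF Bnn] \<open>open U\<close> in \<open>auto intro: compact_diff\<close>)
  define t0 where "t0 = real k / real h"
  have t0: "t0 \<in> {0..1}" using k(2) h8 by (auto simp: t0_def)
  have "c2 t0 = 1" using abs_cos_add_int_pi[of "int k" 0] h8 by (simp add: c2_def t0_def)
  have "(k' * k) mod h = 1" using kk h8 by (simp add: mult.commute mod_mult_self4[of h y' 1, simplified])
  then have c1t0: "c1 t0 = \<tau>" unfolding t0_def res using \<tau>0 by (simp add: \<tau>_def)
  have "1 powr q < (\<tau> ^ L * Nq / R) powr q" using R(2) R0 q0 by (intro powr_less_mono2) auto
  then have "1 < slice_mean (b (Ms + Mp)) q t0"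
    using sB[of t0 "-1" q] circ_half[of k] k(1) q0 c1t0 \<open>c2 t0 = 1\<close> sb[of q] by (simp add: t0_def Nq_def)
  then show ?thesis
    using Ms[of "Ms + Mp"] Mp[of "Ms + Mp"] sb ord q0
    by (intro that[OF bnn[of "Ms + Mp"] _ _ t0]) auto
qed

subsection \<open>From a majorant gap to the counterexamples\<close>

lemma majorant_gap_counterexample:
  assumes P: "nnpoly2 P" and ord: "0 < s" "s < q" "q < p" and U: "torus_sym_open U"
    and gap: "lpn p (\<lambda>x. P (circ x) 1) * lpn p (\<lambda>x. P (circ x) (-1)) < lpn q (\<lambda>x. P (circ x) (-1)) ^ 2"
    and nc: "lpn s (\<lambda>x. P (circ x) (-1)) < lpn q (\<lambda>x. P (circ x) (-1))"
  obtains c :: "nat \<Rightarrow> real" and f :: "real \<Rightarrow> complex" and H :: "real \<Rightarrow> real"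
  where "\<And>n. 0 \<le> c n" "\<And>n. c n \<le> (1 + real n) ^ 2"
    "f \<in> borel_measurable borel"
    "AE t in lebesgue_on {0..1}. ((\<lambda>r. \<Sum>n. of_real (c n) * (of_real r * circ t) ^ n) \<longlongrightarrow> f t) (at_left 1)"
    "integrable (lebesgue_on {0..1}) H"
    "AE t in lebesgue_on {0..1}. \<forall>r\<in>{0<..<1}. norm (\<Sum>n. of_real (c n) * (of_real r * circ t) ^ n) powr s \<le> H t"
    "AE t in lebesgue_on {0..1}. norm (f t) powr s \<le> H t"
    "integrable (lebesgue_on ({0..1} - U)) (\<lambda>t. norm (f t) powr p)"
    "\<not> integrable (lebesgue_on {0..1}) (\<lambda>t. norm (f t) powr q)"
proof -
  have q0: "0 < q" "0 < p" and oU: "open U" using ord U by (auto simp: torus_sym_open_def)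
  obtain b t0 where b: "nnpoly2 b" "\<And>t. t \<in> {0..1} \<Longrightarrow> slice_mean b s t < 1"
    "\<And>t. t \<in> {0..1} - U \<Longrightarrow> slice_mean b p t < 1" "t0 \<in> {0..1}" "slice_mean b q t0 > 1"
    by (rule concentration_block[OF P ord U gap nc]) (rule that, assumption+)
  obtain w where w: "continuous_on UNIV w" "\<And>t. 0 \<le> w t" "\<And>t. w t \<le> (1::real)"
    "\<And>t. t \<in> {0..1} - U \<Longrightarrow> w t = 1"
    "\<And>\<epsilon> K. \<epsilon> > 0 \<Longrightarrow> \<exists>g. nnpoly g \<and> integral {0..1} (\<lambda>t. norm (g (circ t)) powr s) < \<epsilon>
       \<and> integral {0..1} (\<lambda>t. w t * norm (g (circ t)) powr p) < \<epsilon>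
       \<and> integral {0..1} (\<lambda>t. norm (g (circ t)) powr q) > K"
    by (rule riesz_product_concentration[OF b(1) ord(1) q0 oU b(2,3,4,5)]) (assumption | rule that | assumption+)+
  show ?thesis
    by (rule glue_blocks[OF ord(1) q0 oU w(1,2,4,5)]) (assumption | rule that | assumption+)+
qed

section \<open>Fourier coefficients and boundary values of the constructed function\<close>

lemma integral_circ_character:
  fixes m :: nat and n :: int
  shows "integral\<^sup>L (lebesgue_on {0..1}) (\<lambda>t. circ t ^ m * exp (- (2 * pi * \<i> * of_int n * of_real t)))
    = (if int m = n then 1 else 0)"
proof -
  define d where "d = int m - n"
  have eq: "circ t ^ m * exp (- (2 * pi * \<i> * of_int n * of_real t)) = exp (of_real t * (2 * pi * \<i> * of_int d))" for t
    unfolding exp_eq_circ_power[symmetric] exp_add[symmetric] by (simp add: d_def algebra_simps)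
  have cont: "continuous_on {0..1} (\<lambda>t. exp (of_real t * (2 * pi * \<i> * of_int d)))"
    by (intro continuous_intros)
  have L: "integral\<^sup>L (lebesgue_on {0..1}) (\<lambda>t. exp (of_real t * (2 * pi * \<i> * of_int d))) = integral {0..1} (\<lambda>t. exp (of_real t * (2 * pi * \<i> * of_int d)))"
    using continuous_imp_integrable_real[OF cont] by (intro lebesgue_integral_eq_integral) auto
  show ?thesis
  proof (cases "d = 0")
    case True
    then show ?thesis unfolding eq L by (simp add: d_def)
  next
    case False
    define a where "a = 2 * pi * \<i> * of_int d"
    have a: "a \<noteq> 0" using False by (simp add: a_def)
    have "((\<lambda>t. exp (of_real t * a)) has_integral (exp (of_real 1 * a) / a - exp (of_real 0 * a) / a)) {0..1}"
    proof (rule fundamental_theorem_of_calculus)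
      fix t :: real
      have "((\<lambda>z. exp (z * a) / a) has_field_derivative exp (of_real t * a)) (at (of_real t))"
        using a by (auto intro!: derivative_eq_intros)
      then have "((\<lambda>t. exp (of_real t * a) / a) has_vector_derivative exp (of_real t * a)) (at t)"
        by (rule has_vector_derivative_real_field)
      then show "((\<lambda>t. exp (of_real t * a) / a) has_vector_derivative exp (of_real t * a)) (at t within {0..1})"
        by (rule has_vector_derivative_at_within)
    qed simp
    moreover have "exp a = 1"
      using exp_integer_2pi[of "of_int d"] by (simp add: a_def mult_ac)
    ultimately have "integral {0..1} (\<lambda>t. exp (of_real t * a)) = 0" by (simp add: integral_unique)
    moreover have "int m \<noteq> n" using False by (simp add: d_def)
    ultimately show ?thesis using L unfolding eq a_def[symmetric] by simp
  qed
qed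

lemma power_series_fourier_coeff:
  fixes c :: "nat \<Rightarrow> real"
  assumes c: "\<And>n. 0 \<le> c n" "\<And>n. c n \<le> (1 + real n) ^ 2" and r: "0 < r" "r < 1"
  shows "fourier_coeff (\<lambda>t. \<Sum>m. of_real (c m) * (of_real r * circ t) ^ m) n
    = (if n < 0 then 0 else of_real (c (nat n) * r ^ nat n))"
proof -
  let ?M = "lebesgue_on {0..1::real}"
  let ?E = "\<lambda>t. exp (- (2 * pi * \<i> * of_int n * of_real t))"
  have E1: "norm (?E t) = 1" for t :: real by (simp add: norm_exp_eq_Re)
  have sm: "summable (\<lambda>m. c m * r ^ m)"
    by (rule summable_comparison_test'[OF summable_quadratic_powser[of r], of 0])
      (use c r in \<open>auto intro: mult_right_mono\<close>)
  define F where "F m t = of_real (c m * r ^ m) * (circ t ^ m * ?E t)" for m and t :: real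
  have nF: "norm (F m t) = c m * r ^ m" for m t
    using c r by (simp add: F_def norm_mult norm_power E1[simplified])
  have smF: "summable (\<lambda>m. F m t)" for t by (rule summable_norm_cancel) (simp add: nF sm)
  have Fint: "integrable ?M (F m)" for m
    unfolding F_def by (intro continuous_imp_integrable_real continuous_intros)
  have FI: "integral\<^sup>L ?M (F m) = of_real (c m * r ^ m) * (if int m = n then 1 else 0)" for m
    unfolding F_def integral_circ_character[symmetric] by (rule integral_mult_right_zero)
  have "fourier_coeff (\<lambda>t. \<Sum>m. of_real (c m) * (of_real r * circ t) ^ m) n = integral\<^sup>L ?M (\<lambda>t. \<Sum>m. F m t)"
    unfolding fourier_coeff_def
  proof (rule Bochner_Integration.integral_cong[OF refl])
    fix t :: real
    have eq: "of_real (c m) * (of_real r * circ t) ^ m * ?E t = F m t" for m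
      by (simp add: F_def power_mult_distrib)
    have "summable (\<lambda>m. of_real (c m) * (of_real r * circ t) ^ m)"
      by (rule summable_norm_cancel) (use sm c r in \<open>simp add: norm_mult norm_power\<close>)
    then show "(\<Sum>m. of_real (c m) * (of_real r * circ t) ^ m) * ?E t = (\<Sum>m. F m t)"
      unfolding eq[symmetric] by (rule suminf_mult2)
  qed
  also have "\<dots> = (\<Sum>m. integral\<^sup>L ?M (F m))"
  proof (rule integral_suminf[OF Fint])
    show "AE t in ?M. summable (\<lambda>m. norm (F m t))" by (simp add: nF sm)
    show "summable (\<lambda>m. integral\<^sup>L ?M (\<lambda>t. norm (F m t)))"
      unfolding nF integrable_const_lebesgue_on_unit(2) by (rule sm)
  qed
  also have "\<dots> = (if n < 0 then 0 else of_real (c (nat n) * r ^ nat n))"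
  proof (cases "n < 0")
    case True
    then show ?thesis unfolding FI by simp
  next
    case False
    then have "(\<Sum>m. integral\<^sup>L ?M (F m)) = (\<Sum>m\<in>{nat n}. integral\<^sup>L ?M (F m))"
      by (intro suminf_finite) (auto simp: FI)
    then show ?thesis using False by (simp add: FI)
  qed
  finally show ?thesis .
qed

lemma filterlim_one_minus_inverse_at_left:
  "filterlim (\<lambda>k. 1 - 1 / (real k + 2)) (at_left 1) sequentially"
proof -
  have "(\<lambda>k. 1 - 1 / (real (k + 2))) \<longlonglongrightarrow> 1 - 0"
    by (intro tendsto_intros LIMSEQ_ignore_initial_segment lim_1_over_n)
  then show ?thesis
    by (simp add: filterlim_at add.commute[of 2])
qed

text \<open>The condition \<open>1 \<le> s\<close> gives \<open>x \<le> 1 + x powr s\<close>, so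
  \<open>1 + H\<close> dominates \<open>f\<close> and all its Abel means. Dominated convergence as
  the radius tends to 1 then identifies the Fourier coefficients of \<open>f\<close> with
  \<open>c\<close>.\<close>

lemma positive_definite_counterexample:
  assumes P: "nnpoly2 P" and ord: "1 \<le> s" "s < q" "q < p" and U: "torus_sym_open U"
    and gap: "lpn p (\<lambda>x. P (circ x) 1) * lpn p (\<lambda>x. P (circ x) (-1)) < lpn q (\<lambda>x. P (circ x) (-1)) ^ 2"
    and nc: "lpn s (\<lambda>x. P (circ x) (-1)) < lpn q (\<lambda>x. P (circ x) (-1))"
  shows "\<exists>f. positive_definite f \<and> Lp_on {0..1} s f \<and> (\<forall>n<0. fourier_coeff f n = 0)
    \<and> \<not> Lp_on {0..1} q f \<and> Lp_on ({0..1} - U) p f"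
proof -
  let ?M = "lebesgue_on {0..1::real}"
  have s0: "0 < s" using ord by simp
  obtain c :: "nat \<Rightarrow> real" and f H where c: "\<And>n. 0 \<le> c n" "\<And>n. c n \<le> (1 + real n) ^ 2"
    and fm: "f \<in> borel_measurable borel"
    and rad: "AE t in ?M. ((\<lambda>r. \<Sum>n. of_real (c n) * (of_real r * circ t) ^ n) \<longlongrightarrow> f t) (at_left 1)"
    and H: "integrable ?M H"
    and domr: "AE t in ?M. \<forall>r\<in>{0<..<1}. norm (\<Sum>n. of_real (c n) * (of_real r * circ t) ^ n) powr s \<le> H t"
    and domf: "AE t in ?M. norm (f t) powr s \<le> H t"
    and fp: "integrable (lebesgue_on ({0..1} - U)) (\<lambda>t. norm (f t) powr p)"
    and fq: "\<not> integrable ?M (\<lambda>t. norm (f t) powr q)"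
    by (rule majorant_gap_counterexample[OF P s0 ord(2,3) U gap nc]) (rule that, assumption+)
  have fmS: "f \<in> borel_measurable (lebesgue_on S)" for S by (rule borel_measurable_lebesgue_on_of_borel[OF fm])
  have le1: "x \<le> 1 + y" if "x powr s \<le> y" "0 \<le> x" for x y :: real
  proof (cases "x \<le> 1")
    case True
    have "0 \<le> y" using that(1) powr_ge_zero order_trans by blast
    then show ?thesis using True by simp
  next
    case False
    then have "x powr 1 \<le> x powr s" using ord(1) by (intro powr_mono) auto
    then show ?thesis using that False by simp
  qed
  have H1: "integrable ?M (\<lambda>t. 1 + H t)"
    using H integrable_const_lebesgue_on_unit(1) by (intro Bochner_Integration.integrable_add)
  have fint: "integrable ?M f"
  proof (rule Bochner_Integration.integrable_bound[OF H1 fmS])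
    show "AE t in ?M. norm (f t) \<le> norm (1 + H t)"
      using domf by eventually_elim (use le1 in force)
  qed
  have fs: "integrable ?M (\<lambda>t. norm (f t) powr s)"
  proof (rule Bochner_Integration.integrable_bound[OF H])
    show "(\<lambda>t. norm (f t) powr s) \<in> borel_measurable ?M" using fmS by measurable
    show "AE t in ?M. norm (norm (f t) powr s) \<le> norm (H t)"
      using domf by eventually_elim simp
  qed
  define R where "R k = 1 - 1 / (real k + 2)" for k :: nat
  have R: "0 < R k" "R k < 1" for k by (auto simp: R_def field_simps)
  have Rlim: "filterlim R (at_left 1) sequentially"
    unfolding R_def by (rule filterlim_one_minus_inverse_at_left)
  have coeff: "fourier_coeff f n = (if n < 0 then 0 else of_real (c (nat n)))" for n
  proof -
    let ?E = "\<lambda>t. exp (- (2 * pi * \<i> * of_int n * of_real t))"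
    have E1: "norm (?E t) = 1" for t :: real by (simp add: norm_exp_eq_Re)
    have Em: "?E \<in> borel_measurable borel" by (intro borel_measurable_continuous_onI continuous_intros)
    define G where "G r t = (\<Sum>m. of_real (c m) * (of_real r * circ t) ^ m)" for r t
    have Gm: "G r \<in> borel_measurable borel" for r unfolding G_def
      by (intro borel_measurable_suminf borel_measurable_continuous_onI continuous_intros)
    have "(\<lambda>k. fourier_coeff (G (R k)) n) \<longlonglongrightarrow> fourier_coeff f n"
      unfolding fourier_coeff_def
    proof (rule integral_dominated_convergence[OF _ _ H1])
      show "(\<lambda>t. f t * ?E t) \<in> borel_measurable ?M"
        using fm Em by (intro borel_measurable_lebesgue_on_of_borel borel_measurable_times)
      show "(\<lambda>t. G (R k) t * ?E t) \<in> borel_measurable ?M" for k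
        using Gm Em by (intro borel_measurable_lebesgue_on_of_borel borel_measurable_times)
      show "AE t in ?M. (\<lambda>k. G (R k) t * ?E t) \<longlonglongrightarrow> f t * ?E t"
        using rad
      proof eventually_elim
        case (elim t)
        then show ?case unfolding G_def by (intro tendsto_intros filterlim_compose[OF _ Rlim])
      qed
      show "AE t in ?M. norm (G (R k) t * ?E t) \<le> 1 + H t" for k
        using domr
      proof eventually_elim
        case (elim t)
        then have "norm (G (R k) t) powr s \<le> H t" using R by (simp add: G_def)
        then show ?case unfolding norm_mult E1 using le1 by simp
      qed
    qed
    moreover have "(\<lambda>k. fourier_coeff (G (R k)) n) \<longlonglongrightarrow> (if n < 0 then 0 else of_real (c (nat n) * 1 ^ nat n))"
    proof -
      have R1: "R \<longlonglongrightarrow> 1" using Rlim by (simp add: filterlim_at)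
      have "(\<lambda>k. if n < 0 then 0 else complex_of_real (c (nat n) * R k ^ nat n)) \<longlonglongrightarrow> (if n < 0 then 0 else of_real (c (nat n) * 1 ^ nat n))"
        by (cases "n < 0", simp, simp only: if_False) (intro tendsto_intros R1)
      then show ?thesis unfolding G_def power_series_fourier_coeff[OF c R] .
    qed
    ultimately show ?thesis using LIMSEQ_unique by fastforce
  qed
  show ?thesis
    by (rule exI[of _ f]) (use fint coeff c fmS fs fp fq in \<open>auto simp: positive_definite_def Lp_on_def\<close>)
qed

text \<open>For small \<open>s\<close> the boundary function need not be integrable, so the
  distribution is carried by the coefficients themselves. Bounded \<open>q\<close>-means of the Abel
  means would put \<open>f\<close> into the \<open>q\<close>-th power class by Fatou's lemma, which
  is excluded.\<close>

lemma Hardy_counterexample: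
  assumes P: "nnpoly2 P" and ord: "0 < s" "s < q" "q < p" and U: "torus_sym_open U"
    and gap: "lpn p (\<lambda>x. P (circ x) 1) * lpn p (\<lambda>x. P (circ x) (-1)) < lpn q (\<lambda>x. P (circ x) (-1)) ^ 2"
    and nc: "lpn s (\<lambda>x. P (circ x) (-1)) < lpn q (\<lambda>x. P (circ x) (-1))"
  shows "\<exists>c. in_Hardy s c \<and> (\<forall>n. Im (c n) = 0 \<and> Re (c n) \<ge> 0) \<and> \<not> in_Hardy q c
              \<and> (\<exists>g. boundary_value c g \<and> Lp_on ({0..1} - U) p g)"
proof -
  let ?M = "lebesgue_on {0..1::real}"
  obtain c :: "nat \<Rightarrow> real" and f H where c: "\<And>n. 0 \<le> c n" "\<And>n. c n \<le> (1 + real n) ^ 2"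
    and fm: "f \<in> borel_measurable borel"
    and rad: "AE t in ?M. ((\<lambda>r. \<Sum>n. of_real (c n) * (of_real r * circ t) ^ n) \<longlongrightarrow> f t) (at_left 1)"
    and H: "integrable ?M H"
    and domr: "AE t in ?M. \<forall>r\<in>{0<..<1}. norm (\<Sum>n. of_real (c n) * (of_real r * circ t) ^ n) powr s \<le> H t"
    and domf: "AE t in ?M. norm (f t) powr s \<le> H t"
    and fp: "integrable (lebesgue_on ({0..1} - U)) (\<lambda>t. norm (f t) powr p)"
    and fq: "\<not> integrable ?M (\<lambda>t. norm (f t) powr q)"
    by (rule majorant_gap_counterexample[OF P ord U gap nc]) (rule that, assumption+)
  have fmS: "f \<in> borel_measurable (lebesgue_on S)" for S by (rule borel_measurable_lebesgue_on_of_borel[OF fm])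
  define C where "C n = (if n < 0 then 0 else complex_of_real (c (nat n)))" for n :: int
  have abel: "abel_mean C r t = (\<Sum>n. of_real (c n) * (of_real r * circ t) ^ n)" for r t
    unfolding abel_mean_def exp_eq_circ_power by (simp add: C_def power_mult_distrib mult_ac)
  have Gm: "abel_mean C r \<in> borel_measurable borel" for r unfolding abel
    by (intro borel_measurable_suminf borel_measurable_continuous_onI continuous_intros)
  have GmM: "abel_mean C r \<in> borel_measurable ?M" for r by (rule borel_measurable_lebesgue_on_of_borel[OF Gm])
  have int: "integrable ?M (\<lambda>t. norm (abel_mean C r t) powr s)"
    and bd: "integral\<^sup>L ?M (\<lambda>t. norm (abel_mean C r t) powr s) \<le> integral\<^sup>L ?M H" if r: "r \<in> {0<..<1}" for r
  proof -
    have ae: "AE t in ?M. norm (abel_mean C r t) powr s \<le> H t"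
      using domr by eventually_elim (use r in \<open>simp add: abel\<close>)
    show int: "integrable ?M (\<lambda>t. norm (abel_mean C r t) powr s)"
    proof (rule Bochner_Integration.integrable_bound[OF H])
      show "(\<lambda>t. norm (abel_mean C r t) powr s) \<in> borel_measurable ?M" using GmM by measurable
      show "AE t in ?M. norm (norm (abel_mean C r t) powr s) \<le> norm (H t)"
        using ae by eventually_elim simp
    qed
    show "integral\<^sup>L ?M (\<lambda>t. norm (abel_mean C r t) powr s) \<le> integral\<^sup>L ?M H"
      by (rule integral_mono_AE[OF int H ae])
  qed
  have "norm (C n) \<le> 1 * (1 + real_of_int \<bar>n\<bar>) powr 2" for n
    using c(1)[of "nat n"] c(2)[of "nat n"] by (auto simp: C_def powr_numeral)
  then have growth: "\<exists>A K. \<forall>n. norm (C n) \<le> A * (1 + real_of_int \<bar>n\<bar>) powr K" by blast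
  have inH: "in_Hardy s C"
  proof -
    have "\<exists>B. \<forall>r\<in>{0<..<1}. integral\<^sup>L ?M (\<lambda>t. norm (abel_mean C r t) powr s) \<le> B" using bd by blast
    moreover have "\<forall>n<0. C n = 0" by (simp add: C_def)
    ultimately show ?thesis unfolding in_Hardy_def Lp_on_def using growth int GmM by blast
  qed
  have notH: "\<not> in_Hardy q C"
  proof
    assume "in_Hardy q C"
    then obtain B where B: "\<And>r. r \<in> {0<..<1} \<Longrightarrow> integral\<^sup>L ?M (\<lambda>t. norm (abel_mean C r t) powr q) \<le> B"
      and iq: "\<And>r. r \<in> {0<..<1} \<Longrightarrow> integrable ?M (\<lambda>t. norm (abel_mean C r t) powr q)"
      unfolding in_Hardy_def Lp_on_def by blast
    define R where "R k = 1 - 1 / (real k + 2)" for k :: nat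
    have R: "R k \<in> {0<..<1}" for k by (auto simp: R_def field_simps)
    have Rlim: "filterlim R (at_left 1) sequentially"
      unfolding R_def by (rule filterlim_one_minus_inverse_at_left)
    define u where "u k t = ennreal (norm (abel_mean C (R k) t) powr q)" for k t
    have um: "u k \<in> borel_measurable ?M" for k unfolding u_def using GmM by measurable
    have lim: "AE t in ?M. ennreal (norm (f t) powr q) = liminf (\<lambda>k. u k t)"
      using rad
    proof eventually_elim
      case (elim t)
      then have "(\<lambda>k. abel_mean C (R k) t) \<longlonglongrightarrow> f t" unfolding abel by (rule filterlim_compose[OF _ Rlim])
      then have "(\<lambda>k. norm (abel_mean C (R k) t) powr q) \<longlonglongrightarrow> norm (f t) powr q"
        using ord by (intro tendsto_powr' tendsto_norm tendsto_const) auto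
      then have "(\<lambda>k. u k t) \<longlonglongrightarrow> ennreal (norm (f t) powr q)" unfolding u_def by (rule tendsto_ennrealI)
      then show ?case by (simp add: lim_imp_Liminf)
    qed
    have "(\<integral>\<^sup>+t. ennreal (norm (f t) powr q) \<partial>?M) = (\<integral>\<^sup>+t. liminf (\<lambda>k. u k t) \<partial>?M)"
      by (rule nn_integral_cong_AE[OF lim])
    also have "\<dots> \<le> liminf (\<lambda>k. integral\<^sup>N ?M (u k))" by (rule nn_integral_liminf[OF um])
    also have "\<dots> \<le> liminf (\<lambda>k. ennreal B)"
    proof (rule Liminf_mono, rule always_eventually, rule allI)
      fix k
      have "integral\<^sup>N ?M (u k) = ennreal (integral\<^sup>L ?M (\<lambda>t. norm (abel_mean C (R k) t) powr q))"
        unfolding u_def by (rule nn_integral_eq_integral[OF iq[OF R]]) simp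
      then show "integral\<^sup>N ?M (u k) \<le> ennreal B" using B[OF R] by (simp add: ennreal_leI)
    qed
    also have "\<dots> = ennreal B" by (simp add: Liminf_const)
    finally have fin: "(\<integral>\<^sup>+t. ennreal (norm (f t) powr q) \<partial>?M) < \<infinity>" by (simp add: le_less_trans)
    have "integrable ?M (\<lambda>t. norm (f t) powr q)"
    proof (rule integrableI_bounded)
      show "(\<lambda>t. norm (f t) powr q) \<in> borel_measurable ?M" using fmS by measurable
    qed (use fin in simp)
    then show False using fq by simp
  qed
  have "boundary_value C f" unfolding boundary_value_def abel using rad .
  then show ?thesis
    using inH notH c(1) fmS fp by (intro exI[of _ C]) (auto simp: C_def Lp_on_def)
qed

subsection \<open>Majorant gap for exponents above two\<close>

lemma norm_powr_of_real:
  fixes z :: complex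
  assumes "z \<noteq> 0"
  shows "norm (z powr of_real a) = norm z powr a"
  using assms by (simp add: powr_def norm_exp_eq_Re)

text \<open>Convergence of the binomial series at 3/4 makes it absolutely convergent at 1/2; the
  tail with \<open>w ^ Suc m\<close> taken out is bounded by its absolute value sum there.\<close>

lemma binomial_taylor_remainder:
  fixes a :: real
  obtains C where "C \<ge> 0" "\<And>w::complex. norm w \<le> 1/2 \<Longrightarrow>
    norm ((1 + w) powr of_real a - (\<Sum>n\<le>m. of_real (a gchoose n) * w ^ n)) \<le> C * norm w ^ Suc m"
proof -
  define g where "g n = (complex_of_real a gchoose n)" for n
  have g: "g n = of_real (a gchoose n)" for n by (simp add: g_def gbinomial_prod_rev)
  have "summable (\<lambda>n. g n * (3/4) ^ n)"
    unfolding g_def by (rule sums_summable[OF gen_binomial_complex]) simp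
  then have "summable (\<lambda>n. norm (g n * (1/2) ^ n))" by (rule powser_insidea) simp
  then have "summable (\<lambda>n. norm (g (n + Suc m) * (1/2) ^ (n + Suc m)))" by (rule summable_ignore_initial_segment)
  then have "summable (\<lambda>n. 2 ^ Suc m * norm (g (n + Suc m) * (1/2) ^ (n + Suc m)))" by (rule summable_mult)
  then have sm: "summable (\<lambda>n. norm (g (n + Suc m)) * (1/2) ^ n)"
    by (simp add: norm_mult norm_power norm_divide power_add power_one_over mult_ac)
  define C where "C = (\<Sum>n. norm (g (n + Suc m)) * (1/2) ^ n)"
  show ?thesis
  proof (rule that[of C])
    show "C \<ge> 0" unfolding C_def by (intro suminf_nonneg sm) auto
    fix w :: complex assume w: "norm w \<le> 1/2"
    have "(\<lambda>n. g n * w ^ n) sums (1 + w) powr of_real a" unfolding g_def using w by (intro gen_binomial_complex) simp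
    then have s: "(1 + w) powr of_real a = (\<Sum>n. g (n + Suc m) * w ^ (n + Suc m)) + (\<Sum>n<Suc m. g n * w ^ n)"
      using suminf_split_initial_segment[of "\<lambda>n. g n * w ^ n" "Suc m"] by (simp add: sums_iff)
    have "norm (\<Sum>n. g (n + Suc m) * w ^ (n + Suc m)) \<le> (\<Sum>n. norm w ^ Suc m * (norm (g (n + Suc m)) * (1/2) ^ n))"
    proof (rule norm_suminf_le)
      fix n
      have "norm w ^ n \<le> (1/2) ^ n" using w by (intro power_mono) auto
      then have "(norm w ^ Suc m * norm (g (n + Suc m))) * norm w ^ n \<le> (norm w ^ Suc m * norm (g (n + Suc m))) * (1/2) ^ n"
        by (intro mult_left_mono) auto
      then show "norm (g (n + Suc m) * w ^ (n + Suc m)) \<le> norm w ^ Suc m * (norm (g (n + Suc m)) * (1/2) ^ n)"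
        by (simp add: norm_mult norm_power power_add mult_ac)
    qed (rule summable_mult[OF sm])
    also have "\<dots> = C * norm w ^ Suc m" unfolding C_def by (subst suminf_mult[OF sm]) (simp add: mult.commute)
    finally show "norm ((1 + w) powr of_real a - (\<Sum>n\<le>m. of_real (a gchoose n) * w ^ n)) \<le> C * norm w ^ Suc m"
      by (simp add: s lessThan_Suc_atMost[symmetric] g)
  qed
qed

lemma circ_orthogonality:
  "((\<lambda>x. circ x ^ j * cnj (circ x ^ n)) has_integral (if j = n then 1 else 0)) {0..1}"
proof -
  have eq: "exp (- (2 * pi * \<i> * of_int (int n) * of_real x)) = cnj (circ x ^ n)" for x
    unfolding exp_eq_circ_power[symmetric] by (simp add: exp_cnj)
  have cont: "continuous_on {0..1} (\<lambda>x. circ x ^ j * cnj (circ x ^ n))" by (intro continuous_intros)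
  have "integral {0..1} (\<lambda>x. circ x ^ j * cnj (circ x ^ n)) = (if j = n then 1 else 0)"
    using integral_circ_character[of j "int n"] lebesgue_integral_eq_integral[OF continuous_imp_integrable_real[OF cont]]
    unfolding eq by simp
  then show ?thesis using integrable_integral[OF integrable_continuous_interval[OF cont]] by simp
qed

text \<open>This is where evenness matters: only the last factor of the product is negative, whereas
  at the endpoints \<open>a = l\<close> and \<open>a = l + 1\<close>, that is for even
  \<open>p = 2 * a\<close>, some factor vanishes.\<close>

lemma gbinomial_negative:
  assumes "real l < a" "a < real l + 1"
  shows "(a gchoose (l + 2)) < 0"
proof -
  have "(\<Prod>i = 0..<l + 2. a - real i) = (\<Prod>i = 0..<l + 1. a - real i) * (a - real (l + 1))" by simp
  also have "\<dots> < 0"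
  proof (rule mult_pos_neg)
    show "(\<Prod>i = 0..<l + 1. a - real i) > 0" by (rule prod_pos) (use assms in auto)
  qed (use assms in auto)
  finally show ?thesis unfolding gbinomial_prod_rev by (simp add: divide_less_0_iff)
qed

text \<open>The first variation of \<open>\<integral>\<bar>1 + r e(x) + \<delta> e(m x)\<bar>^p\<close> at \<open>\<delta> = 0\<close> has leading term
  \<open>r^m\<close> times a binomial coefficient of \<open>p / 2\<close>, which is negative for \<open>m = l + 2\<close>.\<close>

lemma first_variation_negative:
  fixes \<alpha> :: real
  assumes \<beta>: "(\<alpha> gchoose m) < 0"
  obtains r where "0 < r" "r \<le> 1/4"
    "integral {0..1} (\<lambda>x. norm (1 + of_real r * circ x) powr (2 * \<alpha> - 2)
       * Re (cnj (1 + of_real r * circ x) * circ x ^ m)) < 0"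
proof -
  define A where "A w = (1 + w) powr complex_of_real (\<alpha> - 1)" for w
  define K where "K w = (1 + w) powr complex_of_real \<alpha>" for w
  define Am where "Am w = (\<Sum>n\<le>m. complex_of_real ((\<alpha> - 1) gchoose n) * w ^ n)" for w
  define Km where "Km w = (\<Sum>n\<le>m. complex_of_real (\<alpha> gchoose n) * w ^ n)" for w
  obtain CA where CA: "CA \<ge> 0" "\<And>w. norm w \<le> 1/2 \<Longrightarrow> norm (A w - Am w) \<le> CA * norm w ^ Suc m"
    using binomial_taylor_remainder[of "\<alpha> - 1" m] unfolding A_def Am_def by blast
  obtain CK where CK: "CK \<ge> 0" "\<And>w. norm w \<le> 1/2 \<Longrightarrow> norm (K w - Km w) \<le> CK * norm w ^ Suc m"
    using binomial_taylor_remainder[of \<alpha> m] unfolding K_def Km_def by blast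
  have "bounded (Km ` cball 0 (1/2))" unfolding Km_def
    by (intro compact_imp_bounded compact_continuous_image continuous_intros) auto
  then obtain BK where BK: "BK > 0" "\<And>w. norm w \<le> 1/2 \<Longrightarrow> norm (Km w) \<le> BK" unfolding bounded_pos by auto
  have "bounded (Am ` cball 0 (1/2))" unfolding Am_def
    by (intro compact_imp_bounded compact_continuous_image continuous_intros) auto
  then obtain BA where BA: "BA > 0" "\<And>w. norm w \<le> 1/2 \<Longrightarrow> norm (Am w) \<le> BA" unfolding bounded_pos by auto
  define C where "C = (BA + CA) * CK + CA * BK"
  have C0: "0 \<le> C" using CA CK BA BK by (simp add: C_def)
  \<comment> \<open>Small enough for the leading term of order \<open>r ^ m\<close> to outweigh the
    Taylor error \<open>C * r ^ Suc m\<close>.\<close>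
  define r where "r = min (1/4) (- (\<alpha> gchoose m) / (2 * (C + 1)))"
  have r: "0 < r" "r \<le> 1/4" 
  proof -
    have "0 < - (\<alpha> gchoose m) / (2 * (C + 1))" using \<beta> C0 by (intro divide_pos_pos) auto
    then show "0 < r" unfolding r_def by (simp only: min_less_iff_conj) simp
    show "r \<le> 1/4" unfolding r_def by (rule min.cobounded1)
  qed
  have "r * (C + 1) \<le> - (\<alpha> gchoose m) / (2 * (C + 1)) * (C + 1)" using C0 unfolding r_def by (intro mult_right_mono min.cobounded2) auto
  also have "\<dots> = - (\<alpha> gchoose m) / 2" using C0 by (simp add: field_simps)
  finally have rC: "C * r < - (\<alpha> gchoose m)" using r \<beta> by (simp add: algebra_simps)
  have wle: "norm (of_real r * circ x) \<le> 1/2" "norm (of_real r * circ x) = r" for x using r by (auto simp: norm_mult)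
  have ne: "1 + of_real r * circ x \<noteq> 0" for x
  proof
    assume "1 + of_real r * circ x = 0"
    then have "norm (of_real r * circ x) = norm (-1::complex)" by (metis add.commute add_eq_0_iff)
    then show False using r by (simp add: norm_mult)
  qed
  \<comment> \<open>The factorisation of the modulus power times \<open>cnj z\<close> as
    \<open>z powr (\<alpha> - 1)\<close> times the conjugate of \<open>z powr \<alpha>\<close> turns
    the integrand into products of power series, to which orthogonality applies.\<close>
  have AK: "norm (1 + of_real r * circ x) powr (2 * \<alpha> - 2) * (cnj (1 + of_real r * circ x) * circ x ^ m)
      = A (of_real r * circ x) * cnj (K (of_real r * circ x)) * circ x ^ m" for x
  proof -
    define z where "z = 1 + of_real r * circ x"
    have z: "z \<noteq> 0" using ne by (simp add: z_def)
    have "z powr complex_of_real \<alpha> = z powr complex_of_real (\<alpha> - 1) * z powr 1"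
      by (subst powr_add[symmetric]) simp
    then have Kz: "z powr complex_of_real \<alpha> = z powr complex_of_real (\<alpha> - 1) * z" using z by simp
    have "z powr complex_of_real (\<alpha> - 1) * cnj (z powr complex_of_real (\<alpha> - 1)) = of_real ((norm z powr (\<alpha> - 1)) ^ 2)"
      unfolding complex_norm_square[symmetric] norm_powr_of_real[OF z] ..
    also have "(norm z powr (\<alpha> - 1)) ^ 2 = norm z powr (2 * \<alpha> - 2)"
      using z by (simp add: powr_power field_simps)
    finally have "complex_of_real (norm z powr (2 * \<alpha> - 2)) * cnj z = z powr complex_of_real (\<alpha> - 1) * cnj (z powr complex_of_real \<alpha>)"
      unfolding Kz by (simp add: mult_ac)
    then show ?thesis unfolding A_def K_def z_def[symmetric] by (simp add: mult_ac)
  qed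
  define \<Phi> where "\<Phi> x = A (of_real r * circ x) * cnj (K (of_real r * circ x)) * circ x ^ m" for x
  define \<Psi> where "\<Psi> x = Am (of_real r * circ x) * cnj (Km (of_real r * circ x)) * circ x ^ m" for x
  have close: "norm (\<Phi> x - \<Psi> x) \<le> C * r ^ Suc m" for x
  proof -
    define w where "w = of_real r * circ x"
    have w: "norm w \<le> 1/2" "norm w = r" using wle by (auto simp: w_def)
    have "A w * cnj (K w) - Am w * cnj (Km w) = A w * cnj (K w - Km w) + (A w - Am w) * cnj (Km w)"
      by (simp add: algebra_simps)
    then have "norm (A w * cnj (K w) - Am w * cnj (Km w)) \<le> norm (A w) * norm (K w - Km w) + norm (A w - Am w) * norm (Km w)"
      by (metis norm_triangle_ineq norm_mult complex_mod_cnj)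
    also have "\<dots> \<le> (BA + CA) * (CK * r ^ Suc m) + (CA * r ^ Suc m) * BK"
    proof (intro add_mono mult_mono)
      have "norm (A w) \<le> norm (Am w) + norm (A w - Am w)" by norm
      also have "norm (A w - Am w) \<le> CA * 1"
      proof -
        have "CA * r ^ Suc m \<le> CA * 1" using r CA(1) by (intro mult_left_mono power_le_one) auto
        then show ?thesis using CA(2)[OF w(1)] unfolding w(2) by linarith
      qed
      finally show "norm (A w) \<le> BA + CA" using BA(2)[OF w(1)] by simp
      show "norm (K w - Km w) \<le> CK * r ^ Suc m" using CK(2)[OF w(1)] w(2) by simp
      show "norm (A w - Am w) \<le> CA * r ^ Suc m" using CA(2)[OF w(1)] w(2) by simp
      show "norm (Km w) \<le> BK" using BK(2)[OF w(1)] .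
    qed (use BA CA r in auto)
    finally have "norm (A w * cnj (K w) - Am w * cnj (Km w)) \<le> C * r ^ Suc m" by (simp add: C_def algebra_simps)
    moreover have "\<Phi> x - \<Psi> x = (A w * cnj (K w) - Am w * cnj (Km w)) * circ x ^ m"
      by (simp add: \<Phi>_def \<Psi>_def w_def algebra_simps)
    ultimately show ?thesis by (simp add: norm_mult norm_power)
  qed
  have \<Psi>eq: "\<Psi> x = (\<Sum>j\<le>m. \<Sum>n\<le>m. of_real (((\<alpha> - 1) gchoose j) * (\<alpha> gchoose n) * r ^ (j + n)) * (circ x ^ (j + m) * cnj (circ x ^ n)))" for x
    unfolding \<Psi>_def Am_def Km_def
    by (simp add: sum_distrib_left sum_distrib_right power_mult_distrib power_add mult_ac)
  \<comment> \<open>Orthogonality leaves the terms with \<open>j + m = n\<close>. As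
    \<open>n \<le> m\<close>, only \<open>j = 0\<close> and \<open>n = m\<close> survive.\<close>
  have "(\<Psi> has_integral (\<Sum>j\<le>m. \<Sum>n\<le>m. of_real (((\<alpha> - 1) gchoose j) * (\<alpha> gchoose n) * r ^ (j + n)) * (if j + m = n then 1 else 0))) {0..1}"
    unfolding \<Psi>eq by (intro has_integral_sum has_integral_mult_right circ_orthogonality) auto
  also have "(\<Sum>j\<le>m. \<Sum>n\<le>m. of_real (((\<alpha> - 1) gchoose j) * (\<alpha> gchoose n) * r ^ (j + n)) * (if j + m = n then 1 else 0))
      = (\<Sum>j\<le>m. if j = 0 then complex_of_real ((\<alpha> gchoose m) * r ^ m) else 0)"
  proof (rule sum.cong[OF refl])
    fix j assume "j \<in> {..m}"
    have "(\<Sum>n\<le>m. complex_of_real (((\<alpha> - 1) gchoose j) * (\<alpha> gchoose n) * r ^ (j + n)) * (if j + m = n then 1 else 0))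
      = (\<Sum>n\<le>m. if n = j + m then complex_of_real (((\<alpha> - 1) gchoose j) * (\<alpha> gchoose n) * r ^ (j + n)) else 0)"
      by (intro sum.cong) auto
    also have "\<dots> = (if j = 0 then complex_of_real ((\<alpha> gchoose m) * r ^ m) else 0)"
      by (subst sum.delta) auto
    finally show "(\<Sum>n\<le>m. complex_of_real (((\<alpha> - 1) gchoose j) * (\<alpha> gchoose n) * r ^ (j + n)) * (if j + m = n then 1 else 0))
      = (if j = 0 then complex_of_real ((\<alpha> gchoose m) * r ^ m) else 0)" .
  qed
  also have "\<dots> = of_real ((\<alpha> gchoose m) * r ^ m)" by simp
  finally have \<Psi>int: "(\<Psi> has_integral of_real ((\<alpha> gchoose m) * r ^ m)) {0..1}" .
  define D where "D x = norm (1 + of_real r * circ x) powr (2 * \<alpha> - 2) * Re (cnj (1 + of_real r * circ x) * circ x ^ m)" for x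
  have D: "D x = Re (\<Phi> x)" for x unfolding D_def \<Phi>_def AK[symmetric] by simp
  have Dc: "continuous_on {0..1} D" unfolding D_def using ne by (intro continuous_intros) auto
  have R\<Psi>: "((\<lambda>x. Re (\<Psi> x)) has_integral ((\<alpha> gchoose m) * r ^ m)) {0..1}"
    using has_integral_linear[OF \<Psi>int bounded_linear_Re] by (simp add: o_def)
  have "((\<lambda>x. Re (\<Psi> x) + C * r ^ Suc m) has_integral ((\<alpha> gchoose m) * r ^ m + C * r ^ Suc m)) {0..1}"
    using has_integral_const_real[of "C * r ^ Suc m" 0 1] by (intro has_integral_add R\<Psi>) simp
  moreover have "D x \<le> Re (\<Psi> x) + C * r ^ Suc m" for x
    using complex_Re_le_cmod[of "\<Phi> x - \<Psi> x"] close[of x] unfolding D by simp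
  ultimately have "integral {0..1} D \<le> (\<alpha> gchoose m) * r ^ m + C * r ^ Suc m"
    using has_integral_le[OF integrable_integral[OF integrable_continuous_interval[OF Dc]]] by blast
  also have "\<dots> = r ^ m * ((\<alpha> gchoose m) + C * r)" by (simp add: algebra_simps)
  also have "\<dots> < 0" using rC r by (intro mult_pos_neg) auto
  finally have "integral {0..1} D < 0" .
  then show ?thesis unfolding D_def by (rule that[OF r])
qed

lemma lpn_continuous_exponent:
  assumes F: "continuous_on {0..1} F" and p: "0 < p"
  shows "((\<lambda>q. lpn q F) \<longlongrightarrow> lpn p F) (at_left p)"
proof -
  have "continuous_on ({p/2..p} \<times> cbox 0 1) (\<lambda>(q, x). norm (F x) powr q)"
    unfolding case_prod_unfold using p
    by (intro continuous_on_powr' continuous_intros continuous_on_compose2[OF F]) auto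
  then have "continuous_on {p/2..p} (\<lambda>q. integral (cbox 0 1) (\<lambda>x. norm (F x) powr q))"
    by (rule integral_continuous_on_param)
  then have c: "continuous_on {p/2..p} (\<lambda>q. integral {0..1} (\<lambda>x. norm (F x) powr q))" by simp
  have "continuous_on {p/2..p} (\<lambda>q. lpn q F)"
    unfolding lpn_def
  proof (intro continuous_on_powr' c continuous_intros ballI conjI impI)
    fix q assume q: "q \<in> {p/2..p}"
    then show "0 \<le> integral {0..1} (\<lambda>x. norm (F x) powr q)" using p
      by (intro integral_nonneg integrable_continuous_interval continuous_on_norm_powr F) auto
  qed (use p in auto)
  then have "((\<lambda>q. lpn q F) \<longlongrightarrow> lpn p F) (at p within {p/2..p})"
    using p by (auto simp: continuous_on_def)
  then show ?thesis using p by (simp add: at_within_Icc_at_left)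
qed


lemma nnpoly2_trinomial:
  assumes "0 \<le> r" "0 \<le> d"
  shows "nnpoly2 (\<lambda>w u. 1 + of_real r * w + of_real d * (u * w ^ m))"
  using nnpoly2.const[of 1] assms
  by (intro nnpoly2.add nnpoly2.mult nnpoly2_power nnpoly2.const nnpoly2.fst nnpoly2.snd) auto

text \<open>The \<open>p\<close>-th power integral of \<open>1 + r w + d w^m\<close> has negative
  derivative at \<open>d = 0\<close>. Hence a small positive \<open>d\<close> decreases it and a
  small negative \<open>d\<close> increases it, although the coefficients have the same
  moduli.\<close>

lemma majorant_failure_not_even:
  assumes p: "2 < p" "2 * real l < p" "p < 2 * (real l + 1)"
  obtains P where "nnpoly2 P" "lpn p (\<lambda>x. P (circ x) 1) < lpn p (\<lambda>x. P (circ x) (-1))"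
    "norm (P (circ 0) (-1)) \<noteq> norm (P (circ (1/2)) (-1))"
proof -
  define \<alpha> where "\<alpha> = p / 2"
  define m where "m = l + 2"
  have "(\<alpha> gchoose m) < 0" unfolding m_def using p by (intro gbinomial_negative) (auto simp: \<alpha>_def)
  from first_variation_negative[OF this] obtain r where r: "0 < r" "r \<le> 1/4"
    and neg: "integral {0..1} (\<lambda>x. norm (1 + of_real r * circ x) powr (2 * \<alpha> - 2)
       * Re (cnj (1 + of_real r * circ x) * circ x ^ m)) < 0" by blast
  define z where "z d x = 1 + of_real r * circ x + of_real d * circ x ^ m" for d x
  have zc: "continuous_on S (\<lambda>y. z (f y) (g y))" if "continuous_on S f" "continuous_on S g"
    for S and f g :: "'b::topological_space \<Rightarrow> real"
    unfolding z_def using that by (intro continuous_intros)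
  have zne: "z d x \<noteq> 0" if "d \<in> {-1/4..1/4}" for d x
  proof
    assume "z d x = 0"
    then have "1 = - (of_real r * circ x + of_real d * circ x ^ m)" by (simp add: z_def add_eq_0_iff2 add.assoc)
    then have "(1::real) = norm (of_real r * circ x + of_real d * circ x ^ m)" by (metis norm_minus_cancel norm_one)
    also have "\<dots> \<le> norm (of_real r * circ x) + norm (of_real d * circ x ^ m)" by (rule norm_triangle_ineq)
    also have "\<dots> = r + \<bar>d\<bar>" using r by (simp add: norm_mult norm_power)
    finally show False using that r by auto
  qed
  \<comment> \<open>The squared modulus is a real polynomial in \<open>d\<close>, and it is positive
    since \<open>r\<close> and the modulus of \<open>d\<close> are at most 1/4; its power \<alpha>
    is then differentiable under the integral.\<close>
  define Q where "Q d x = (Re (z d x)) ^ 2 + (Im (z d x)) ^ 2" for d x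
  have Q: "Q d x = norm (z d x) ^ 2" for d x by (simp add: Q_def cmod_power2)
  have Qpos: "0 < Q d x" if "d \<in> {-1/4..1/4}" for d x using zne[OF that] by (simp add: Q)
  define dQ where "dQ d x = \<alpha> * Q d x powr (\<alpha> - 1) * (2 * Re (z d x) * Re (circ x ^ m) + 2 * Im (z d x) * Im (circ x ^ m))" for d x
  define \<phi> where "\<phi> d = integral {0..1} (\<lambda>x. Q d x powr \<alpha>)" for d
  have \<alpha>: "\<alpha> > 0" using p by (simp add: \<alpha>_def)
  have "((\<lambda>d. integral (cbox 0 1) (\<lambda>x. Q d x powr \<alpha>)) has_field_derivative integral (cbox 0 1) (dQ 0)) (at 0 within {-1/4..1/4})"
  proof (rule leibniz_rule_field_derivative)
    fix d x :: real assume d: "d \<in> {-1/4..1/4}"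
    have Rez: "Re (z d x) = Re (1 + of_real r * circ x) + d * Re (circ x ^ m)" and
         Imz: "Im (z d x) = Im (1 + of_real r * circ x) + d * Im (circ x ^ m)" for d
      unfolding z_def by simp_all
    have "((\<lambda>d. Q d x) has_field_derivative (2 * Re (z d x) * Re (circ x ^ m) + 2 * Im (z d x) * Im (circ x ^ m))) (at d within {-1/4..1/4})"
      unfolding Q_def Rez Imz by (auto intro!: derivative_eq_intros simp: algebra_simps)
    from DERIV_chain'[OF this has_real_derivative_powr[OF Qpos[OF d]]]
    show "((\<lambda>d. Q d x powr \<alpha>) has_field_derivative dQ d x) (at d within {-1/4..1/4})"
      by (simp add: dQ_def mult_ac)
  next
    fix d :: real assume "d \<in> {-1/4..1/4}"
    have "continuous_on {0..1} (\<lambda>x. Q d x powr \<alpha>)" unfolding Q_def using \<alpha>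
      by (intro continuous_on_powr' continuous_intros zc) auto
    then show "(\<lambda>x. Q d x powr \<alpha>) integrable_on cbox 0 1" by (simp add: integrable_continuous_interval)
  next
    show "continuous_on ({-1/4..1/4} \<times> cbox 0 1) (\<lambda>(d, x). dQ d x)"
      unfolding dQ_def case_prod_unfold Q_def
    proof (intro continuous_intros zc)
      show "\<forall>y\<in>{-1/4..1/4} \<times> cbox 0 1. (Re (z (fst y) (snd y)))\<^sup>2 + (Im (z (fst y) (snd y)))\<^sup>2 \<noteq> 0"
      proof
        fix y :: "real \<times> real" assume "y \<in> {-1/4..1/4} \<times> cbox 0 1"
        then have "0 < Q (fst y) (snd y)" by (intro Qpos) auto
        then show "(Re (z (fst y) (snd y)))\<^sup>2 + (Im (z (fst y) (snd y)))\<^sup>2 \<noteq> 0"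
          unfolding Q_def by (metis less_irrefl)
      qed
    qed
  qed auto
  then have "(\<phi> has_field_derivative integral {0..1} (dQ 0)) (at 0)"
    using at_within_interior[of 0 "{-1/4..1/4::real}"] by (simp add: \<phi>_def[abs_def])
  moreover have "integral {0..1} (dQ 0) < 0"
  proof -
    have "dQ 0 x = p * (norm (1 + of_real r * circ x) powr (2 * \<alpha> - 2) * Re (cnj (1 + of_real r * circ x) * circ x ^ m))" for x
    proof -
      have "norm (z 0 x) > 0" using zne[of 0 x] by simp
      then have "Q 0 x powr (\<alpha> - 1) = norm (z 0 x) powr (2 * \<alpha> - 2)"
        unfolding Q by (simp add: powr_powr powr_numeral[symmetric] algebra_simps del: powr_numeral)
      moreover have "2 * Re (z 0 x) * Re (circ x ^ m) + 2 * Im (z 0 x) * Im (circ x ^ m) = 2 * Re (cnj (z 0 x) * circ x ^ m)"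
        by (simp add: algebra_simps)
      ultimately show ?thesis unfolding dQ_def by (simp add: \<alpha>_def z_def)
    qed
    then have "dQ 0 = (\<lambda>x. p * (norm (1 + of_real r * circ x) powr (2 * \<alpha> - 2) * Re (cnj (1 + of_real r * circ x) * circ x ^ m)))" ..
    then have "integral {0..1} (dQ 0) = p * integral {0..1} (\<lambda>x. norm (1 + of_real r * circ x) powr (2 * \<alpha> - 2)
       * Re (cnj (1 + of_real r * circ x) * circ x ^ m))" by (simp only: integral_mult_right)
    then show ?thesis using neg p by (simp add: mult_less_0_iff)
  qed
  ultimately obtain d1 d2 where d1: "d1 > 0" "\<And>h. h > 0 \<Longrightarrow> h < d1 \<Longrightarrow> \<phi> 0 > \<phi> (0 + h)"
    and d2: "d2 > 0" "\<And>h. h > 0 \<Longrightarrow> h < d2 \<Longrightarrow> \<phi> 0 < \<phi> (0 - h)"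
    using DERIV_neg_dec_right[of \<phi> _ 0] DERIV_neg_dec_left[of \<phi> _ 0] by metis
  \<comment> \<open>The bound \<open>d < r\<close> separates the moduli at \<open>x = 0\<close> and
    \<open>x = 1/2\<close> for \<open>u = -1\<close>: the first is \<open>1 + r - d\<close>, the
    second at most \<open>1 - r + d\<close>.\<close>
  define d where "d = min (r / 2) (min (d1 / 2) (d2 / 2))"
  have d: "0 < d" "d < r" "d < d1" "d < d2" using r d1(1) d2(1) by (auto simp: d_def)
  have lt: "\<phi> d < \<phi> (- d)" using d1(2)[of d] d2(2)[of d] d by simp
  define P where "P w u = 1 + of_real r * w + of_real d * (u * w ^ m)" for w u :: complex
  have PQ: "norm (P (circ x) (of_real e)) powr p = Q (d * e) x powr \<alpha>" for x e
  proof -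
    have "P (circ x) (of_real e) = z (d * e) x" by (simp add: P_def z_def)
    then show ?thesis unfolding Q by (cases "z (d * e) x = 0") (simp_all add: \<alpha>_def powr_powr powr_numeral[symmetric] del: powr_numeral)
  qed
  have l: "lpn p (\<lambda>x. P (circ x) (of_real e)) = \<phi> (d * e) powr (1 / p)" for e
    unfolding lpn_def PQ \<phi>_def ..
  have "0 \<le> \<phi> d" unfolding \<phi>_def Q_def using \<alpha>
    by (intro integral_nonneg integrable_continuous_interval continuous_on_powr' continuous_intros zc) auto
  then have "\<phi> d powr (1 / p) < \<phi> (- d) powr (1 / p)" using lt p by (intro powr_less_mono2) auto
  then have key: "lpn p (\<lambda>x. P (circ x) 1) < lpn p (\<lambda>x. P (circ x) (-1))" using l[of 1] l[of "-1"] by simp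
  have c0: "circ 0 = 1" "circ (1/2) = -1" by (simp_all add: circ_def)
  have "norm (P (circ 0) (-1)) = norm (complex_of_real (1 + r - d))" by (simp add: P_def c0)
  then have n0: "norm (P (circ 0) (-1)) = 1 + r - d" unfolding norm_of_real using d by simp
  have "P (circ (1/2)) (-1) = of_real (1 - r) + of_real d * (- ((-1) ^ m))" by (simp add: P_def c0)
  then have "norm (P (circ (1/2)) (-1)) \<le> norm (complex_of_real (1 - r)) + norm (of_real d * (- ((-1::complex) ^ m)))"
    by (metis norm_triangle_ineq)
  also have "\<dots> = 1 - r + d" unfolding norm_of_real norm_mult using d r by (simp add: norm_power)
  finally have "norm (P (circ (1/2)) (-1)) < norm (P (circ 0) (-1))" unfolding n0 using d by linarith
  then show ?thesis using key nnpoly2_trinomial[of r d m] r d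
    by (intro that[of P]) (auto simp: P_def[abs_def])
qed

text \<open>At \<open>q = p\<close> the gap is just the failure of the majorant property multiplied
  by a positive norm. It is an open condition, and the norm depends continuously on the exponent, so
  it persists for some \<open>q\<close> below \<open>p\<close>.\<close>

lemma majorant_gap_not_even:
  assumes p: "2 < p" "2 * real l < p" "p < 2 * (real l + 1)"
  obtains P q where "nnpoly2 P" "2 * real l < q" "q < p"
    "lpn p (\<lambda>x. P (circ x) 1) * lpn p (\<lambda>x. P (circ x) (-1)) < lpn q (\<lambda>x. P (circ x) (-1)) ^ 2"
    "lpn (2 * real l) (\<lambda>x. P (circ x) (-1)) < lpn q (\<lambda>x. P (circ x) (-1))"
proof -
  obtain P where P: "nnpoly2 P" "lpn p (\<lambda>x. P (circ x) 1) < lpn p (\<lambda>x. P (circ x) (-1))"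
    "norm (P (circ 0) (-1)) \<noteq> norm (P (circ (1/2)) (-1))"
    by (rule majorant_failure_not_even[OF p])
  define F where "F = (\<lambda>x. P (circ x) (-1))"
  have Fc: "continuous_on {0..1} F" unfolding F_def by (intro continuous_on_nnpoly2[OF P(1)] continuous_intros)
  have l1: "0 < real l" using p by (cases l) auto
  have "((\<lambda>q. lpn q F ^ 2) \<longlongrightarrow> lpn p F ^ 2) (at_left p)"
    by (intro tendsto_power lpn_continuous_exponent[OF Fc]) (use p in auto)
  moreover have "lpn p (\<lambda>x. P (circ x) 1) * lpn p F < lpn p F ^ 2"
    using P(2) lpn_nonneg[of p "\<lambda>x. P (circ x) 1"] unfolding power2_eq_square F_def by (intro mult_strict_right_mono) auto
  ultimately have "\<forall>\<^sub>F q in at_left p. lpn p (\<lambda>x. P (circ x) 1) * lpn p F < lpn q F ^ 2" by (rule order_tendstoD(1))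
  moreover have "\<forall>\<^sub>F q in at_left p. q \<in> {2 * real l<..<p}" using p by (intro eventually_at_left_real) auto
  ultimately have "\<forall>\<^sub>F q in at_left p. lpn p (\<lambda>x. P (circ x) 1) * lpn p F < lpn q F ^ 2 \<and> q \<in> {2 * real l<..<p}"
    by (rule eventually_conj)
  then obtain q where q: "lpn p (\<lambda>x. P (circ x) 1) * lpn p F < lpn q F ^ 2" "2 * real l < q" "q < p"
    using eventually_happens'[OF trivial_limit_at_left_real] by fastforce
  have "lpn (2 * real l) F < lpn q F"
    by (rule lpn_strict_mono[OF _ q(2) Fc, of 0 "1/2"]) (use P(3) l1 in \<open>auto simp: F_def\<close>)
  then show ?thesis using q P(1) by (intro that[of P q]) (auto simp: F_def)
qed

subsection \<open>Majorant gap for exponents below two\<close>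

text \<open>At \<open>u = -1\<close> these are the Rudin-Shapiro polynomials, at \<open>u = 1\<close> both are Dirichlet kernels.\<close>

primrec rudin_shapiro :: "nat \<Rightarrow> complex \<Rightarrow> complex \<Rightarrow> complex \<times> complex" where
  "rudin_shapiro 0 w u = (1, 1)"
| "rudin_shapiro (Suc k) w u =
    (fst (rudin_shapiro k w u) + w ^ 2 ^ k * snd (rudin_shapiro k w u),
     fst (rudin_shapiro k w u) + u * (w ^ 2 ^ k * snd (rudin_shapiro k w u)))"

lemma nnpoly2_rudin_shapiro:
  "nnpoly2 (\<lambda>w u. fst (rudin_shapiro k w u))" "nnpoly2 (\<lambda>w u. snd (rudin_shapiro k w u))"
proof (induction k)
  case 0
  show "nnpoly2 (\<lambda>w u. fst (rudin_shapiro 0 w u))" "nnpoly2 (\<lambda>w u. snd (rudin_shapiro 0 w u))"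
    using nnpoly2.const[of 1] by simp_all
next
  case (Suc k)
  show "nnpoly2 (\<lambda>w u. fst (rudin_shapiro (Suc k) w u))" "nnpoly2 (\<lambda>w u. snd (rudin_shapiro (Suc k) w u))"
    by (simp_all, (intro nnpoly2.add nnpoly2.mult nnpoly2_power nnpoly2.fst nnpoly2.snd Suc)+)
qed

lemma rudin_shapiro_one:
  "rudin_shapiro k w 1 = ((\<Sum>n<2 ^ k. w ^ n), (\<Sum>n<2 ^ k. w ^ n))"
proof (induction k)
  case (Suc k)
  have "(\<Sum>n<2 ^ k + 2 ^ k. w ^ n) = (\<Sum>n<2 ^ k. w ^ n) + (\<Sum>n=2 ^ k..<2 ^ k + 2 ^ k. w ^ n)"
    by (simp add: lessThan_atLeast0 sum.atLeastLessThan_concat)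
  also have "(\<Sum>n=2 ^ k..<2 ^ k + 2 ^ k. w ^ n) = w ^ 2 ^ k * (\<Sum>n<2 ^ k. w ^ n)"
    using sum.shift_bounds_nat_ivl[of "\<lambda>n. w ^ n" 0 "2 ^ k" "2 ^ k"]
    by (simp add: lessThan_atLeast0 sum_distrib_left power_add mult.commute)
  finally have "(\<Sum>n<2 ^ Suc k. w ^ n) = (\<Sum>n<2 ^ k. w ^ n) + w ^ 2 ^ k * (\<Sum>n<2 ^ k. w ^ n)"
    by (simp add: mult_2)
  then show ?case using Suc by (simp del: power_Suc)
qed simp

lemma rudin_shapiro_parallelogram:
  assumes "norm w = 1"
  shows "norm (fst (rudin_shapiro k w (-1))) ^ 2 + norm (snd (rudin_shapiro k w (-1))) ^ 2 = 2 ^ Suc k"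
proof (induction k)
  case (Suc k)
  define a where "a = fst (rudin_shapiro k w (-1))"
  define b where "b = w ^ 2 ^ k * snd (rudin_shapiro k w (-1))"
  have nb: "norm b = norm (snd (rudin_shapiro k w (-1)))" using assms by (simp add: b_def norm_mult norm_power)
  have "norm (a + b) ^ 2 + norm (a - b) ^ 2 = 2 * (norm a ^ 2 + norm b ^ 2)"
    unfolding cmod_power2 by (simp add: power2_eq_square algebra_simps)
  then show ?case using Suc unfolding nb by (simp add: a_def[symmetric] b_def[symmetric])
qed simp

text \<open>At odd index each of the two polynomials has a zero at \<open>w = 1\<close> or
  \<open>w = -1\<close>. A nonzero polynomial with such a zero has nonconstant modulus on the
  circle, as strict monotonicity of \<open>lpn\<close> requires.\<close>

lemma rudin_shapiro_zeros:
  "snd (rudin_shapiro (2 * i + 1) 1 (-1)) = 0" "fst (rudin_shapiro (2 * i + 1) (-1) (-1)) = 0"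
proof (induction i)
  case (Suc i)
  have e: "even ((2::nat) ^ (2 * i + 1))" "even ((2::nat) ^ Suc (2 * i + 1))" by simp_all
  have s: "2 * Suc i + 1 = Suc (Suc (2 * i + 1))" by simp
  show "snd (rudin_shapiro (2 * Suc i + 1) 1 (-1)) = 0" "fst (rudin_shapiro (2 * Suc i + 1) (-1) (-1)) = 0"
    unfolding s rudin_shapiro.simps(2) using Suc e by (simp_all only: fst_conv snd_conv) (simp_all del: rudin_shapiro.simps(2))
qed simp_all

section \<open>Norms of Dirichlet kernels\<close>

lemma sin_ge_half:
  fixes y :: real
  assumes "0 \<le> y" "y \<le> pi / 2"
  shows "y / 2 \<le> sin y"
\<comment> \<open>Below \<open>pi / 3\<close> the slope of the sine is at least 1/2; above, the sine
  is at least \<open>sqrt 3 / 2\<close>, more than \<open>pi / 4\<close>, the largest value of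
  \<open>y / 2\<close>.\<close>
proof (cases "y \<le> pi / 3")
  case True
  show ?thesis
  proof (cases "y = 0")
    case False
    then have "0 < y" using assms by simp
    then obtain x where x: "0 < x" "x < y" "sin y - sin 0 = (y - 0) * cos x"
      using MVT2[of 0 y sin cos] by (auto intro: DERIV_sin)
    have "cos (pi / 3) \<le> cos x" using x True by (intro cos_monotone_0_pi_le) auto
    then have "y * (1 / 2) \<le> y * cos x" using \<open>0 < y\<close> by (intro mult_left_mono) (auto simp: cos_60)
    then show ?thesis using x by simp
  qed simp
next
  case False
  have "sin (pi / 3) \<le> sin y" using False assms by (intro sin_monotone_2pi_le) auto
  moreover have "(17/10::real) \<le> sqrt 3" by (rule real_le_rsqrt) (simp add: power2_eq_square)
  ultimately have "17/20 \<le> sin y" by (simp add: sin_60)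
  moreover have "pi < 34/10" using pi_approx by simp
  ultimately show ?thesis using assms by linarith
qed

lemma norm_one_minus_circ_ge:
  assumes "0 \<le> x" "x \<le> 1"
  shows "norm (1 - circ x) \<ge> min x (1 - x)"
proof -
  have "norm (1 - circ x) ^ 2 = (1 - cos (2 * (pi * x))) ^ 2 + (sin (2 * (pi * x))) ^ 2"
    by (simp add: cmod_power2 circ_def mult_ac)
  also have "\<dots> = 1 - 2 * cos (2 * (pi * x)) + ((cos (2 * (pi * x))) ^ 2 + (sin (2 * (pi * x))) ^ 2)"
    by (simp only: power2_diff) (simp add: algebra_simps)
  also have "\<dots> = 2 - 2 * cos (2 * (pi * x))" by simp
  also have "\<dots> = (2 * sin (pi * x)) ^ 2" by (simp only: cos_double_sin) (simp add: power_mult_distrib)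
  finally have eq: "norm (1 - circ x) = 2 * sin (pi * x)"
    by (rule power2_eq_imp_eq) (use assms in \<open>auto intro!: sin_ge_zero simp: mult_left_le\<close>)
  have pi1: "pi > 1" using pi_gt3 by simp
  show ?thesis
  proof (cases "x \<le> 1/2")
    case True
    have "pi * x / 2 \<le> sin (pi * x)" using True assms by (intro sin_ge_half) auto
    moreover have "1 * x \<le> pi * x" using pi1 assms by (intro mult_right_mono) auto
    ultimately show ?thesis unfolding eq by linarith
  next
    case False
    have "pi * (1 - x) / 2 \<le> sin (pi * (1 - x))" using False assms by (intro sin_ge_half) auto
    also have "sin (pi * (1 - x)) = sin (pi * x)" using sin_pi_minus[of "pi * x"] by (simp add: algebra_simps)
    finally have "pi * (1 - x) \<le> 2 * sin (pi * x)" by simp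
    moreover have "1 * (1 - x) \<le> pi * (1 - x)" using pi1 assms by (intro mult_right_mono) auto
    ultimately have "1 - x \<le> 2 * sin (pi * x)" by (metis mult_1 order_trans)
    then show ?thesis unfolding eq by (rule min.coboundedI2)
  qed
qed

text \<open>Geometric interpolation, with weights \<theta> and \<open>1 - \<theta>\<close>, between
  the trivial bound \<open>N\<close> and the bound of the geometric sum by twice the reciprocal
  distance to the integers.\<close>

lemma dirichlet_norm_bound:
  assumes "0 < x" "x < 1" "0 \<le> \<theta>" "\<theta> \<le> 1" "0 < N"
  shows "norm (\<Sum>n<N. circ x ^ n) \<le> real N powr \<theta> * (2 / min x (1 - x)) powr (1 - \<theta>)"
proof -
  define D where "D = norm (\<Sum>n<N. circ x ^ n)"
  have m: "0 < min x (1 - x)" using assms by simp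
  have ge: "min x (1 - x) \<le> norm (1 - circ x)" using norm_one_minus_circ_ge assms by simp
  have "D \<le> (\<Sum>n<N. 1)" unfolding D_def by (rule sum_norm_le) (simp add: norm_power)
  then have D1: "D \<le> real N" by simp
  have "D * norm (1 - circ x) = norm (1 - circ x ^ N)"
    unfolding D_def norm_mult[symmetric] using one_diff_power_eq[of "circ x" N] by (simp add: mult.commute)
  also have "\<dots> \<le> 2" using norm_triangle_ineq4[of 1 "circ x ^ N"] by (simp add: norm_power)
  finally have "D * norm (1 - circ x) \<le> 2" .
  moreover have "D * min x (1 - x) \<le> D * norm (1 - circ x)" using ge by (intro mult_left_mono) (auto simp: D_def)
  ultimately have D2: "D \<le> 2 / min x (1 - x)" using m by (simp add: pos_le_divide_eq)
  have D0: "0 \<le> D" by (simp add: D_def)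
  have "D = D powr \<theta> * D powr (1 - \<theta>)" using D0 by (cases "D = 0") (simp_all flip: powr_add)
  also have "\<dots> \<le> real N powr \<theta> * (2 / min x (1 - x)) powr (1 - \<theta>)"
    using D0 D1 D2 assms by (intro mult_mono powr_mono2) auto
  finally show ?thesis by (simp add: D_def)
qed

text \<open>The condition on \<theta> makes the \<open>p\<close>-th power of the singularity in
  \<open>dirichlet_norm_bound\<close> integrable. Interpolation avoids separate treatment of
  exponents below, at and above 1.\<close>

lemma dirichlet_lp_bound:
  assumes p: "0 < p" and th: "0 \<le> \<theta>" "\<theta> \<le> 1" "(1 - \<theta>) * p < 1"
  obtains C where "C > 0" "\<And>N. 0 < N \<Longrightarrow> lpn p (\<lambda>x. \<Sum>n<N. circ x ^ n) \<le> C * real N powr \<theta>"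
proof -
  define \<mu> where "\<mu> = (1 - \<theta>) * p"
  have \<mu>: "0 \<le> \<mu>" "\<mu> < 1" using assms by (auto simp: \<mu>_def)
  have i1: "((\<lambda>x. x powr (- \<mu>)) has_integral (1 / (1 - \<mu>))) {0..1}"
    using has_integral_powr_from_0[of "- \<mu>" 1] \<mu> by (simp add: add.commute)
  have i2: "((\<lambda>x. (1 - x) powr (- \<mu>)) has_integral (1 / (1 - \<mu>))) {0..1}"
  proof -
    have "((\<lambda>x. (- x) powr (- \<mu>)) has_integral (1 / (1 - \<mu>))) {-1..-0}"
      using i1 by (subst has_integral_reflect_real)
    then have "(((\<lambda>x. (- x) powr (- \<mu>)) \<circ> (+) (-1)) has_integral (1 / (1 - \<mu>))) {0..1}"
      by (subst has_integral_shift_Icc_real) simp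
    then show ?thesis by (simp add: o_def)
  qed
  define A where "A = 2 powr \<mu> * (1 / (1 - \<mu>) + 1 / (1 - \<mu>))"
  have A: "A > 0" using \<mu> by (simp add: A_def)
  show ?thesis
  proof (rule that[of "A powr (1 / p)"])
    show "A powr (1 / p) > 0" using A by simp
    fix N :: nat assume N: "0 < N"
    define E where "E = (\<lambda>x. \<Sum>n<N. circ x ^ n)"
    have Ec: "continuous_on {0..1} E" unfolding E_def by (intro continuous_intros)
    define I where "I = integral {0..1} (\<lambda>x. norm (E x) powr p)"
    have hi: "((\<lambda>x. norm (E x) powr p) has_integral I) {0..1}" unfolding I_def
      by (intro integrable_integral integrable_continuous_interval continuous_on_norm_powr Ec p)
    \<comment> \<open>At an endpoint the majorant has lost its singularity because
      \<open>0 powr (- \<mu>) = 0\<close>; the integrand is therefore set to 0 at these two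
      points.\<close>
    then have hi': "((\<lambda>x. if x \<in> {0, 1} then 0 else norm (E x) powr p) has_integral I) {0..1}"
      by (rule has_integral_spike_finite[of "{0, 1}", rotated 2]) auto
    have hb: "((\<lambda>x. real N powr (\<theta> * p) * (2 powr \<mu> * (x powr (- \<mu>) + (1 - x) powr (- \<mu>)))) has_integral (real N powr (\<theta> * p) * A)) {0..1}"
      unfolding A_def by (intro has_integral_mult_right has_integral_add i1 i2)
    have "I \<le> real N powr (\<theta> * p) * A"
    proof (rule has_integral_le[OF hi' hb])
      fix x :: real assume x: "x \<in> {0..1}"
      show "(if x \<in> {0, 1} then 0 else norm (E x) powr p) \<le> real N powr (\<theta> * p) * (2 powr \<mu> * (x powr (- \<mu>) + (1 - x) powr (- \<mu>)))"
      proof (cases "x \<in> {0, 1}")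
        case False
        then have x': "0 < x" "x < 1" using x by auto
        have "norm (E x) powr p \<le> (real N powr \<theta> * (2 / min x (1 - x)) powr (1 - \<theta>)) powr p"
          unfolding E_def using dirichlet_norm_bound[OF x' th(1,2) N] p by (intro powr_mono2) auto
        also have "\<dots> = real N powr (\<theta> * p) * (2 / min x (1 - x)) powr \<mu>"
          by (simp add: powr_mult powr_powr \<mu>_def)
        also have "(2 / min x (1 - x)) powr \<mu> = 2 powr \<mu> * (min x (1 - x)) powr (- \<mu>)"
          using x' by (simp add: powr_divide powr_minus_divide)
        also have "(min x (1 - x)) powr (- \<mu>) \<le> x powr (- \<mu>) + (1 - x) powr (- \<mu>)" by (auto simp: min_def)
        finally show ?thesis using False by (simp add: mult_left_mono)
      qed simp
    qed
    then have "I powr (1 / p) \<le> (real N powr (\<theta> * p) * A) powr (1 / p)"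
      using has_integral_nonneg[OF hi] p by (intro powr_mono2) auto
    also have "\<dots> = A powr (1 / p) * real N powr \<theta>" using p by (simp add: powr_mult powr_powr)
    finally show "lpn p (\<lambda>x. \<Sum>n<N. circ x ^ n) \<le> A powr (1 / p) * real N powr \<theta>"
      unfolding lpn_def I_def E_def .
  qed
qed

lemma lpn_sup_bound:
  assumes a: "0 < a" and F: "continuous_on {0..1} F" and B: "\<And>x. x \<in> {0..1} \<Longrightarrow> norm (F x) \<le> B" "0 \<le> B"
  shows "lpn a F \<le> B"
proof -
  have int: "(\<lambda>x. norm (F x) powr a) integrable_on {0..1}"
    by (intro integrable_continuous_interval continuous_on_norm_powr F a)
  have "integral {0..1} (\<lambda>x. norm (F x) powr a) \<le> integral {0..1} (\<lambda>x::real. B powr a)"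
    by (rule integral_le[OF int]) (use B a in \<open>auto intro: powr_mono2\<close>)
  then have "lpn a F \<le> (B powr a) powr (1 / a)" unfolding lpn_def
    using a by (intro powr_mono2 integral_nonneg int) auto
  then show ?thesis using a B by (simp add: powr_powr)
qed

text \<open>Since \<open>q \<le> 2\<close>, flatness helps: a modulus squared of at most
  \<open>2 * N\<close> lets a power below 2 dominate a multiple of the square, and the lower bound
  in mean square carries over with the loss of a constant.\<close>

lemma lpn_lower_bound_from_square:
  assumes q: "0 < q" "q \<le> 2" and F: "continuous_on {0..1} F" and N: "0 < N"
    and B: "\<And>x. x \<in> {0..1} \<Longrightarrow> norm (F x) ^ 2 \<le> 2 * N" and I: "N \<le> integral {0..1} (\<lambda>x. norm (F x) ^ 2)"
  shows "2 * N * 2 powr (- 2 / q) \<le> lpn q F ^ 2"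
proof -
  have int: "(\<lambda>x. norm (F x) powr q) integrable_on {0..1}"
    by (intro integrable_continuous_interval continuous_on_norm_powr F q)
  have "(2 * N) powr (q / 2 - 1) * N \<le> (2 * N) powr (q / 2 - 1) * integral {0..1} (\<lambda>x. norm (F x) ^ 2)"
    using I by (intro mult_left_mono) auto
  also have "\<dots> = integral {0..1} (\<lambda>x. (2 * N) powr (q / 2 - 1) * norm (F x) ^ 2)" by simp
  also have "\<dots> \<le> integral {0..1} (\<lambda>x. norm (F x) powr q)"
  proof (rule integral_le[OF _ int])
    show "(\<lambda>x. (2 * N) powr (q / 2 - 1) * norm (F x) ^ 2) integrable_on {0..1}"
      by (intro integrable_continuous_interval continuous_intros F)
    fix x :: real assume x: "x \<in> {0..1}"
    show "(2 * N) powr (q / 2 - 1) * norm (F x) ^ 2 \<le> norm (F x) powr q"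
    proof (cases "F x = 0")
      case False
      then have pos: "0 < norm (F x) ^ 2" by simp
      have "(2 * N) powr (q / 2 - 1) \<le> (norm (F x) ^ 2) powr (q / 2 - 1)"
        using q by (intro powr_mono2' pos B x) auto
      then have "(2 * N) powr (q / 2 - 1) * norm (F x) ^ 2 \<le> (norm (F x) ^ 2) powr (q / 2 - 1) * (norm (F x) ^ 2) powr 1"
        using pos by (simp add: mult_right_mono)
      also have "\<dots> = (norm (F x) ^ 2) powr (q / 2)" by (simp only: powr_add[symmetric]) simp
      also have "\<dots> = (norm (F x) powr 2) powr (q / 2)" using False by simp
      also have "\<dots> = norm (F x) powr q" by (simp only: powr_powr) simp
      finally show ?thesis .
    qed simp
  qed
  finally have le: "(2 * N) powr (q / 2 - 1) * N \<le> lpn q F powr q" unfolding lpn_powr[OF q(1) F] .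
  have "(2 * N) powr (q / 2 - 1) * N = (2 * N) powr (q / 2) * 2 powr (-1)"
    using N by (simp add: powr_diff powr_minus_divide)
  with le have "((2 * N) powr (q / 2) * 2 powr (-1)) powr (2 / q) \<le> (lpn q F powr q) powr (2 / q)"
    using q by (intro powr_mono2) auto
  moreover have "((2 * N) powr (q / 2) * 2 powr (-1)) powr (2 / q) = 2 * N * 2 powr (- 2 / q)"
    by (simp only: powr_mult[of "(2 * N) powr (q / 2)"] powr_powr) (use q N in simp)
  moreover have "(lpn q F powr q) powr (2 / q) = lpn q F ^ 2"
    using q lpn_nonneg[of q F] by (cases "lpn q F = 0") (simp_all add: powr_powr)
  ultimately show ?thesis by simp
qed

text \<open>With \<open>N\<close> terms, the norm at \<open>u = 1\<close> is of order at most
  \<open>N powr \<theta>\<close> with \<theta> < 1/2, whereas at \<open>u = -1\<close> a flat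
  polynomial has norms of order \<open>sqrt N\<close> for \<open>p\<close> and \<open>q\<close>
  alike. So the left side of the gap grows more slowly than \<open>N\<close>, and the right side at
  least like \<open>N\<close>.\<close>

lemma majorant_gap_below_two:
  assumes ord: "0 < s" "s < q" "q < p" "p < 2"
  obtains P where "nnpoly2 P"
    "lpn p (\<lambda>x. P (circ x) 1) * lpn p (\<lambda>x. P (circ x) (-1)) < lpn q (\<lambda>x. P (circ x) (-1)) ^ 2"
    "lpn s (\<lambda>x. P (circ x) (-1)) < lpn q (\<lambda>x. P (circ x) (-1))"
proof -
  have p0: "0 < p" "0 < q" using ord by auto
  have "1 / 2 < 1 / p" using ord p0 by (intro divide_strict_left_mono) auto
  then have "max 0 (1 - 1 / p) < 1/2" by linarith
  \<comment> \<open>Above \<open>1 - 1 / p\<close> for integrability and below 1/2 for slow growth;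
    both are possible because \<open>p < 2\<close>.\<close>
  then obtain \<theta> where \<theta>: "max 0 (1 - 1 / p) < \<theta>" "\<theta> < 1/2" using dense by blast
  have "(1 - \<theta>) * p < (1 / p) * p" using \<theta> p0 by (intro mult_strict_right_mono) auto
  then have \<theta>p: "(1 - \<theta>) * p < 1" using p0 by simp
  have th: "0 \<le> \<theta>" "\<theta> \<le> 1" using \<theta> by auto
  obtain C where C: "C > 0" "\<And>N. 0 < N \<Longrightarrow> lpn p (\<lambda>x. \<Sum>n<N. circ x ^ n) \<le> C * real N powr \<theta>"
    using dirichlet_lp_bound[OF p0(1) th \<theta>p] by blast
  \<comment> \<open>The value that \<open>N powr (\<theta> - 1/2)\<close> must undercut for the gap,
    found by comparing \<open>C * N powr \<theta> * sqrt (2 * N)\<close> with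
    \<open>2 * N * 2 powr (- 2 / q)\<close>.\<close>
  define \<eta> where "\<eta> = 2 powr (1/2) * 2 powr (- 2 / q) / C"
  have \<eta>: "\<eta> > 0" using C by (simp add: \<eta>_def)
  have "(2::real) powr (\<theta> - 1/2) < 2 powr 0" using \<theta> by (intro powr_less_mono) auto
  then have lt1: "(2::real) powr (\<theta> - 1/2) < 1" by simp
  then obtain k0 where k0: "(2 powr (\<theta> - 1/2)) ^ k0 < \<eta>" using real_arch_pow_inv[OF \<eta>] by blast
  \<comment> \<open>Odd for the sake of \<open>rudin_shapiro_zeros\<close>, and at least
    \<open>k0\<close>, so the power of a base below 1 stays under \<eta>.\<close>
  define k where "k = 2 * k0 + 1"
  define N where "N = (2::real) ^ k"
  have N: "N > 0" "real (2 ^ k) = N" by (simp_all add: N_def)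
  have "N powr (\<theta> - 1/2) = (2 powr (\<theta> - 1/2)) ^ k"
    by (simp add: N_def powr_realpow[symmetric] powr_powr mult.commute)
  also have "\<dots> \<le> (2 powr (\<theta> - 1/2)) ^ k0" using lt1 by (intro power_decreasing) (auto simp: k_def)
  finally have N\<eta>: "N powr (\<theta> - 1/2) < \<eta>" using k0 by simp
  define F where "F b x = (if b then fst (rudin_shapiro k (circ x) (-1)) else snd (rudin_shapiro k (circ x) (-1)))" for b x
  define P where "P b w u = (if b then fst (rudin_shapiro k w u) else snd (rudin_shapiro k w u))" for b w u
  have Pnn: "nnpoly2 (P b)" for b unfolding P_def using nnpoly2_rudin_shapiro by (cases b) simp_all
  have PF: "(\<lambda>x. P b (circ x) (-1)) = F b" for b by (simp add: P_def F_def fun_eq_iff)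
  have P1: "P b (circ x) 1 = (\<Sum>n<2 ^ k. circ x ^ n)" for b x by (simp add: P_def rudin_shapiro_one)
  have Fc: "continuous_on {0..1} (F b)" for b
    unfolding PF[symmetric] by (intro continuous_on_nnpoly2[OF Pnn] continuous_intros)
  have par: "norm (F True x) ^ 2 + norm (F False x) ^ 2 = 2 * N" for x
    using rudin_shapiro_parallelogram[of "circ x" k] by (simp add: F_def N_def)
  have F2: "norm (F b x) ^ 2 \<le> 2 * N" for b x
  proof -
    have "norm (F True x) ^ 2 \<le> 2 * N" "norm (F False x) ^ 2 \<le> 2 * N"
      using par[of x] zero_le_power2[of "norm (F True x)"] zero_le_power2[of "norm (F False x)"] by linarith+
    then show ?thesis by (cases b) simp_all
  qed
  have sqint: "(\<lambda>x. norm (F b x) ^ 2) integrable_on {0..1}" for b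
    by (intro integrable_continuous_interval continuous_intros Fc)
  have "integral {0..1} (\<lambda>x. norm (F True x) ^ 2) + integral {0..1} (\<lambda>x. norm (F False x) ^ 2)
      = integral {0..1} (\<lambda>x. norm (F True x) ^ 2 + norm (F False x) ^ 2)"
    by (rule integral_add[OF sqint sqint, symmetric])
  also have "\<dots> = 2 * N" unfolding par by simp
  finally have "N \<le> integral {0..1} (\<lambda>x. norm (F True x) ^ 2) \<or> N \<le> integral {0..1} (\<lambda>x. norm (F False x) ^ 2)" by linarith
  then obtain b where b: "N \<le> integral {0..1} (\<lambda>x. norm (F b x) ^ 2)" by blast
  have low: "2 * N * 2 powr (- 2 / q) \<le> lpn q (F b) ^ 2"
    by (rule lpn_lower_bound_from_square[OF p0(2) _ Fc N(1) F2 b]) (use ord in simp)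
  have up: "lpn p (F b) \<le> sqrt (2 * N)"
    by (rule lpn_sup_bound[OF p0(1) Fc]) (use F2 N in \<open>auto intro: real_le_rsqrt\<close>)
  have dir: "lpn p (\<lambda>x. P b (circ x) 1) \<le> C * N powr \<theta>" unfolding P1 using C(2)[of "2 ^ k"] by (simp add: N_def)
  have "lpn p (\<lambda>x. P b (circ x) 1) * lpn p (F b) \<le> (C * N powr \<theta>) * sqrt (2 * N)"
    using dir up C N lpn_nonneg by (intro mult_mono) auto
  also have "sqrt (2 * N) = 2 powr (1/2) * N powr (1/2)" using N by (simp add: powr_half_sqrt real_sqrt_mult)
  also have "C * N powr \<theta> * (2 powr (1/2) * N powr (1/2)) = C * 2 powr (1/2) * N * N powr (\<theta> - 1/2)"
  proof -
    have "N powr \<theta> * N powr (1/2) = N powr 1 * N powr (\<theta> - 1/2)" by (simp only: powr_add[symmetric]) (simp add: add.commute)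
    then show ?thesis using N by (simp add: mult_ac)
  qed
  also have "\<dots> < C * 2 powr (1/2) * N * \<eta>" using N\<eta> C N by (intro mult_strict_left_mono) auto
  also have "\<dots> = (2 powr (1/2) * 2 powr (1/2)) * N * 2 powr (- 2 / q)" using C by (simp add: \<eta>_def)
  also have "2 powr (1/2) * 2 powr (1/2) = (2::real)" by (simp only: powr_add[symmetric]) simp
  finally have gap: "lpn p (\<lambda>x. P b (circ x) 1) * lpn p (F b) < lpn q (F b) ^ 2" using low by simp
  have "circ 0 = 1" "circ (1/2) = -1" by (simp_all add: circ_def)
  then have zero: "\<exists>x0\<in>{0..1}. F b x0 = 0"
    using rudin_shapiro_zeros[of k0] unfolding k_def[symmetric]
    by (cases b) (auto simp: F_def intro: bexI[of _ 0] bexI[of _ "1/2"])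
  have "\<exists>x1\<in>{0..1}. F b x1 \<noteq> 0"
  proof (rule ccontr)
    assume "\<not> ?thesis"
    then have "integral {0..1} (\<lambda>x. norm (F b x) ^ 2) = integral {0..1} (\<lambda>x::real. 0::real)" by (intro integral_cong) auto
    then show False using b N by simp
  qed
  with zero obtain x0 x1 where x: "x0 \<in> {0..1}" "x1 \<in> {0..1}" "norm (F b x0) \<noteq> norm (F b x1)" by force
  have "lpn s (F b) < lpn q (F b)" by (rule lpn_strict_mono[OF ord(1,2) Fc x])
  then show ?thesis using gap Pnn by (intro that[of "P b"]) (auto simp: PF)
qed

lemma Lp_on_unit_mono:
  assumes "0 < a" "a \<le> b" "Lp_on {0..1} b f"
  shows "Lp_on {0..1} a f"
proof -
  have m: "f \<in> borel_measurable (lebesgue_on {0..1})"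
    and i: "integrable (lebesgue_on {0..1}) (\<lambda>t. norm (f t) powr b)" using assms by (auto simp: Lp_on_def)
  have "integrable (lebesgue_on {0..1}) (\<lambda>t. 1 + norm (f t) powr b)"
    using i integrable_const_lebesgue_on_unit(1) by (intro Bochner_Integration.integrable_add)
  then have "integrable (lebesgue_on {0..1}) (\<lambda>t. norm (f t) powr a)"
  proof (rule Bochner_Integration.integrable_bound)
    show "(\<lambda>t. norm (f t) powr a) \<in> borel_measurable (lebesgue_on {0..1})" using m by measurable
    show "AE t in lebesgue_on {0..1}. norm (norm (f t) powr a) \<le> norm (1 + norm (f t) powr b)"
    proof (rule AE_I2)
      fix t :: real
      have "norm (f t) powr a \<le> 1 + norm (f t) powr b"
      proof (cases "norm (f t) \<le> 1")
        case True
        then have "norm (f t) powr a \<le> 1 powr a" using assms by (intro powr_mono2) auto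
        then show ?thesis by (simp add: add_increasing2)
      next
        case False
        then have "norm (f t) powr a \<le> norm (f t) powr b" using assms by (intro powr_mono) auto
        then show ?thesis by simp
      qed
      then show "norm (norm (f t) powr a) \<le> norm (1 + norm (f t) powr b)" by simp
    qed
  qed
  then show ?thesis using m by (simp add: Lp_on_def)
qed

theorem theorem5:
  shows "(\<forall>(p::real) (l::nat). p > 2 \<and> (\<forall>k::nat. p \<noteq> 2 * real k)
            \<and> 2 * real l < p \<and> p < 2 * (real l + 1) \<longrightarrow>
          (\<exists>q0 < p. \<forall>U. torus_sym_open U \<longrightarrow> (\<forall>q > q0.
             \<exists>f. positive_definite f \<and> Lp_on {0..1} (2 * real l) f
               \<and> (\<forall>n<0. fourier_coeff f n = 0)
               \<and> \<not> Lp_on {0..1} q f \<and> Lp_on ({0..1} - U) p f)))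
       \<and> (\<forall>(p::real) U s q. 0 < p \<and> p < 2 \<and> torus_sym_open U \<and> 0 < s \<and> s < q \<and> q < p \<longrightarrow>
          (\<exists>c. in_Hardy s c \<and> (\<forall>n. Im (c n) = 0 \<and> Re (c n) \<ge> 0) \<and> \<not> in_Hardy q c
              \<and> (\<exists>g. boundary_value c g \<and> Lp_on ({0..1} - U) p g)))"
proof (intro conjI allI impI)
  fix p :: real and l :: nat
  assume "p > 2 \<and> (\<forall>k::nat. p \<noteq> 2 * real k) \<and> 2 * real l < p \<and> p < 2 * (real l + 1)"
  then have p: "2 < p" "2 * real l < p" "p < 2 * (real l + 1)" by auto
  then have l1: "1 \<le> 2 * real l" by (cases l) auto
  obtain P q0 where P: "nnpoly2 P" "2 * real l < q0" "q0 < p"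
    "lpn p (\<lambda>x. P (circ x) 1) * lpn p (\<lambda>x. P (circ x) (-1)) < lpn q0 (\<lambda>x. P (circ x) (-1)) ^ 2"
    "lpn (2 * real l) (\<lambda>x. P (circ x) (-1)) < lpn q0 (\<lambda>x. P (circ x) (-1))"
    by (rule majorant_gap_not_even[OF p])
  show "\<exists>q0<p. \<forall>U. torus_sym_open U \<longrightarrow> (\<forall>q > q0.
             \<exists>f. positive_definite f \<and> Lp_on {0..1} (2 * real l) f
               \<and> (\<forall>n<0. fourier_coeff f n = 0)
               \<and> \<not> Lp_on {0..1} q f \<and> Lp_on ({0..1} - U) p f)"
  \<comment> \<open>\<open>P\<close> and \<open>q0\<close> are fixed before \<open>U\<close> enters.
    Larger \<open>q\<close> follow from \<open>q0\<close> because the interval has finite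
    measure.\<close>
  proof (intro exI[of _ q0] conjI allI impI)
    fix U q assume U: "torus_sym_open U" and q: "q0 < q"
    obtain f where f: "positive_definite f" "Lp_on {0..1} (2 * real l) f"
      "\<forall>n<0. fourier_coeff f n = 0" "\<not> Lp_on {0..1} q0 f" "Lp_on ({0..1} - U) p f"
      using positive_definite_counterexample[OF P(1) l1 P(2,3) U P(4,5)] by blast
    have "\<not> Lp_on {0..1} q f" using Lp_on_unit_mono[of q0 q f] P(2) l1 q f(4) by auto
    then show "\<exists>f. positive_definite f \<and> Lp_on {0..1} (2 * real l) f
               \<and> (\<forall>n<0. fourier_coeff f n = 0)
               \<and> \<not> Lp_on {0..1} q f \<and> Lp_on ({0..1} - U) p f" using f by blast
  qed (rule P(3))
next
  fix p :: real and U s q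
  assume a: "0 < p \<and> p < 2 \<and> torus_sym_open U \<and> 0 < s \<and> s < q \<and> q < p"
  then have ord: "0 < s" "s < q" "q < p" "p < 2" and U: "torus_sym_open U" by auto
  obtain P where P: "nnpoly2 P"
    "lpn p (\<lambda>x. P (circ x) 1) * lpn p (\<lambda>x. P (circ x) (-1)) < lpn q (\<lambda>x. P (circ x) (-1)) ^ 2"
    "lpn s (\<lambda>x. P (circ x) (-1)) < lpn q (\<lambda>x. P (circ x) (-1))"
    by (rule majorant_gap_below_two[OF ord])
  show "\<exists>c. in_Hardy s c \<and> (\<forall>n. Im (c n) = 0 \<and> Re (c n) \<ge> 0) \<and> \<not> in_Hardy q c
              \<and> (\<exists>g. boundary_value c g \<and> Lp_on ({0..1} - U) p g)"
    by (rule Hardy_counterexample[OF P(1) ord(1-3) U P(2,3)])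
qed

end
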